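(* Let $\Omega$ be an open bounded convex subset of $\mathbb{R}^n$, and let $u$ be a variational infinity ground state in $\Omega$. Assume that $u$ is of class $C^1$ on $\{x\in\overline\Omega:\ d_{\partial\Omega}(x)<\delta\}$ for some $\delta>0$. If there exists a positive constant $c$ such that $|\nabla u| = c$ on $\partial\Omega$, then $c=\Lambda_\infty$, $u = c\, d_{\partial\Omega}$, and $\Omega$ is a stadium-like domain.
   Context: $d_{\partial\Omega}$ denotes the distance function from $\partial\Omega$. For $p>1$, $u_p$ denotes the first Dirichlet eigenfunction of the $p$-Laplacian on $\Omega$, i.e. the unique (positive) minimizer of $\Lambda_p=\inf\{\int_\Omega|\nabla v|^p/\int_\Omega|v|^p:\ v\in W^{1,p}_0(\Omega),\ \int_\Omega|v|^p=1\}$ (extended by $0$ to $\overline\Omega$). A function $u:\Omega\to\mathbb{R}$ is a variational infinity ground state if there is a sequence $p_j\to+\infty$ with $u_{p_j}\to u$ uniformly in $\overline\Omega$. $\Lambda_\infty:=\lim_p\Lambda_p=(\max_{\overline\Omega}d_{\partial\Omega})^{-1}$. Let $\Sigma(\Omega)$ be the set of points of $\Omega$ where $d_{\partial\Omega}$ is not differentiable; the cut locus $\overline{\Sigma}(\Omega)$ is the closure of $\Sigma(\Omega)$ in $\overline\Omega$, and the high ridge is the set of points of $\overline\Omega$ where $d_{\partial\Omega}$ attains its maximum. $\Omega$ is called a stadium-like domain if its cut locus coincides with its high ridge. *)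

theory Defs
  imports "HOL-Analysis.Analysis"
begin

definition dist_bd :: "'a::euclidean_space set \<Rightarrow> 'a \<Rightarrow> real" where
  "dist_bd \<Omega> x = infdist x (frontier \<Omega>)"

definition test_C1 :: "'a::euclidean_space set \<Rightarrow> ('a \<Rightarrow> real) \<Rightarrow> ('a \<Rightarrow> 'a) \<Rightarrow> bool" where
  "test_C1 \<Omega> f Df \<longleftrightarrow>
     continuous_on UNIV Df \<and>
     (\<forall>x. (f has_derivative (\<lambda>h. Df x \<bullet> h)) (at x)) \<and>
     compact (closure {x. f x \<noteq> 0}) \<and> closure {x. f x \<noteq> 0} \<subseteq> \<Omega>"

text \<open>v belongs to W^{1,p}_0(Omega) with weak gradient g: v is the limit in the
  W^{1,p} norm of compactly supported C^1 functions in Omega.\<close>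
definition W0_grad :: "real \<Rightarrow> 'a::euclidean_space set \<Rightarrow> ('a \<Rightarrow> real) \<Rightarrow> ('a \<Rightarrow> 'a) \<Rightarrow> bool" where
  "W0_grad p \<Omega> v g \<longleftrightarrow>
     v \<in> borel_measurable lborel \<and> g \<in> borel_measurable lborel \<and>
     integrable lborel (\<lambda>x. \<bar>v x\<bar> powr p) \<and>
     integrable lborel (\<lambda>x. norm (g x) powr p) \<and>
     (\<exists>\<phi> D\<phi>. (\<forall>k. test_C1 \<Omega> (\<phi> k) (D\<phi> k)) \<and>
        (\<lambda>k. LINT x|lborel. \<bar>\<phi> k x - v x\<bar> powr p) \<longlonglongrightarrow> 0 \<and>
        (\<lambda>k. LINT x|lborel. norm (D\<phi> k x - g x) powr p) \<longlonglongrightarrow> 0)"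

text \<open>First Dirichlet eigenvalue of the p-Laplacian (infimum of the Rayleigh quotient).\<close>
definition Lambda_p :: "real \<Rightarrow> 'a::euclidean_space set \<Rightarrow> real" where
  "Lambda_p p \<Omega> = Inf {LINT x|lborel. norm (g x) powr p | v g.
       W0_grad p \<Omega> v g \<and> (LINT x|lborel. \<bar>v x\<bar> powr p) = 1}"

text \<open>u is the (positive, normalized) first Dirichlet eigenfunction of the p-Laplacian,
  i.e. a positive minimizer, taken continuous on the closure and extended by 0.\<close>
definition first_eigenfunction :: "real \<Rightarrow> 'a::euclidean_space set \<Rightarrow> ('a \<Rightarrow> real) \<Rightarrow> bool" where
  "first_eigenfunction p \<Omega> u \<longleftrightarrow>
     (\<exists>g. W0_grad p \<Omega> u g \<and> (LINT x|lborel. \<bar>u x\<bar> powr p) = 1 \<and>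
          (LINT x|lborel. norm (g x) powr p) = Lambda_p p \<Omega>) \<and>
     (\<forall>x\<in>\<Omega>. u x > 0) \<and> (\<forall>x. x \<notin> \<Omega> \<longrightarrow> u x = 0) \<and>
     continuous_on (closure \<Omega>) u"

definition variational_inf_ground_state :: "'a::euclidean_space set \<Rightarrow> ('a \<Rightarrow> real) \<Rightarrow> bool" where
  "variational_inf_ground_state \<Omega> u \<longleftrightarrow>
     (\<exists>p U. (\<forall>j. p j > 1 \<and> first_eigenfunction (p j) \<Omega> (U j)) \<and>
            filterlim p at_top sequentially \<and>
            uniform_limit (closure \<Omega>) U u sequentially)"

definition Lambda_inf :: "'a::euclidean_space set \<Rightarrow> real" where
  "Lambda_inf \<Omega> = 1 / (SUP x\<in>closure \<Omega>. dist_bd \<Omega> x)"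

definition cut_locus :: "'a::euclidean_space set \<Rightarrow> 'a set" where
  "cut_locus \<Omega> = closure {x\<in>\<Omega>. \<not> (dist_bd \<Omega> differentiable (at x))}"

definition high_ridge :: "'a::euclidean_space set \<Rightarrow> 'a set" where
  "high_ridge \<Omega> = {x\<in>closure \<Omega>. dist_bd \<Omega> x = (SUP y\<in>closure \<Omega>. dist_bd \<Omega> y)}"

definition stadium_like :: "'a::euclidean_space set \<Rightarrow> bool" where
  "stadium_like \<Omega> \<longleftrightarrow> cut_locus \<Omega> = high_ridge \<Omega>"

end

theory Submission
  imports Defs
begin

text \<open>
  Write \<open>R\<close> for the inradius. Testing the Rayleigh quotient with a smoothed cone over an inscribed ball
  gives \<open>limsup Lambda_p^(1/p) \<le> 1/R\<close>, so \<open>u\<close> is \<open>1/R\<close>-Lipschitz and attains the value \<open>1\<close> on the high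
  ridge. On the segment from such a maximum point to a nearest boundary point \<open>u\<close> is therefore affine with
  slope \<open>1/R\<close>, whence \<open>c = 1/R\<close>.

  Fix a boundary point \<open>y\<close> with inner normal \<open>\<nu>\<close> and \<open>r < R\<close>. If \<open>u < r/R\<close> held on the ball of radius \<open>r\<close>
  around \<open>y\<close>, then a radial, slightly concave function of slope just below \<open>c\<close>, centred a little outside
  \<open>\<Omega>\<close> near \<open>y\<close>, would be a strict supersolution of the eigenvalue equation for large \<open>p\<close> wherever the
  eigenfunction exceeds it, because its slope is larger than \<open>u/R\<close> there. Minimality of the eigenfunction
  then places \<open>u\<close> below this barrier, which contradicts the normal derivative \<open>c\<close> at \<open>y\<close>. Letting \<open>r\<close> tend
  to \<open>R\<close>, the point \<open>y + R \<nu>\<close> lies on the high ridge and \<open>u = 1\<close> there. Every point of \<open>\<Omega>\<close> lies on such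
  a segment, which yields \<open>u = c d\<close>, and off the high ridge \<open>d\<close> is squeezed between the distance from \<open>y\<close>
  and \<open>R\<close> minus the distance from \<open>y + R \<nu>\<close>, hence differentiable.
\<close>

section \<open>Convexity of powers and convergence in the mean\<close>

text \<open>The eigenfunctions enter only as limits in the mean of test functions, without an
  Euler-Lagrange equation or gradient regularity. Integral inequalities are therefore proved for
  test functions and passed to the limit, and comparison with a barrier tests minimality directly: a
  smoothed minimum of eigenfunction and barrier is the competitor, and convexity of the p-th power
  moves all derivatives onto the barrier. For the same reason the Lipschitz bound comes from
  averages over boxes. A barrier slope above \<open>u / R\<close> suffices for large
  \<open>p\<close>: relative to the (p-1)-th power of the slope, the exponential radial profile
  contributes minus a positive multiple of p-1, which outweighs the bounded curvature term, while
  the eigenvalue term is a ratio below 1 raised to the power p-1, up to a bounded factor. The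
  comparison is global, so the barrier must also dominate the eigenfunction far from
  \<open>y\<close>. The boundary is not assumed smooth: convexity keeps rays from boundary points to
  inner points in \<Omega>, and the normal is read off from the gradient of
  \<open>u\<close>.\<close>

lemma powr_above_tangent:
  fixes s t p :: real
  assumes "s \<ge> 0" "t > 0" "p \<ge> 1"
  shows "t powr p + p * t powr (p - 1) * (s - t) \<le> s powr p"
proof (cases "s = 0")
  \<comment> \<open>Convexity and differentiability are used on the open half line only, so the
    endpoint is computed directly.\<close>
  case True
  have "t powr p = t powr (p - 1) * t"
    using assms by (simp add: powr_diff)
  then have "t powr p + p * t powr (p - 1) * (s - t) = (1 - p) * t powr p"
    using True by (simp add: algebra_simps)
  then show ?thesis using assms True by (simp add: mult_nonpos_nonneg)
next
  case False
  have "((\<lambda>x. x powr p) has_real_derivative p * t powr (p - 1)) (at t within {0<..})"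
    using has_field_derivative_at_within[OF has_real_derivative_powr[OF \<open>t > 0\<close>]] .
  then have "s powr p - t powr p \<ge> p * t powr (p - 1) * (s - t)"
    using convex_on_imp_above_tangent[OF powr_convex[OF assms(3)], of t s "p * t powr (p - 1)"]
      assms False by (simp add: interior_open)
  then show ?thesis by simp
qed

text \<open>Two tangent inequalities at the mean \<open>m\<close>, weighted by \<open>1 - s\<close>
  and \<open>s\<close>: their linear parts cancel.\<close>

lemma powr_convex_combination:
  fixes x y s p :: real
  assumes "x \<ge> 0" "y \<ge> 0" "0 \<le> s" "s \<le> 1" "p \<ge> 1"
  shows "((1 - s) * x + s * y) powr p \<le> (1 - s) * x powr p + s * y powr p"
proof (cases "(1 - s) * x + s * y = 0")
  case False
  define m where "m = (1 - s) * x + s * y"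
  have m: "m > 0" using False assms by (simp add: m_def order_less_le)
  define q where "q = p * m powr (p - 1)"
  have "(1 - s) * (m powr p + q * (x - m)) \<le> (1 - s) * x powr p"
    "s * (m powr p + q * (y - m)) \<le> s * y powr p"
    unfolding q_def using powr_above_tangent[of _ m p] assms m by (auto intro!: mult_left_mono)
  moreover have "(1 - s) * (m powr p + q * (x - m)) + s * (m powr p + q * (y - m))
      = m powr p + q * ((1 - s) * x + s * y - m)" by (simp add: algebra_simps)
  ultimately show ?thesis unfolding m_def[symmetric] by (simp add: m_def[symmetric])
qed (use assms in simp)

lemma norm_powr_convex_combination:
  fixes a b :: "'b::real_normed_vector"
  assumes "0 \<le> s" "s \<le> 1" "p \<ge> 1"
  shows "norm ((1 - s) *\<^sub>R a + s *\<^sub>R b) powr p \<le> (1 - s) * norm a powr p + s * norm b powr p"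
proof -
  have "norm ((1 - s) *\<^sub>R a + s *\<^sub>R b) \<le> (1 - s) * norm a + s * norm b"
    using norm_triangle_ineq[of "(1 - s) *\<^sub>R a" "s *\<^sub>R b"] assms by simp
  then have "norm ((1 - s) *\<^sub>R a + s *\<^sub>R b) powr p \<le> ((1 - s) * norm a + s * norm b) powr p"
    using assms by (intro powr_mono2) auto
  also have "\<dots> \<le> (1 - s) * norm a powr p + s * norm b powr p"
    by (intro powr_convex_combination) (use assms in auto)
  finally show ?thesis .
qed

text \<open>The vector \<open>(p * norm b powr (p - 2)) *\<^sub>R b\<close> is the gradient of the
  p-th power of the norm at \<open>b\<close>. Cauchy-Schwarz reduces the claim to the scalar tangent
  inequality.\<close>

lemma norm_powr_above_tangent:
  fixes a b :: "'b::real_inner"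
  assumes "b \<noteq> 0" "p \<ge> 1"
  shows "norm b powr p + p * norm b powr (p - 2) * (b \<bullet> (a - b)) \<le> norm a powr p"
proof -
  have "b \<bullet> (a - b) \<le> norm b * (norm a - norm b)"
    using Cauchy_Schwarz_ineq2[of b a]
    by (simp add: inner_diff_right algebra_simps power2_norm_eq_inner[symmetric] power2_eq_square)
  then have "p * norm b powr (p - 2) * (b \<bullet> (a - b))
      \<le> p * norm b powr (p - 2) * (norm b * (norm a - norm b))"
    using assms by (intro mult_left_mono) auto
  also have "p * norm b powr (p - 2) * (norm b * (norm a - norm b)) = p * (norm b powr (p - 2) * norm b) * (norm a - norm b)"
    by simp
  also have "norm b powr (p - 2) * norm b = norm b powr (p - 1)"
    using assms powr_mult_base[of "norm b" "p - 2"] by (simp add: mult.commute)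
  finally have "p * norm b powr (p - 2) * (b \<bullet> (a - b)) \<le> p * norm b powr (p - 1) * (norm a - norm b)" .
  then show ?thesis using powr_above_tangent[of "norm a" "norm b" p] assms(1) \<open>p \<ge> 1\<close> norm_ge_zero[of a]
    unfolding zero_less_norm_iff[symmetric] by linarith
qed

text \<open>Stands in for Minkowski's inequality: \<open>a\<close> is a convex combination of
  \<open>b /\<^sub>R (1 - s)\<close> and \<open>(a - b) /\<^sub>R s\<close>. For small
  \<open>s\<close> the first factor is close to 1; the second may be huge, which is harmless in
  front of an error tending to 0.\<close>

lemma norm_powr_split:
  fixes a b :: "'b::real_normed_vector"
  assumes "0 < s" "s < 1" "p \<ge> 1"
  shows "norm a powr p \<le> (1 - s) powr (1 - p) * norm b powr p + s powr (1 - p) * norm (a - b) powr p"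
proof -
  have e: "r * (x / r) powr p = r powr (1 - p) * x powr p" if "r > 0" "x \<ge> 0" for r x :: real
    using that by (simp add: powr_divide powr_diff field_simps)
  have "a = (1 - s) *\<^sub>R (b /\<^sub>R (1 - s)) + s *\<^sub>R ((a - b) /\<^sub>R s)" using assms by simp
  then have "norm a powr p \<le> (1 - s) * norm (b /\<^sub>R (1 - s)) powr p + s * norm ((a - b) /\<^sub>R s) powr p"
    using norm_powr_convex_combination[of s p "b /\<^sub>R (1 - s)" "(a - b) /\<^sub>R s"] assms by simp
  also have "\<dots> = (1 - s) * (norm b / (1 - s)) powr p + s * (norm (a - b) / s) powr p"
    using assms by (simp add: divide_inverse mult.commute)
  finally show ?thesis using e[of "1 - s" "norm b"] e[of s "norm (a - b)"] assms by simp
qed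

text \<open>Stands in for Hoelder's inequality. The level \<open>l\<close> stays free, and the
  Lipschitz bound will choose it slightly above the p-th root of the eigenvalue.\<close>

lemma le_add_powr:
  fixes a l p :: real
  assumes "a \<ge> 0" "l > 0" "p \<ge> 1"
  shows "a \<le> l + l powr (1 - p) * a powr p"
proof (cases "a \<le> l")
  case True then show ?thesis using assms by (simp add: add_increasing2)
next
  case False
  then have "l powr (p - 1) * a \<le> a powr (p - 1) * a"
    using assms by (intro mult_right_mono powr_mono2) auto
  also have "\<dots> = a powr p" using False assms by (simp add: powr_diff)
  finally have "l powr (1 - p) * (l powr (p - 1) * a) \<le> l powr (1 - p) * a powr p"
    by (intro mult_left_mono) auto
  also have "l powr (1 - p) * (l powr (p - 1) * a) = a"
    using assms by (simp add: powr_add[symmetric] mult.assoc[symmetric])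
  finally show ?thesis using assms by simp
qed

section \<open>Integrals of p-th powers of norms\<close>

lemma integrable_norm_powr_diff:
  fixes f g :: "'m \<Rightarrow> 'b::{banach, second_countable_topology}"
  assumes [measurable]: "f \<in> borel_measurable M" "g \<in> borel_measurable M"
    and "integrable M (\<lambda>x. norm (f x) powr p)" "integrable M (\<lambda>x. norm (g x) powr p)" "p \<ge> 1"
  shows "integrable M (\<lambda>x. norm (f x - g x) powr p)"
proof (rule Bochner_Integration.integrable_bound)
  show "integrable M (\<lambda>x. (1/2) powr (1 - p) * norm (f x) powr p + (1/2) powr (1 - p) * norm (g x) powr p)"
    using assms by auto
  show "AE x in M. norm (norm (f x - g x) powr p)
      \<le> norm ((1/2) powr (1 - p) * norm (f x) powr p + (1/2) powr (1 - p) * norm (g x) powr p)"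
  proof (intro always_eventually allI)
    fix x
    show "norm (norm (f x - g x) powr p)
      \<le> norm ((1/2) powr (1 - p) * norm (f x) powr p + (1/2) powr (1 - p) * norm (g x) powr p)"
      using norm_powr_split[of "1/2" p "f x - g x" "f x"] assms by simp
  qed
qed measurable

lemma LINT_norm_powr_split:
  fixes f g :: "'m \<Rightarrow> 'b::{banach, second_countable_topology}"
  assumes [measurable]: "f \<in> borel_measurable M" "g \<in> borel_measurable M"
    and "integrable M (\<lambda>x. norm (f x) powr p)" "integrable M (\<lambda>x. norm (g x) powr p)" "p \<ge> 1"
    and "0 < s" "s < 1"
  shows "(LINT x|M. norm (f x) powr p) \<le> (1 - s) powr (1 - p) * (LINT x|M. norm (g x) powr p)
     + s powr (1 - p) * (LINT x|M. norm (f x - g x) powr p)"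
proof -
  have d: "integrable M (\<lambda>x. norm (f x - g x) powr p)"
    using assms by (intro integrable_norm_powr_diff)
  have "(LINT x|M. norm (f x) powr p) \<le>
     (LINT x|M. (1 - s) powr (1 - p) * norm (g x) powr p + s powr (1 - p) * norm (f x - g x) powr p)"
    using assms d norm_powr_split by (intro integral_mono) auto
  then show ?thesis using assms d by simp
qed

text \<open>\<open>LINT_norm_powr_split\<close> is applied in both directions. First
  \<open>s\<close> is fixed so small that the leading factor is close to 1, and only then does
  \<open>k\<close> tend to infinity and remove the error term.\<close>

lemma LINT_norm_powr_tendsto:
  fixes f :: "'m \<Rightarrow> 'b::{banach, second_countable_topology}"
  assumes fk[measurable]: "\<And>k. F k \<in> borel_measurable M" and [measurable]: "f \<in> borel_measurable M"
    and int: "\<And>k. integrable M (\<lambda>x. norm (F k x) powr p)" "integrable M (\<lambda>x. norm (f x) powr p)"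
    and p: "p \<ge> 1"
    and lim: "(\<lambda>k. LINT x|M. norm (F k x - f x) powr p) \<longlonglongrightarrow> 0"
  shows "(\<lambda>k. LINT x|M. norm (F k x) powr p) \<longlonglongrightarrow> (LINT x|M. norm (f x) powr p)"
proof -
  define A where "A = (LINT x|M. norm (f x) powr p)"
  define B where "B k = (LINT x|M. norm (F k x) powr p)" for k
  define E where "E k = (LINT x|M. norm (F k x - f x) powr p)" for k
  have up: "B k \<le> (1 - s) powr (1 - p) * A + s powr (1 - p) * E k" if "0 < s" "s < 1" for k s
    unfolding A_def B_def E_def using int p that by (intro LINT_norm_powr_split) auto
  have lo: "A \<le> (1 - s) powr (1 - p) * B k + s powr (1 - p) * E k" if "0 < s" "s < 1" for k s
    using LINT_norm_powr_split[of f M "F k" p s] int p that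
    unfolding A_def B_def E_def by (simp add: norm_minus_commute)
  have E0: "E \<longlonglongrightarrow> 0" using lim unfolding E_def .
  have ev: "\<forall>\<^sub>F s in at_right 0. 0 < s \<and> s < (1::real)"
    using eventually_at_right_less[of 0] eventually_at_right_field[of "\<lambda>s. s < 1" "0::real"]
    by (auto simp: eventually_conj_iff intro: exI[of _ 1])
  have c0: "((\<lambda>s. (1 - s) powr q * A) \<longlongrightarrow> A) (at_right 0)" for q
    by (auto intro!: tendsto_eq_intros)
  have "B \<longlonglongrightarrow> A"
  proof (rule order_tendstoI)
    fix a assume "a < A"
    have "\<forall>\<^sub>F s in at_right 0. (0 < s \<and> s < 1) \<and> a < (1 - s) powr (p - 1) * A"
      using ev order_tendstoD(1)[OF c0 \<open>a < A\<close>, of "p - 1"] by (rule eventually_conj)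
    then obtain s where s: "0 < s" "s < 1" "a < (1 - s) powr (p - 1) * A"
      by (metis (mono_tags, lifting) eventually_happens trivial_limit_at_right_real)
    have "(\<lambda>k. (1 - s) powr (p - 1) * (A - s powr (1 - p) * E k)) \<longlonglongrightarrow> (1 - s) powr (p - 1) * (A - s powr (1 - p) * 0)"
      by (intro tendsto_intros E0)
    then have "\<forall>\<^sub>F k in sequentially. a < (1 - s) powr (p - 1) * (A - s powr (1 - p) * E k)"
      using s by (intro order_tendstoD(1)) auto
    then show "\<forall>\<^sub>F k in sequentially. a < B k"
    proof eventually_elim
      case (elim k)
      have "(1 - s) powr (p - 1) * (A - s powr (1 - p) * E k) \<le> (1 - s) powr (p - 1) * ((1 - s) powr (1 - p) * B k)"
        using lo[OF s(1,2), of k] by (intro mult_left_mono) auto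
      also have "\<dots> = B k" using s by (simp add: mult.assoc[symmetric] powr_add[symmetric])
      finally show ?case using elim by simp
    qed
  next
    fix a assume "A < a"
    have "\<forall>\<^sub>F s in at_right 0. (0 < s \<and> s < 1) \<and> (1 - s) powr (1 - p) * A < a"
      using ev order_tendstoD(2)[OF c0 \<open>A < a\<close>, of "1 - p"] by (rule eventually_conj)
    then obtain s where s: "0 < s" "s < 1" "(1 - s) powr (1 - p) * A < a"
      by (metis (mono_tags, lifting) eventually_happens trivial_limit_at_right_real)
    have "(\<lambda>k. (1 - s) powr (1 - p) * A + s powr (1 - p) * E k) \<longlonglongrightarrow> (1 - s) powr (1 - p) * A + s powr (1 - p) * 0"
      by (intro tendsto_intros E0)
    then have "\<forall>\<^sub>F k in sequentially. (1 - s) powr (1 - p) * A + s powr (1 - p) * E k < a"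
      using s by (intro order_tendstoD(2)) auto
    then show "\<forall>\<^sub>F k in sequentially. B k < a"
      by eventually_elim (use up[OF s(1,2)] in \<open>auto intro: le_less_trans\<close>)
  qed
  then show ?thesis unfolding A_def B_def .
qed

lemma set_LINT_norm_le_powr:
  fixes f :: "'m \<Rightarrow> 'b::{banach, second_countable_topology}"
  assumes [measurable]: "f \<in> borel_measurable M" "S \<in> sets M" and fin: "emeasure M S < \<infinity>"
    and int: "integrable M (\<lambda>x. norm (f x) powr p)" and "p \<ge> 1" "l > 0"
  shows "set_integrable M S f"
    and "(LINT x:S|M. norm (f x)) \<le> l * measure M S + l powr (1 - p) * (LINT x|M. norm (f x) powr p)"
proof -
  let ?b = "\<lambda>x. l * indicator S x + l powr (1 - p) * norm (f x) powr p"
  have b: "integrable M ?b" using int fin by (auto intro!: integrable_real_indicator)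
  have le: "norm (indicator S x *\<^sub>R f x) \<le> ?b x" for x
    using le_add_powr[of "norm (f x)" l p] assms by (auto split: split_indicator)
  show i: "set_integrable M S f"
    unfolding set_integrable_def using b le
    by (intro Bochner_Integration.integrable_bound[OF b])
      (auto intro!: always_eventually intro: order_trans[OF _ abs_ge_self])
  have "(LINT x:S|M. norm (f x)) \<le> (LINT x|M. ?b x)"
    unfolding set_lebesgue_integral_def using i b le unfolding set_integrable_def
    by (intro integral_mono) (auto split: split_indicator dest: integrable_norm)
  also have "\<dots> = l * measure M S + l powr (1 - p) * (LINT x|M. norm (f x) powr p)"
    using int fin by (subst Bochner_Integration.integral_add) (auto intro!: integrable_real_indicator)
  finally show "(LINT x:S|M. norm (f x)) \<le> l * measure M S + l powr (1 - p) * (LINT x|M. norm (f x) powr p)" .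
qed

lemma set_LINT_norm_tendsto_0:
  fixes F :: "nat \<Rightarrow> 'm \<Rightarrow> 'b::{banach, second_countable_topology}"
  assumes "\<And>k. F k \<in> borel_measurable M" "S \<in> sets M" "emeasure M S < \<infinity>"
    and "\<And>k. integrable M (\<lambda>x. norm (F k x) powr p)" "p \<ge> 1"
    and lim: "(\<lambda>k. LINT x|M. norm (F k x) powr p) \<longlonglongrightarrow> 0"
  shows "(\<lambda>k. LINT x:S|M. norm (F k x)) \<longlonglongrightarrow> 0"
proof (rule order_tendstoI)
  fix a :: real assume "a < 0"
  moreover have "0 \<le> (LINT x:S|M. norm (F k x))" for k
    unfolding set_lebesgue_integral_def by (intro integral_nonneg_AE) auto
  ultimately show "\<forall>\<^sub>F k in sequentially. a < (LINT x:S|M. norm (F k x))"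
    by (intro always_eventually allI) (rule less_le_trans)
next
  fix a :: real assume a: "0 < a"
  \<comment> \<open>The level part of the bound then stays below \<open>a / 2\<close>; adding 1
    covers null sets.\<close>
  define l where "l = a / (2 * (measure M S + 1))"
  have pos: "measure M S + 1 > 0" by (simp add: add_nonneg_pos)
  then have l: "l > 0" using a by (simp add: l_def)
  have "l * (measure M S + 1) = a / 2" using pos unfolding l_def by (simp add: divide_simps)
  then have lm: "l * measure M S < a" using l a by (simp add: algebra_simps)
  have "(\<lambda>k. l * measure M S + l powr (1 - p) * (LINT x|M. norm (F k x) powr p)) \<longlonglongrightarrow> l * measure M S + l powr (1 - p) * 0"
    by (intro tendsto_intros lim)
  then have "\<forall>\<^sub>F k in sequentially. l * measure M S + l powr (1 - p) * (LINT x|M. norm (F k x) powr p) < a"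
    using lm by (intro order_tendstoD(2)) auto
  then show "\<forall>\<^sub>F k in sequentially. (LINT x:S|M. norm (F k x)) < a"
    by eventually_elim (use set_LINT_norm_le_powr(2)[OF assms(1-5) l] in \<open>auto intro: le_less_trans\<close>)
qed

section \<open>Test functions and integration by parts\<close>

lemma integrable_lborel_compact_support:
  fixes f :: "'a::euclidean_space \<Rightarrow> 'b::{banach, second_countable_topology}"
  assumes "continuous_on UNIV f" "compact S" "\<And>x. x \<notin> S \<Longrightarrow> f x = 0"
  shows "integrable lborel f"
proof -
  have "integrable lborel (\<lambda>x. indicator S x *\<^sub>R f x)"
    using assms by (intro borel_integrable_compact) (auto intro: continuous_on_subset)
  moreover have "(\<lambda>x. indicator S x *\<^sub>R f x) = f"
    using assms by (auto split: split_indicator)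
  ultimately show ?thesis by simp
qed

lemma continuous_on_norm_powr:
  fixes f :: "'a::topological_space \<Rightarrow> 'b::real_normed_vector"
  assumes "continuous_on S f" "p > 0"
  shows "continuous_on S (\<lambda>x. norm (f x) powr p)"
  using assms by (intro continuous_on_powr' continuous_intros) auto

lemma integral_cbox_eq_LINT:
  fixes f :: "'a::euclidean_space \<Rightarrow> real"
  assumes "continuous_on UNIV f" "\<And>x. x \<notin> cbox a b \<Longrightarrow> f x = 0"
  shows "integral (cbox a b) f = (LINT x|lborel. f x)"
proof -
  have i: "(\<lambda>x. indicator (cbox a b) x *\<^sub>R f x) = f"
    using assms by (auto split: split_indicator)
  have "integrable lborel f"
    using assms by (intro integrable_lborel_compact_support[of _ "cbox a b"]) auto
  then have "set_integrable lborel (cbox a b) f" unfolding set_integrable_def i .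
  then have "(LINT x:cbox a b|lborel. f x) = integral (cbox a b) f"
    by (rule set_borel_integral_eq_integral)
  then show ?thesis unfolding set_lebesgue_integral_def i by simp
qed

lemma LINT_lborel_translate:
  fixes f :: "'a::euclidean_space \<Rightarrow> real"
  assumes "f \<in> borel_measurable borel"
  shows "(LINT x|lborel. f (x + e)) = (LINT x|lborel. f x)"
proof -
  have "(LINT x|lborel. f x) = (LINT x|distr lborel borel ((+) e). f x)"
    by (simp add: lborel_distr_plus)
  also have "\<dots> = (LINT x|lborel. f (e + x))"
    using assms by (intro integral_distr) auto
  finally show ?thesis by (simp add: add.commute)
qed

lemma test_C1_continuous:
  assumes "test_C1 \<Omega> f Df"
  shows "continuous_on UNIV f" "continuous_on UNIV Df"
  using assms unfolding test_C1_def
  by (meson continuous_at_imp_continuous_on has_derivative_continuous)+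

lemma test_C1_vanishes:
  assumes "test_C1 \<Omega> f Df" "x \<notin> closure {x. f x \<noteq> 0}"
  shows "f x = 0" "Df x = 0"
proof -
  have z: "f y = 0" if "y \<notin> closure {x. f x \<noteq> 0}" for y
    using that closure_subset[of "{x. f x \<noteq> 0}"] by auto
  then show "f x = 0" using assms by blast
  have "(f has_derivative (\<lambda>h. 0)) (at x)"
  proof (rule has_derivative_transform_within_open[where f="\<lambda>_. 0" and s="- closure {x. f x \<noteq> 0}"])
    show "0 = f y" if "y \<in> - closure {x. f x \<noteq> 0}" for y
      using z[of y] that by (metis ComplD)
    show "x \<in> - closure {x. f x \<noteq> 0}" using assms(2) by blast
  qed (auto simp del: closure_complement)
  moreover have "(f has_derivative (\<lambda>h. Df x \<bullet> h)) (at x)"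
    using assms unfolding test_C1_def by auto
  ultimately have "(\<lambda>h. Df x \<bullet> h) = (\<lambda>h. 0)" by (rule has_derivative_unique[symmetric])
  then show "Df x = 0" by (metis inner_eq_zero_iff)
qed

lemma test_C1_support:
  assumes "test_C1 \<Omega> f Df"
  obtains S where "compact S" "S \<subseteq> \<Omega>" "\<And>x. x \<notin> S \<Longrightarrow> f x = 0" "\<And>x. x \<notin> S \<Longrightarrow> Df x = 0"
  using that[of "closure {x. f x \<noteq> 0}"] assms test_C1_vanishes[OF assms]
  unfolding test_C1_def by blast

text \<open>The open sets \<open>\<Omega>\<close> and \<open>- S\<close> cover the space and
  \<open>f\<close> vanishes on the second, so regularity has to be checked on
  \<open>\<Omega>\<close> only.\<close>

lemma test_C1I:
  fixes f :: "'a::euclidean_space \<Rightarrow> real"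
  assumes "open \<Omega>" "compact S" "S \<subseteq> \<Omega>" "\<And>x. x \<notin> S \<Longrightarrow> f x = 0" "\<And>x. x \<notin> S \<Longrightarrow> Df x = 0"
    and D: "\<And>x. x \<in> \<Omega> \<Longrightarrow> (f has_derivative (\<lambda>h. Df x \<bullet> h)) (at x)"
    and c: "continuous_on \<Omega> Df"
  shows "test_C1 \<Omega> f Df"
proof -
  have oS: "open (- S)" using assms by (simp add: compact_imp_closed open_Compl)
  have sup: "closure {x. f x \<noteq> 0} \<subseteq> S"
    using assms by (intro closure_minimal) (auto simp: compact_imp_closed)
  have "continuous_on (- S) Df"
    using assms(5) by (subst continuous_on_cong[where g="\<lambda>_. 0"]) auto
  then have "continuous_on (\<Omega> \<union> - S) Df" using c oS assms by (intro continuous_on_open_Un)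
  moreover have "\<Omega> \<union> - S = UNIV" using assms by auto
  moreover have "(f has_derivative (\<lambda>h. Df x \<bullet> h)) (at x)" for x
  proof (cases "x \<in> \<Omega>")
    case False
    then have x: "x \<in> - S" using assms by auto
    have "(f has_derivative (\<lambda>h. 0)) (at x)"
      by (rule has_derivative_transform_within_open[where f="\<lambda>_. 0" and s="- S"])
        (use assms x oS in auto)
    then show ?thesis using x assms by simp
  qed (use D in auto)
  moreover have "compact (closure {x. f x \<noteq> 0})"
    using sup assms by (metis closed_closure compact_Int_closed inf.absorb_iff2)
  ultimately show ?thesis using sup assms unfolding test_C1_def by auto
qed

lemma test_C1_integrable:
  assumes "test_C1 \<Omega> f Df" "p > 0"
  shows "integrable lborel f" "integrable lborel (\<lambda>x. norm (f x) powr p)"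
    "integrable lborel (\<lambda>x. norm (Df x) powr p)"
proof -
  obtain S where S: "compact S" "\<And>x. x \<notin> S \<Longrightarrow> f x = 0" "\<And>x. x \<notin> S \<Longrightarrow> Df x = 0"
    using test_C1_support[OF assms(1)] by metis
  note c = test_C1_continuous[OF assms(1)]
  show "integrable lborel f" "integrable lborel (\<lambda>x. norm (f x) powr p)"
    "integrable lborel (\<lambda>x. norm (Df x) powr p)"
    using S c assms(2) by (auto intro!: integrable_lborel_compact_support[of _ S] continuous_on_norm_powr simp del: real_norm_def)
qed

lemma test_C1_measurable:
  assumes "test_C1 \<Omega> f Df"
  shows "f \<in> borel_measurable borel" "Df \<in> borel_measurable borel"
  using test_C1_continuous[OF assms] by (auto intro: borel_measurable_continuous_onI)

section \<open>Translations and the divergence theorem for test functions\<close>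

lemma test_C1_translate_derivative:
  fixes f :: "'a::euclidean_space \<Rightarrow> real"
  assumes t: "test_C1 \<Omega> f Df"
  shows "((\<lambda>s. integral (cbox a b) (\<lambda>x. f (x + s *\<^sub>R e))) has_field_derivative
     integral (cbox a b) (\<lambda>x. Df (x + s *\<^sub>R e) \<bullet> e)) (at s)"
proof (rule leibniz_rule_field_derivative)
  fix s x assume "x \<in> cbox a b"
  have "(f has_derivative (\<lambda>h. Df (x + s *\<^sub>R e) \<bullet> h)) (at (x + s *\<^sub>R e))"
    using t unfolding test_C1_def by auto
  then have "((\<lambda>s. f (x + s *\<^sub>R e)) has_derivative (\<lambda>h. Df (x + s *\<^sub>R e) \<bullet> (h *\<^sub>R e))) (at s)"
    by (rule has_derivative_compose[rotated]) (auto intro!: derivative_eq_intros)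
  then show "((\<lambda>s. f (x + s *\<^sub>R e)) has_field_derivative Df (x + s *\<^sub>R e) \<bullet> e) (at s)"
    unfolding has_field_derivative_def by (simp add: mult_commute_abs)
next
  fix s
  show "(\<lambda>x. f (x + s *\<^sub>R e)) integrable_on cbox a b"
    by (intro integrable_continuous continuous_on_compose2[OF test_C1_continuous(1)[OF t]])
      (auto intro!: continuous_intros)
next
  show "continuous_on (UNIV \<times> cbox a b) (\<lambda>(s, x). Df (x + s *\<^sub>R e) \<bullet> e)"
    unfolding split_beta
    by (intro continuous_intros continuous_on_compose2[OF test_C1_continuous(2)[OF t]]) auto
qed auto

text \<open>By translation invariance the integral of \<open>f (x + s *\<^sub>R e)\<close> does not
  depend on \<open>s\<close>; its derivative at 0 is the integral in question. Leibniz' rule needs a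
  fixed box, so the box is taken large enough to contain the support for all
  \<open>\<bar>s\<bar> < 1\<close>.\<close>

lemma test_C1_LINT_derivative:
  fixes f :: "'a::euclidean_space \<Rightarrow> real"
  assumes t: "test_C1 \<Omega> f Df"
  shows "(LINT x|lborel. Df x \<bullet> e) = 0"
proof -
  obtain S where S: "compact S" "\<And>x. x \<notin> S \<Longrightarrow> f x = 0" "\<And>x. x \<notin> S \<Longrightarrow> Df x = 0"
    using test_C1_support[OF t] by metis
  note c = test_C1_continuous[OF t]
  obtain \<rho> where \<rho>: "S \<subseteq> ball 0 \<rho>" using S(1) bounded_subset_ballD compact_imp_bounded by blast
  obtain a where a: "ball (0::'a) (\<rho> + norm e) \<subseteq> cbox (- a) a"
    using bounded_subset_cbox_symmetric[OF bounded_ball] by metis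
  have out: "x + s *\<^sub>R e \<notin> S" if "x \<notin> cbox (- a) a" "\<bar>s\<bar> < 1" for x s
  proof
    assume "x + s *\<^sub>R e \<in> S"
    then have "norm (x + s *\<^sub>R e) < \<rho>" using \<rho> by auto
    moreover have "norm x \<le> norm (x + s *\<^sub>R e) + norm (s *\<^sub>R e)"
      using norm_triangle_ineq4[of "x + s *\<^sub>R e" "s *\<^sub>R e"] by simp
    moreover have "norm (s *\<^sub>R e) \<le> norm e" using that by (simp add: mult_left_le_one_le)
    ultimately have "x \<in> ball 0 (\<rho> + norm e)" by simp
    then show False using a that by blast
  qed
  have I: "integral (cbox (- a) a) (\<lambda>x. f (x + s *\<^sub>R e)) = (LINT x|lborel. f x)" if "\<bar>s\<bar> < 1" for s
  proof -
    have "integral (cbox (- a) a) (\<lambda>x. f (x + s *\<^sub>R e)) = (LINT x|lborel. f (x + s *\<^sub>R e))"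
      using out[OF _ that] S by (intro integral_cbox_eq_LINT continuous_on_compose2[OF c(1)])
        (auto intro!: continuous_intros)
    then show ?thesis
      using LINT_lborel_translate[OF test_C1_measurable(1)[OF t]] by simp
  qed
  have "((\<lambda>s. LINT x|lborel. f x) has_field_derivative integral (cbox (- a) a) (\<lambda>x. Df x \<bullet> e)) (at (0::real))"
    by (rule has_field_derivative_transform_within_open[of "\<lambda>s. integral (cbox (- a) a) (\<lambda>x. f (x + s *\<^sub>R e))" _ _ "{-1<..<1}"])
      (use test_C1_translate_derivative[OF t, of "-a" a e 0] I in auto)
  then have "integral (cbox (- a) a) (\<lambda>x. Df x \<bullet> e) = 0"
    using DERIV_const DERIV_unique by blast
  moreover have "integral (cbox (- a) a) (\<lambda>x. Df x \<bullet> e) = (LINT x|lborel. Df x \<bullet> e)"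
    using out[of _ 0] S by (intro integral_cbox_eq_LINT continuous_intros c) auto
  ultimately show ?thesis by simp
qed

text \<open>\<open>G i\<close> is the gradient of the component of \<open>F\<close> along
  \<open>i\<close>, so the sum over \<open>Basis\<close> is the divergence of \<open>F\<close>. The
  previous lemma is applied to each product of \<open>f\<close> with a component, and the results
  are added.\<close>

lemma integration_by_parts_test_C1:
  fixes F :: "'a::euclidean_space \<Rightarrow> 'a" and G :: "'a \<Rightarrow> 'a \<Rightarrow> 'a"
  assumes "open \<Omega>" and t: "test_C1 \<Omega> f Df"
    and F: "\<And>x i. x \<in> \<Omega> \<Longrightarrow> i \<in> Basis \<Longrightarrow> ((\<lambda>x. F x \<bullet> i) has_derivative (\<lambda>h. G i x \<bullet> h)) (at x)"
    and G: "\<And>i. i \<in> Basis \<Longrightarrow> continuous_on \<Omega> (G i)"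
  shows "integrable lborel (\<lambda>x. F x \<bullet> Df x)"
    "integrable lborel (\<lambda>x. f x * (\<Sum>i\<in>Basis. G i x \<bullet> i))"
    "(LINT x|lborel. F x \<bullet> Df x) = - (LINT x|lborel. f x * (\<Sum>i\<in>Basis. G i x \<bullet> i))"
proof -
  obtain S where S: "compact S" "S \<subseteq> \<Omega>" "\<And>x. x \<notin> S \<Longrightarrow> f x = 0" "\<And>x. x \<notin> S \<Longrightarrow> Df x = 0"
    using test_C1_support[OF t] by metis
  note c = continuous_on_subset[OF test_C1_continuous(1)[OF t] subset_UNIV]
    continuous_on_subset[OF test_C1_continuous(2)[OF t] subset_UNIV]
  have cF: "continuous_on \<Omega> (\<lambda>x. F x \<bullet> i)" if "i \<in> Basis" for i
    using F[OF _ that] by (meson continuous_at_imp_continuous_on has_derivative_continuous)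
  define D1 where "D1 i x = Df x \<bullet> i * (F x \<bullet> i)" for i x
  define D2 where "D2 i x = f x * (G i x \<bullet> i)" for i x
  have int: "integrable lborel g" if "continuous_on \<Omega> g" "\<And>x. x \<notin> S \<Longrightarrow> g x = 0" for g :: "'a \<Rightarrow> real"
  proof (rule integrable_lborel_compact_support[OF _ S(1) that(2)])
    have oS: "open (- S)" using S by (simp add: compact_imp_closed open_Compl)
    have "continuous_on (- S) g"
      using that(2) by (subst continuous_on_cong[where g="\<lambda>_. 0"]) auto
    then have "continuous_on (\<Omega> \<union> - S) g" using that oS assms by (intro continuous_on_open_Un)
    moreover have "\<Omega> \<union> - S = UNIV" using S by auto
    ultimately show "continuous_on UNIV g" by simp
  qed
  have i1: "integrable lborel (D1 i)" and i2: "integrable lborel (D2 i)" if "i \<in> Basis" for i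
    unfolding D1_def D2_def using S by (auto intro!: int continuous_on_mult continuous_on_inner cF that G c continuous_on_const)
  have zero: "(LINT x|lborel. D1 i x) + (LINT x|lborel. D2 i x) = 0" if i: "i \<in> Basis" for i
  proof -
    define g where "g x = (F x \<bullet> i) *\<^sub>R Df x + f x *\<^sub>R G i x" for x
    define g' where "g' x = (if x \<in> S then g x else 0)" for x
    have gg: "g' x = g x" if "x \<in> \<Omega>" for x using S that unfolding g_def g'_def by auto
    have "test_C1 \<Omega> (\<lambda>x. f x * (F x \<bullet> i)) g'"
    proof (rule test_C1I[OF assms(1) S(1,2)])
      fix x assume x: "x \<in> \<Omega>"
      have "(f has_derivative (\<lambda>h. Df x \<bullet> h)) (at x)" using t unfolding test_C1_def by auto
      then have "((\<lambda>x. f x * (F x \<bullet> i)) has_derivative (\<lambda>h. f x * (G i x \<bullet> h) + (Df x \<bullet> h) * (F x \<bullet> i))) (at x)"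
        by (rule has_derivative_mult) (rule F[OF x i])
      also have "(\<lambda>h. f x * (G i x \<bullet> h) + (Df x \<bullet> h) * (F x \<bullet> i)) = (\<lambda>h. g x \<bullet> h)"
        by (auto simp: g_def inner_add_left)
      finally show "((\<lambda>x. f x * (F x \<bullet> i)) has_derivative (\<lambda>h. g' x \<bullet> h)) (at x)" using gg x by simp
    next
      have "continuous_on \<Omega> g" unfolding g_def
        by (intro continuous_on_add continuous_on_scaleR cF[OF i] G[OF i] c)
      then show "continuous_on \<Omega> g'" using gg continuous_on_cong[of \<Omega> \<Omega> g' g] by simp
    qed (use S in \<open>auto simp: g'_def\<close>)
    from test_C1_LINT_derivative[OF this, of i] have "(LINT x|lborel. g' x \<bullet> i) = 0" .
    moreover have "(\<lambda>x. g' x \<bullet> i) = (\<lambda>x. D1 i x + D2 i x)"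
      using S by (auto simp: g'_def g_def D1_def D2_def inner_add_left)
    ultimately show ?thesis using i1[OF i] i2[OF i] by simp
  qed
  have e1: "(\<lambda>x. F x \<bullet> Df x) = (\<lambda>x. \<Sum>i\<in>Basis. D1 i x)"
    unfolding D1_def by (rule ext, subst euclidean_inner) (simp add: mult.commute)
  have e2: "(\<lambda>x. f x * (\<Sum>i\<in>Basis. G i x \<bullet> i)) = (\<lambda>x. \<Sum>i\<in>Basis. D2 i x)"
    unfolding D2_def by (simp add: sum_distrib_left)
  show "integrable lborel (\<lambda>x. F x \<bullet> Df x)"
    "integrable lborel (\<lambda>x. f x * (\<Sum>i\<in>Basis. G i x \<bullet> i))"
    unfolding e1 e2 using i1 i2 by auto
  have "(LINT x|lborel. (\<Sum>i\<in>Basis. D1 i x)) + (LINT x|lborel. (\<Sum>i\<in>Basis. D2 i x)) = 0"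
    using i1 i2 zero by (simp add: sum.distrib[symmetric])
  then show "(LINT x|lborel. F x \<bullet> Df x) = - (LINT x|lborel. f x * (\<Sum>i\<in>Basis. G i x \<bullet> i))"
    unfolding e1 e2 by simp
qed

section \<open>Upper bound for the eigenvalues\<close>

lemma filterlim_const_powr_at_top:
  fixes a :: real
  assumes "1 < a" "filterlim p at_top F"
  shows "filterlim (\<lambda>j. a powr p j) at_top F"
proof -
  have "filterlim (\<lambda>j. ln a * p j) at_top F"
    using assms by (intro filterlim_tendsto_pos_mult_at_top[OF tendsto_const]) auto
  then have "filterlim (\<lambda>j. exp (ln a * p j)) at_top F"
    by (rule filterlim_compose[OF exp_at_top])
  then show ?thesis using assms by (simp add: powr_def mult.commute)
qed

text \<open>
  A regularised positive part whose slopes stay in \<open>[0, 1]\<close>: the gradient of \<open>f - smooth_pos \<sigma> (f - \<phi>)\<close> is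
  then a convex combination of the gradients of \<open>f\<close> and \<open>\<phi>\<close>.
\<close>

definition smooth_pos :: "real \<Rightarrow> real \<Rightarrow> real" where
  "smooth_pos \<sigma> s = (max 0 s)\<^sup>2 / (max 0 s + \<sigma>)"

definition smooth_pos' :: "real \<Rightarrow> real \<Rightarrow> real" where
  "smooth_pos' \<sigma> s = 1 - (\<sigma> / (max 0 s + \<sigma>))\<^sup>2"

lemma smooth_pos_nonpos: "s \<le> 0 \<Longrightarrow> smooth_pos \<sigma> s = 0"
  and smooth_pos'_nonpos: "\<sigma> > 0 \<Longrightarrow> s \<le> 0 \<Longrightarrow> smooth_pos' \<sigma> s = 0"
  by (simp_all add: smooth_pos_def smooth_pos'_def max_def)

lemma smooth_pos_nonneg: "\<sigma> > 0 \<Longrightarrow> 0 \<le> smooth_pos \<sigma> s"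
  by (simp add: smooth_pos_def max_def)

lemma smooth_pos_pos: "\<sigma> > 0 \<Longrightarrow> s > 0 \<Longrightarrow> 0 < smooth_pos \<sigma> s"
  by (simp add: smooth_pos_def max_def)

lemma smooth_pos'_bounds:
  assumes "\<sigma> > 0"
  shows "0 \<le> smooth_pos' \<sigma> s" "smooth_pos' \<sigma> s \<le> 1"
proof -
  have "\<sigma> / (max 0 s + \<sigma>) \<le> 1" "0 \<le> \<sigma> / (max 0 s + \<sigma>)" using assms by (auto simp: divide_simps max_def)
  then show "0 \<le> smooth_pos' \<sigma> s" "smooth_pos' \<sigma> s \<le> 1"
    unfolding smooth_pos'_def using power_le_one by auto
qed

lemma continuous_on_smooth_pos': "\<sigma> > 0 \<Longrightarrow> continuous_on S (smooth_pos' \<sigma>)"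
  unfolding smooth_pos'_def by (intro continuous_intros) (auto simp: max_def)

lemma smooth_pos_ge: "\<sigma> > 0 \<Longrightarrow> s - \<sigma> \<le> smooth_pos \<sigma> s"
  by (cases "s \<le> 0") (simp_all add: smooth_pos_def max_def field_simps power2_eq_square)

lemma DERIV_smooth_pos:
  assumes "\<sigma> > 0"
  shows "(smooth_pos \<sigma> has_real_derivative smooth_pos' \<sigma> s) (at s)"
proof -
  consider "s < 0" | "s = 0" | "s > 0" by linarith
  then show ?thesis
  proof cases
    case 1
    have "(smooth_pos \<sigma> has_real_derivative 0) (at s)"
      by (rule has_field_derivative_transform_within_open[of "\<lambda>_. 0" _ _ "{..<0}"])
        (use 1 in \<open>auto simp: smooth_pos_nonpos\<close>)
    then show ?thesis using 1 assms by (simp add: smooth_pos'_nonpos)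
  next
    case 2
    have "((\<lambda>h. (smooth_pos \<sigma> h - 0) / h) \<longlongrightarrow> 0) (at 0)"
    proof (rule Lim_null_comparison)
      show "\<forall>\<^sub>F h in at 0. norm ((smooth_pos \<sigma> h - 0) / h) \<le> \<bar>h\<bar> / \<sigma>"
      proof (intro always_eventually allI)
        fix h
        show "norm ((smooth_pos \<sigma> h - 0) / h) \<le> \<bar>h\<bar> / \<sigma>"
        proof (cases "h \<le> 0")
          case False
          then have "h / (h + \<sigma>) \<le> h / \<sigma>" using assms by (intro divide_left_mono) auto
          then show ?thesis using assms False by (simp add: smooth_pos_def max_def power2_eq_square)
        qed (use assms in \<open>simp add: smooth_pos_nonpos divide_nonpos_pos\<close>)
      qed
      show "((\<lambda>h. \<bar>h\<bar> / \<sigma>) \<longlongrightarrow> 0) (at 0)" using assms by (auto intro!: tendsto_eq_intros)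
    qed
    then show ?thesis using 2 assms
      by (simp add: has_field_derivative_iff smooth_pos_nonpos smooth_pos'_nonpos)
  next
    case 3
    have "((\<lambda>s. s\<^sup>2 / (s + \<sigma>)) has_real_derivative (2 * s * (s + \<sigma>) - s\<^sup>2) / (s + \<sigma>)\<^sup>2) (at s)"
      using 3 assms by (auto intro!: derivative_eq_intros simp: power2_eq_square)
    also have "(2 * s * (s + \<sigma>) - s\<^sup>2) / (s + \<sigma>)\<^sup>2 = 1 - (\<sigma> / (s + \<sigma>))\<^sup>2"
      using 3 assms by (simp add: divide_simps) (simp add: power2_eq_square algebra_simps)
    finally have "(smooth_pos \<sigma> has_real_derivative 1 - (\<sigma> / (s + \<sigma>))\<^sup>2) (at s)"
      by (rule has_field_derivative_transform_within_open[of _ _ _ "{0<..}"])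
        (use 3 in \<open>auto simp: smooth_pos_def max_def\<close>)
    then show ?thesis using 3 by (simp add: smooth_pos'_def)
  qed
qed

lemma smooth_pos_incr:
  assumes "\<sigma> > 0" "b \<le> a"
  shows "0 \<le> smooth_pos \<sigma> a - smooth_pos \<sigma> b" "smooth_pos \<sigma> a - smooth_pos \<sigma> b \<le> a - b"
proof -
  have "smooth_pos \<sigma> b \<le> smooth_pos \<sigma> a"
    using DERIV_nonneg_imp_nondecreasing[OF assms(2)] DERIV_smooth_pos[OF assms(1)]
      smooth_pos'_bounds[OF assms(1)] by metis
  then show "0 \<le> smooth_pos \<sigma> a - smooth_pos \<sigma> b" by simp
  have "b - smooth_pos \<sigma> b \<le> a - smooth_pos \<sigma> a"
  proof (rule DERIV_nonneg_imp_nondecreasing[OF assms(2)])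
    fix x
    have "((\<lambda>x. x - smooth_pos \<sigma> x) has_real_derivative 1 - smooth_pos' \<sigma> x) (at x)"
      by (rule DERIV_diff[OF DERIV_ident DERIV_smooth_pos[OF assms(1)]])
    then show "\<exists>y. ((\<lambda>x. x - smooth_pos \<sigma> x) has_real_derivative y) (at x) \<and> 0 \<le> y"
      using smooth_pos'_bounds[OF assms(1), of x] by auto
  qed
  then show "smooth_pos \<sigma> a - smooth_pos \<sigma> b \<le> a - b" by simp
qed

text \<open>Both the truncation and what it leaves of the function inherit convergence in the mean
  from the approximating functions, without any control of derivatives.\<close>

lemma smooth_pos_lipschitz:
  assumes "\<sigma> > 0"
  shows "\<bar>smooth_pos \<sigma> a - smooth_pos \<sigma> b\<bar> \<le> \<bar>a - b\<bar>"
    "\<bar>(a - smooth_pos \<sigma> (a - d)) - (b - smooth_pos \<sigma> (b - d))\<bar> \<le> \<bar>a - b\<bar>"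
  using smooth_pos_incr[OF assms, of a b] smooth_pos_incr[OF assms, of b a]
    smooth_pos_incr[OF assms, of "a - d" "b - d"] smooth_pos_incr[OF assms, of "b - d" "a - d"]
  by linarith+

section \<open>The Rayleigh quotient on test functions\<close>

lemma test_C1_imp_W0_grad:
  assumes t: "test_C1 \<Omega> f Df" and "p > 0"
  shows "W0_grad p \<Omega> f Df"
proof -
  have "\<exists>\<phi> D\<phi>. (\<forall>k::nat. test_C1 \<Omega> (\<phi> k) (D\<phi> k)) \<and>
        (\<lambda>k. LINT x|lborel. \<bar>\<phi> k x - f x\<bar> powr p) \<longlonglongrightarrow> 0 \<and>
        (\<lambda>k. LINT x|lborel. norm (D\<phi> k x - Df x) powr p) \<longlonglongrightarrow> 0"
    by (rule exI[of _ "\<lambda>_. f"], rule exI[of _ "\<lambda>_. Df"]) (use t in auto)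
  then show ?thesis
    unfolding W0_grad_def using test_C1_measurable[OF t] test_C1_integrable[OF assms] by simp
qed

lemma test_C1_scale:
  assumes "open \<Omega>" "test_C1 \<Omega> f Df"
  shows "test_C1 \<Omega> (\<lambda>x. s * f x) (\<lambda>x. s *\<^sub>R Df x)"
proof -
  obtain S where S: "compact S" "S \<subseteq> \<Omega>" "\<And>x. x \<notin> S \<Longrightarrow> f x = 0" "\<And>x. x \<notin> S \<Longrightarrow> Df x = 0"
    using test_C1_support[OF assms(2)] by metis
  show ?thesis
  proof (rule test_C1I[OF assms(1) S(1,2)])
    fix x
    have "(f has_derivative (\<lambda>h. Df x \<bullet> h)) (at x)" using assms unfolding test_C1_def by auto
    then show "((\<lambda>x. s * f x) has_derivative (\<lambda>h. (s *\<^sub>R Df x) \<bullet> h)) (at x)"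
      by (auto intro!: derivative_eq_intros)
  next
    show "continuous_on \<Omega> (\<lambda>x. s *\<^sub>R Df x)"
      using continuous_on_subset[OF test_C1_continuous(2)[OF assms(2)] subset_UNIV]
      by (intro continuous_intros)
  qed (use S in auto)
qed

text \<open>The homogeneous form spares later competitors a normalisation: a nonzero function is
  rescaled to unit p-norm, and for a vanishing p-norm the left side is 0.\<close>

lemma Lambda_p_mult_le:
  assumes "open \<Omega>" "test_C1 \<Omega> f Df" "p > 0"
  shows "Lambda_p p \<Omega> * (LINT x|lborel. \<bar>f x\<bar> powr p) \<le> (LINT x|lborel. norm (Df x) powr p)"
proof (cases "(LINT x|lborel. \<bar>f x\<bar> powr p) = 0")
  case True
  then show ?thesis by (simp add: integral_nonneg_AE)
next
  case False
  define A where "A = (LINT x|lborel. \<bar>f x\<bar> powr p)"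
  have "A \<ge> 0" unfolding A_def by (simp add: integral_nonneg_AE)
  then have A: "A > 0" using False A_def by linarith
  define s where "s = A powr (- 1 / p)"
  have "s powr p = A powr (- 1)" using assms unfolding s_def powr_powr by simp
  then have s: "s powr p = 1 / A" "s \<ge> 0"
    using A by (simp_all add: s_def powr_minus_divide)
  have "W0_grad p \<Omega> (\<lambda>x. s * f x) (\<lambda>x. s *\<^sub>R Df x)"
    using assms by (intro test_C1_imp_W0_grad test_C1_scale)
  moreover have "(LINT x|lborel. \<bar>s * f x\<bar> powr p) = 1"
    using s A by (simp add: abs_mult powr_mult A_def[symmetric])
  ultimately have "Lambda_p p \<Omega> \<le> (LINT x|lborel. norm (s *\<^sub>R Df x) powr p)"
    unfolding Lambda_p_def
    by (intro cInf_lower bdd_belowI[of _ 0] CollectI exI[of _ "\<lambda>x. s * f x"] exI[of _ "\<lambda>x. s *\<^sub>R Df x"])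
      (auto simp: integral_nonneg_AE)
  also have "\<dots> = (LINT x|lborel. norm (Df x) powr p) / A"
    using s by (simp add: powr_mult)
  finally show ?thesis using A unfolding A_def[symmetric] by (simp add: field_simps)
qed

text \<open>Adding \<open>\<tau>\<close> under the root removes the singularity of the distance at
  \<open>x0\<close>.\<close>

lemma has_derivative_sqrt_dist:
  fixes x0 :: "'a::real_inner"
  assumes "\<tau> > 0"
  shows "((\<lambda>x. sqrt ((x - x0) \<bullet> (x - x0) + \<tau>)) has_derivative
     (\<lambda>h. ((x - x0) /\<^sub>R sqrt ((x - x0) \<bullet> (x - x0) + \<tau>)) \<bullet> h)) (at x)"
proof -
  have p: "(x - x0) \<bullet> (x - x0) + \<tau> > 0" using assms by (simp add: add_nonneg_pos)
  have "((\<lambda>x. (x - x0) \<bullet> (x - x0) + \<tau>) has_derivative (\<lambda>h. 2 * ((x - x0) \<bullet> h))) (at x)"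
    by (auto intro!: derivative_eq_intros simp: inner_commute)
  from has_derivative_real_sqrt[OF p this]
  have "((\<lambda>x. sqrt ((x - x0) \<bullet> (x - x0) + \<tau>)) has_derivative
     (\<lambda>h. 2 * ((x - x0) \<bullet> h) / (2 * sqrt ((x - x0) \<bullet> (x - x0) + \<tau>)))) (at x)"
    by (simp add: field_simps)
  also have "(\<lambda>h. 2 * ((x - x0) \<bullet> h) / (2 * sqrt ((x - x0) \<bullet> (x - x0) + \<tau>)))
      = (\<lambda>h. ((x - x0) /\<^sub>R sqrt ((x - x0) \<bullet> (x - x0) + \<tau>)) \<bullet> h)"
    by (rule ext) (simp only: inner_scaleR_left mult_divide_mult_cancel_left_if, simp add: divide_inverse_commute)
  finally show ?thesis .
qed

text \<open>The cone of slope 1 over the ball, smoothed twice: \<open>q\<close> rounds the tip,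
  \<open>smooth_pos\<close> rounds the base. Both operations keep the slope at most 1.\<close>

lemma cone_test_function:
  fixes x0 :: "'a::euclidean_space"
  assumes "open \<Omega>" "ball x0 R \<subseteq> \<Omega>" "0 < m" "m < R"
  obtains f Df where "test_C1 \<Omega> f Df" "\<And>x. norm (Df x) \<le> 1" "f x0 > m"
proof -
  \<comment> \<open>\<open>R'\<close> below \<open>R\<close> keeps the support inside the ball. Each
    smoothing lowers the tip by at most \<open>\<sigma>\<close>, so a height of at least
    \<open>R' - 2 * \<sigma>\<close> remains, which exceeds \<open>m\<close>.\<close>
  define R' \<sigma> where "R' = (m + R) / 2" and "\<sigma> = (R' - m) / 4"
  have R': "m < R'" "R' < R" using assms by (auto simp: R'_def)
  have \<sigma>: "\<sigma> > 0" "R' - \<sigma> - \<sigma> > m" using R' by (auto simp: \<sigma>_def field_simps)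
  define q where "q x = sqrt ((x - x0) \<bullet> (x - x0) + \<sigma>\<^sup>2)" for x
  have q: "norm (x - x0) \<le> q x" "0 < q x" for x
    unfolding q_def using \<sigma> by (auto simp: norm_eq_sqrt_inner add_nonneg_pos)
  have qD: "(q has_derivative (\<lambda>h. ((x - x0) /\<^sub>R q x) \<bullet> h)) (at x)" for x
    unfolding q_def by (rule has_derivative_sqrt_dist) (use \<sigma> in auto)
  have cq: "continuous_on S q" for S unfolding q_def by (intro continuous_intros)
  define f where "f x = smooth_pos \<sigma> (R' - q x)" for x
  define Df where "Df x = - (smooth_pos' \<sigma> (R' - q x) / q x) *\<^sub>R (x - x0)" for x
  have out: "R' - q x \<le> 0" if "x \<notin> cball x0 R'" for x
    using q(1)[of x] that by (auto simp: dist_norm norm_minus_commute)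
  have "test_C1 \<Omega> f Df"
  proof (rule test_C1I[OF assms(1), of "cball x0 R'"])
    show "f x = 0" "Df x = 0" if "x \<notin> cball x0 R'" for x
      using out[OF that] \<sigma> by (auto simp: f_def Df_def smooth_pos_nonpos smooth_pos'_nonpos)
    show "cball x0 R' \<subseteq> \<Omega>" using assms R' by (auto simp: subset_iff)
    show "(f has_derivative (\<lambda>h. Df x \<bullet> h)) (at x)" for x
    proof -
      have "((\<lambda>x. R' - q x) has_derivative (\<lambda>h. - (((x - x0) /\<^sub>R q x) \<bullet> h))) (at x)"
        by (auto intro!: derivative_eq_intros qD)
      from has_derivative_compose[OF this DERIV_smooth_pos[OF \<sigma>(1), of "R' - q x", unfolded has_field_derivative_def]]
      show ?thesis unfolding f_def Df_def
        by (rule has_derivative_eq_rhs) (simp add: fun_eq_iff divide_inverse)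
    qed
    show "continuous_on \<Omega> Df" unfolding Df_def
      using q(2) by (intro continuous_intros continuous_on_compose2[OF continuous_on_smooth_pos'[OF \<sigma>(1)]] cq)
       (auto simp: less_imp_neq[OF q(2), symmetric])
  qed auto
  moreover have "norm (Df x) \<le> 1" for x
  proof -
    have "norm (Df x) = smooth_pos' \<sigma> (R' - q x) * (norm (x - x0) / q x)"
      unfolding Df_def using smooth_pos'_bounds[OF \<sigma>(1), of "R' - q x"] q[of x] by simp
    also have "\<dots> \<le> 1 * 1"
      using smooth_pos'_bounds[OF \<sigma>(1), of "R' - q x"] q[of x] by (intro mult_mono) auto
    finally show ?thesis by simp
  qed
  moreover have "f x0 > m"
    unfolding f_def using smooth_pos_ge[OF \<sigma>(1), of "R' - q x0"] \<sigma> by (simp add: q_def)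
  ultimately show ?thesis by (rule that)
qed

text \<open>With a cone of height above \<open>m\<close> the Rayleigh quotient is at most
  \<open>C / B\<close> times \<open>m powr (- p)\<close>, where \<open>C\<close> is the measure of a
  set supporting the gradient and \<open>B\<close> that of a ball on which the cone exceeds
  \<open>m\<close>.\<close>

lemma eventually_Lambda_p_le_powr:
  fixes \<Omega> :: "'a::euclidean_space set" and p :: "nat \<Rightarrow> real"
  assumes "open \<Omega>" "ball x0 R \<subseteq> \<Omega>" "R > 0" "l > 1 / R" "filterlim p at_top sequentially"
    and p1: "\<And>j. p j > 1"
  shows "\<forall>\<^sub>F j in sequentially. Lambda_p (p j) \<Omega> \<le> l powr p j"
proof -
  have l: "l > 0" using assms by (meson less_trans zero_less_divide_1_iff)
  have lR: "1 / l < R" using assms l by (simp add: field_simps)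
  \<comment> \<open>Any height strictly between \<open>1 / l\<close> and \<open>R\<close> makes
    \<open>l * m > 1\<close>, and the powers of \<open>l * m\<close> eventually absorb the constant
    \<open>C / B\<close>.\<close>
  define m where "m = (1 / l + R) / 2"
  have m: "1 / l < m" "m < R" "0 < m" using lR l assms(3) by (auto simp: m_def intro!: add_pos_pos)
  have lm: "1 < l * m" using m l by (simp add: field_simps)
  obtain f Df where t: "test_C1 \<Omega> f Df" and n: "\<And>x. norm (Df x) \<le> 1" and f: "f x0 > m"
    using cone_test_function[OF assms(1,2) m(3,2)] by metis
  obtain S where S: "compact S" "\<And>x. x \<notin> S \<Longrightarrow> Df x = 0"
    using test_C1_support[OF t] by metis
  have "open {x. f x > m}"
    using test_C1_continuous(1)[OF t] by (intro open_Collect_less continuous_on_const)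
  then obtain \<rho> where \<rho>: "\<rho> > 0" "ball x0 \<rho> \<subseteq> {x. f x > m}"
    using f open_contains_ball by blast
  define C B where "C = measure lborel S" and "B = measure lborel (ball x0 \<rho>)"
  have B: "B > 0" unfolding B_def using \<rho> by (simp add: content_ball_pos)
  have "filterlim (\<lambda>j. (l * m) powr p j) at_top sequentially"
    using filterlim_const_powr_at_top[OF lm assms(5)] .
  then have "\<forall>\<^sub>F j in sequentially. C / B \<le> (l * m) powr p j" by (simp add: filterlim_at_top)
  then show ?thesis
  proof eventually_elim
    case (elim j)
    have pj: "p j > 0" using p1[of j] by simp
    show ?case
    proof (cases "Lambda_p (p j) \<Omega> \<le> 0")
      case True then show ?thesis using powr_ge_zero order_trans by blast
    next
      case False
      have "m powr p j * B = (LINT x|lborel. m powr p j * indicator (ball x0 \<rho>) x)"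
        unfolding B_def by simp
      also have "\<dots> \<le> (LINT x|lborel. \<bar>f x\<bar> powr p j)"
      proof (rule integral_mono)
        show "integrable lborel (\<lambda>x. m powr p j * indicator (ball x0 \<rho>) x)"
          by (auto intro!: integrable_real_indicator emeasure_bounded_finite)
        show "integrable lborel (\<lambda>x. \<bar>f x\<bar> powr p j)"
          using test_C1_integrable(2)[OF t pj] by simp
        show "m powr p j * indicator (ball x0 \<rho>) x \<le> \<bar>f x\<bar> powr p j" for x
        proof (cases "x \<in> ball x0 \<rho>")
          case True
          then have "f x > m" using \<rho> by blast
          then show ?thesis using True m pj by (auto intro!: powr_mono2)
        qed auto
      qed
      finally have 1: "m powr p j * B \<le> (LINT x|lborel. \<bar>f x\<bar> powr p j)" .
      have "(LINT x|lborel. norm (Df x) powr p j) \<le> (LINT x|lborel. indicator S x)"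
      proof (rule integral_mono)
        show "integrable lborel (indicator S :: 'a \<Rightarrow> real)"
          using S by (auto intro!: integrable_real_indicator emeasure_compact_finite simp: compact_imp_closed)
        show "integrable lborel (\<lambda>x. norm (Df x) powr p j)"
          using test_C1_integrable(3)[OF t pj] by simp
        show "norm (Df x) powr p j \<le> indicator S x" for x
          using S n[of x] pj powr_mono2[of "p j" "norm (Df x)" 1] by (auto split: split_indicator)
      qed
      also have "\<dots> = C" unfolding C_def using S by (simp add: compact_imp_closed)
      finally have 2: "(LINT x|lborel. norm (Df x) powr p j) \<le> C" .
      have "Lambda_p (p j) \<Omega> * (m powr p j * B) \<le> Lambda_p (p j) \<Omega> * (LINT x|lborel. \<bar>f x\<bar> powr p j)"
        using 1 False by (intro mult_left_mono) auto
      also have "\<dots> \<le> C" using Lambda_p_mult_le[OF assms(1) t pj] 2 by linarith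
      also have "C \<le> (l * m) powr p j * B" using elim B by (simp add: field_simps)
      also have "\<dots> = l powr p j * (m powr p j * B)" using l m by (simp add: powr_mult)
      finally show ?thesis using B m by simp
    qed
  qed
qed

section \<open>Lipschitz bound for the limit\<close>

lemma integrable_lborel_translate:
  fixes f :: "'a::euclidean_space \<Rightarrow> 'b::{banach, second_countable_topology}"
  assumes "integrable lborel f"
  shows "integrable lborel (\<lambda>x. f (x + e))"
proof -
  have "integrable (distr lborel borel ((+) e)) f" using assms by (simp add: lborel_distr_plus)
  then have "integrable lborel (\<lambda>x. f (e + x))"
    by (subst (asm) integrable_distr_eq) (use assms in auto)
  then show ?thesis by (simp add: add.commute)
qed

text \<open>Averages over a box are compared instead of values, since an integral bound on the
  gradient does not control values directly. The average over the box shifted by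
  \<open>s *\<^sub>R h\<close> is differentiable in \<open>s\<close>; its derivative is bounded
  through \<open>set_LINT_norm_le_powr\<close>, and the integral over the whole space is unaffected
  by the shift.\<close>

lemma test_C1_box_increment:
  fixes f :: "'a::euclidean_space \<Rightarrow> real"
  assumes t: "test_C1 \<Omega> f Df" and p: "p \<ge> 1" and l: "l > 0"
  shows "\<bar>(LINT x:cbox a b|lborel. f (x + h)) - (LINT x:cbox a b|lborel. f x)\<bar>
    \<le> norm h * (l * measure lborel (cbox a b) + l powr (1 - p) * (LINT x|lborel. norm (Df x) powr p))"
proof -
  let ?Q = "cbox a b"
  let ?B = "norm h * (l * measure lborel ?Q + l powr (1 - p) * (LINT x|lborel. norm (Df x) powr p))"
  define I where "I s = integral ?Q (\<lambda>x. f (x + s *\<^sub>R h))" for s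
  have ic: "set_integrable lborel ?Q g" if "continuous_on UNIV g" for g :: "'a \<Rightarrow> real"
    unfolding set_integrable_def using that
    by (intro borel_integrable_compact) (auto intro: continuous_on_subset)
  have I: "I s = (LINT x:?Q|lborel. f (x + s *\<^sub>R h))" for s
    unfolding I_def
    by (rule set_borel_integral_eq_integral(2)[symmetric], rule ic,
        rule continuous_on_compose2[OF test_C1_continuous(1)[OF t]]) (auto intro!: continuous_intros)
  have bound: "norm (integral ?Q (\<lambda>x. Df (x + s *\<^sub>R h) \<bullet> h)) \<le> ?B" for s
  proof -
    define D where "D x = Df (x + s *\<^sub>R h)" for x
    have c: "continuous_on UNIV D" unfolding D_def
      by (rule continuous_on_compose2[OF test_C1_continuous(2)[OF t]]) (auto intro!: continuous_intros)
    then have m: "D \<in> borel_measurable borel" by (rule borel_measurable_continuous_onI)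
    have Dp: "integrable lborel (\<lambda>x. norm (D x) powr p)"
      using integrable_lborel_translate[OF test_C1_integrable(3)[OF t]] p unfolding D_def by simp
    have "norm (integral ?Q (\<lambda>x. D x \<bullet> h)) = norm (LINT x:?Q|lborel. D x \<bullet> h)"
      by (subst set_borel_integral_eq_integral(2)) (use c in \<open>auto intro!: ic continuous_intros\<close>)
    also have "\<dots> \<le> (LINT x:?Q|lborel. norm (D x \<bullet> h))"
      by (rule set_integral_norm_bound) (use c in \<open>auto intro!: ic continuous_intros\<close>)
    also have "\<dots> \<le> (LINT x:?Q|lborel. norm (D x) * norm h)"
      by (rule set_integral_mono) (use c in \<open>auto intro!: ic continuous_intros Cauchy_Schwarz_ineq2\<close>)
    also have "\<dots> = norm h * (LINT x:?Q|lborel. norm (D x))" by (simp add: mult.commute)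
    also have "\<dots> \<le> norm h * (l * measure lborel ?Q + l powr (1 - p) * (LINT x|lborel. norm (D x) powr p))"
      using m Dp p l emeasure_compact_finite[of ?Q] by (intro mult_left_mono set_LINT_norm_le_powr) auto
    also have "(LINT x|lborel. norm (D x) powr p) = (LINT x|lborel. norm (Df x) powr p)"
      unfolding D_def using test_C1_measurable[OF t]
      by (intro LINT_lborel_translate[of "\<lambda>x. norm (Df x) powr p"]) auto
    finally show ?thesis unfolding D_def .
  qed
  have ID: "(I has_field_derivative integral ?Q (\<lambda>x. Df (x + s *\<^sub>R h) \<bullet> h)) (at s)" for s
    unfolding I_def by (rule test_C1_translate_derivative[OF t])
  have "norm (I 1 - I 0) \<le> ?B * norm (1 - 0 :: real)"
    by (rule field_differentiable_bound[of UNIV I "\<lambda>s. integral ?Q (\<lambda>x. Df (x + s *\<^sub>R h) \<bullet> h)"])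
      (use bound ID in auto)
  then show ?thesis by (simp add: I)
qed

text \<open>The bound survives the limit along approximating test functions: convergence in the p-th
  mean gives convergence of integrals over the box, which has finite measure, and of the gradient
  integrals.\<close>

lemma W0_grad_box_increment:
  fixes v :: "'a::euclidean_space \<Rightarrow> real"
  assumes w: "W0_grad p \<Omega> v g" and p: "p \<ge> 1" and l: "l > 0"
  shows "\<bar>(LINT x:cbox a b|lborel. v (x + h)) - (LINT x:cbox a b|lborel. v x)\<bar>
    \<le> norm h * (l * measure lborel (cbox a b) + l powr (1 - p) * (LINT x|lborel. norm (g x) powr p))"
proof -
  let ?Q = "cbox a b"
  obtain \<phi> D\<phi> where t: "\<And>k. test_C1 \<Omega> (\<phi> k) (D\<phi> k)"
    and l1: "(\<lambda>k. LINT x|lborel. \<bar>\<phi> k x - v x\<bar> powr p) \<longlonglongrightarrow> 0"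
    and l2: "(\<lambda>k. LINT x|lborel. norm (D\<phi> k x - g x) powr p) \<longlonglongrightarrow> 0"
    and vm[measurable]: "v \<in> borel_measurable borel" and gm: "g \<in> borel_measurable borel"
    and vi: "integrable lborel (\<lambda>x. norm (v x) powr p)" and gi: "integrable lborel (\<lambda>x. norm (g x) powr p)"
    using w unfolding W0_grad_def by auto
  have p0: "p > 0" using p by simp
  note [measurable] = test_C1_measurable[OF t]
  have s1: "(\<lambda>k. LINT x:?Q|lborel. \<phi> k (x + e)) \<longlonglongrightarrow> (LINT x:?Q|lborel. v (x + e))" for e
  proof -
    have d: "integrable lborel (\<lambda>x. norm (\<phi> k x - v x) powr p)" for k
      using vi test_C1_integrable(2)[OF t p0] p by (intro integrable_norm_powr_diff) auto
    have d': "integrable lborel (\<lambda>x. norm (\<phi> k (x + e) - v (x + e)) powr p)" for k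
      using integrable_lborel_translate[OF d] .
    have "(LINT x|lborel. norm (\<phi> k (x + e) - v (x + e)) powr p) = (LINT x|lborel. \<bar>\<phi> k x - v x\<bar> powr p)" for k
      using LINT_lborel_translate[of "\<lambda>x. \<bar>\<phi> k x - v x\<bar> powr p" e] by simp
    then have z: "(\<lambda>k. LINT x:?Q|lborel. norm (\<phi> k (x + e) - v (x + e))) \<longlonglongrightarrow> 0"
      using d' p l1 emeasure_compact_finite[of ?Q] by (intro set_LINT_norm_tendsto_0) auto
    have i: "set_integrable lborel ?Q (\<lambda>x. v (x + e))" "set_integrable lborel ?Q (\<lambda>x. \<phi> k (x + e))"
        "set_integrable lborel ?Q (\<lambda>x. \<phi> k (x + e) - v (x + e))" for k
      using integrable_lborel_translate[OF vi, of e] d'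
         integrable_lborel_translate[OF test_C1_integrable(2)[OF t p0], of k e] p
         emeasure_compact_finite[of ?Q]
      by (auto intro!: set_LINT_norm_le_powr(1)[where l=1 and p=p])
    have "(\<lambda>k. (LINT x:?Q|lborel. \<phi> k (x + e)) - (LINT x:?Q|lborel. v (x + e))) \<longlonglongrightarrow> 0"
    proof (rule Lim_null_comparison[OF always_eventually z], rule allI)
      fix k
      have "(LINT x:?Q|lborel. \<phi> k (x + e)) - (LINT x:?Q|lborel. v (x + e))
        = (LINT x:?Q|lborel. \<phi> k (x + e) - v (x + e))" using i by simp
      then show "norm ((LINT x:?Q|lborel. \<phi> k (x + e)) - (LINT x:?Q|lborel. v (x + e)))
         \<le> (LINT x:?Q|lborel. norm (\<phi> k (x + e) - v (x + e)))"
        using set_integral_norm_bound[OF i(3)] by simp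
    qed
    then show ?thesis by (simp add: LIM_zero_iff)
  qed
  have s2: "(\<lambda>k. LINT x|lborel. norm (D\<phi> k x) powr p) \<longlonglongrightarrow> (LINT x|lborel. norm (g x) powr p)"
    using gm gi test_C1_integrable(3)[OF t p0] p l2 by (intro LINT_norm_powr_tendsto) auto
  show ?thesis
  proof (rule LIMSEQ_le)
    show "(\<lambda>k. \<bar>(LINT x:?Q|lborel. \<phi> k (x + h)) - (LINT x:?Q|lborel. \<phi> k x)\<bar>)
      \<longlonglongrightarrow> \<bar>(LINT x:?Q|lborel. v (x + h)) - (LINT x:?Q|lborel. v x)\<bar>"
      using s1[of h] s1[of 0] by (auto intro!: tendsto_intros)
    show "(\<lambda>k. norm h * (l * measure lborel ?Q + l powr (1 - p) * (LINT x|lborel. norm (D\<phi> k x) powr p)))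
     \<longlonglongrightarrow> norm h * (l * measure lborel ?Q + l powr (1 - p) * (LINT x|lborel. norm (g x) powr p))"
      by (intro tendsto_intros s2)
  qed (use test_C1_box_increment[OF t p l] in blast)
qed

lemma ball_dist_bd_subset:
  assumes "x \<in> \<Omega>"
  shows "ball x (dist_bd \<Omega> x) \<subseteq> \<Omega>"
proof (rule ccontr)
  assume n: "\<not> ball x (dist_bd \<Omega> x) \<subseteq> \<Omega>"
  then have "0 < dist_bd \<Omega> x" by (metis ball_eq_empty empty_subsetI not_le)
  then have "ball x (dist_bd \<Omega> x) \<inter> frontier \<Omega> \<noteq> {}"
    using assms n centre_in_ball by (intro connected_Int_frontier) blast+
  then obtain y where "y \<in> frontier \<Omega>" "dist x y < infdist x (frontier \<Omega>)"
    by (auto simp: dist_bd_def)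
  then show False using infdist_le[of y "frontier \<Omega>" x] by simp
qed

lemma continuous_on_dist_bd: "continuous_on S (dist_bd \<Omega>)"
  unfolding dist_bd_def by (intro continuous_intros)

lemma first_eigenfunction_continuous:
  assumes "open \<Omega>" "first_eigenfunction p \<Omega> v"
  shows "continuous_on UNIV v"
proof -
  have z: "v x = 0" if "x \<notin> \<Omega>" for x
    using assms(2) that unfolding first_eigenfunction_def by auto
  have "continuous_on (closure \<Omega>) v" using assms(2) unfolding first_eigenfunction_def by auto
  moreover have "continuous_on (- \<Omega>) v"
    using z continuous_on_cong[of "- \<Omega>" "- \<Omega>" v "\<lambda>_. 0"] by simp
  ultimately have "continuous_on (closure \<Omega> \<union> - \<Omega>) v"
    using assms(1) by (intro continuous_on_closed_Un) auto
  moreover have "closure \<Omega> \<union> - \<Omega> = UNIV" using closure_subset[of \<Omega>] by auto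
  ultimately show ?thesis by simp
qed

section \<open>The eigenfunctions along the sequence and their uniform limit\<close>

locale ground_state_sequence =
  fixes \<Omega> :: "'a::euclidean_space set" and p :: "nat \<Rightarrow> real" and U :: "nat \<Rightarrow> 'a \<Rightarrow> real" and u :: "'a \<Rightarrow> real"
  assumes open_\<Omega>: "open \<Omega>" and bounded_\<Omega>: "bounded \<Omega>"
    and p_gt_1: "\<And>j. p j > 1"
    and eigen: "\<And>j. first_eigenfunction (p j) \<Omega> (U j)"
    and p_at_top: "filterlim p at_top sequentially"
    and U_lim: "uniform_limit (closure \<Omega>) U u sequentially"
begin

definition inradius :: real where
  "inradius = (SUP x\<in>closure \<Omega>. dist_bd \<Omega> x)"

lemma U_zero: "x \<notin> \<Omega> \<Longrightarrow> U j x = 0"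
  and U_pos: "x \<in> \<Omega> \<Longrightarrow> U j x > 0"
  and U_norm: "(LINT x|lborel. \<bar>U j x\<bar> powr p j) = 1"
  using eigen[of j] unfolding first_eigenfunction_def by blast+

lemma U_nonneg: "U j x \<ge> 0"
  using U_zero[of x j] U_pos[of x j] by (cases "x \<in> \<Omega>") auto

lemma U_continuous: "continuous_on UNIV (U j)"
  using first_eigenfunction_continuous[OF open_\<Omega> eigen] .

lemma nonempty: "\<Omega> \<noteq> {}"
proof
  assume "\<Omega> = {}"
  then have "U 0 = (\<lambda>_. 0)" using U_zero[of _ 0] by auto
  then show False using U_norm[of 0] by simp
qed

lemma compact_closure: "compact (closure \<Omega>)"
  using bounded_\<Omega> by (simp add: compact_closure)

lemma frontier_nonempty: "frontier \<Omega> \<noteq> {}"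
  using nonempty bounded_\<Omega> frontier_eq_empty not_bounded_UNIV by metis

lemma frontier_iff: "x \<in> frontier \<Omega> \<longleftrightarrow> x \<in> closure \<Omega> \<and> x \<notin> \<Omega>"
  using open_\<Omega> by (simp add: frontier_def interior_open)

lemma dist_bd_pos: "x \<in> \<Omega> \<Longrightarrow> dist_bd \<Omega> x > 0"
  unfolding dist_bd_def using frontier_nonempty frontier_iff
  by (metis frontier_closed in_closed_iff_infdist_zero infdist_nonneg less_eq_real_def)

lemma dist_bd_frontier: "x \<in> frontier \<Omega> \<Longrightarrow> dist_bd \<Omega> x = 0"
  unfolding dist_bd_def by simp

lemma nearest_frontier:
  obtains y where "y \<in> frontier \<Omega>" "dist x y = dist_bd \<Omega> x"
  unfolding dist_bd_def using infdist_attains_inf[OF frontier_closed frontier_nonempty] by metis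

lemma bdd_dist_bd: "bdd_above (dist_bd \<Omega> ` closure \<Omega>)"
  using compact_closure continuous_on_dist_bd
  by (intro bounded_imp_bdd_above compact_imp_bounded compact_continuous_image)

lemma dist_bd_le_inradius: "x \<in> closure \<Omega> \<Longrightarrow> dist_bd \<Omega> x \<le> inradius"
  unfolding inradius_def using bdd_dist_bd by (intro cSUP_upper)

lemma incenter:
  obtains x0 where "x0 \<in> \<Omega>" "dist_bd \<Omega> x0 = inradius"
proof -
  have "closure \<Omega> \<noteq> {}" using nonempty by simp
  then obtain x0 where x0: "x0 \<in> closure \<Omega>" "\<forall>y\<in>closure \<Omega>. dist_bd \<Omega> y \<le> dist_bd \<Omega> x0"
    using continuous_attains_sup[OF compact_closure _ continuous_on_dist_bd] by blast
  have e: "dist_bd \<Omega> x0 = inradius"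
    unfolding inradius_def using x0 bdd_dist_bd
    by (intro antisym cSUP_upper cSUP_least) auto
  obtain z where z: "z \<in> \<Omega>" using nonempty by blast
  then have "dist_bd \<Omega> x0 > 0" using x0(2) dist_bd_pos[OF z] closure_subset[of \<Omega>]
    by (meson less_le_trans subsetD)
  then have "x0 \<in> \<Omega>" using x0(1) frontier_iff[of x0] dist_bd_frontier[of x0] by auto
  then show ?thesis using e that by blast
qed

lemma inradius_pos: "inradius > 0"
  using incenter dist_bd_pos by metis

lemma Lambda_p_le:
  assumes "l > 1 / inradius"
  shows "\<forall>\<^sub>F j in sequentially. Lambda_p (p j) \<Omega> \<le> l powr p j"
proof -
  obtain x0 where "x0 \<in> \<Omega>" "dist_bd \<Omega> x0 = inradius" using incenter .
  then have "ball x0 inradius \<subseteq> \<Omega>" using ball_dist_bd_subset by metis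
  then show ?thesis
    using eventually_Lambda_p_le_powr[OF open_\<Omega> _ inradius_pos assms p_at_top p_gt_1] by blast
qed

text \<open>Outside the closure \<open>u\<close> is arbitrary. The extension by 0 is the uniform
  limit of the \<open>U j\<close> on the whole space, so that estimates may use points and segments
  outside \<Omega>.\<close>

definition u0 :: "'a \<Rightarrow> real" where
  "u0 x = (if x \<in> closure \<Omega> then u x else 0)"

lemma U_lim_u0: "uniform_limit UNIV U u0 sequentially"
  unfolding uniform_limit_iff
proof (intro allI impI)
  fix e :: real assume e: "e > 0"
  then have "\<forall>\<^sub>F n in sequentially. \<forall>x\<in>closure \<Omega>. dist (U n x) (u x) < e"
    using U_lim unfolding uniform_limit_iff by blast
  then show "\<forall>\<^sub>F n in sequentially. \<forall>x\<in>UNIV. dist (U n x) (u0 x) < e"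
  proof eventually_elim
    case (elim n)
    show ?case
    proof
      fix x show "dist (U n x) (u0 x) < e"
      proof (cases "x \<in> closure \<Omega>")
        case False
        then have "x \<notin> \<Omega>" using closure_subset by blast
        then show ?thesis using False e by (simp add: u0_def U_zero)
      qed (use elim in \<open>simp add: u0_def\<close>)
    qed
  qed
qed

lemma U_close: "e > 0 \<Longrightarrow> \<forall>\<^sub>F j in sequentially. \<forall>x. \<bar>U j x - u0 x\<bar> < e"
  using U_lim_u0 unfolding uniform_limit_iff by (auto simp: dist_real_def)

lemma u0_continuous: "continuous_on S u0"
proof -
  have "continuous_on UNIV u0"
    by (rule uniform_limit_theorem[OF _ U_lim_u0]) (auto simp: U_continuous)
  then show ?thesis by (rule continuous_on_subset) auto
qed

lemma u0_zero: "x \<notin> \<Omega> \<Longrightarrow> u0 x = 0"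
proof -
  assume "x \<notin> \<Omega>"
  then have "(\<lambda>j. U j x) = (\<lambda>j. 0)" using U_zero by auto
  moreover have "(\<lambda>j. U j x) \<longlonglongrightarrow> u0 x" by (rule tendsto_uniform_limitI[OF U_lim_u0 UNIV_I])
  ultimately show ?thesis using LIMSEQ_unique tendsto_const by metis
qed

lemma u0_nonneg: "u0 x \<ge> 0"
proof -
  have "(\<lambda>j. U j x) \<longlonglongrightarrow> u0 x" by (rule tendsto_uniform_limitI[OF U_lim_u0 UNIV_I])
  then show ?thesis by (rule LIMSEQ_le_const) (simp add: U_nonneg)
qed

text \<open>A larger increment at \<open>a\<close> would persist for the averages of
  \<open>U j\<close> over a small box around \<open>a\<close>. \<open>W0_grad_box_increment\<close>
  at level \<open>l\<close> allows only \<open>l * norm h\<close> per unit measure plus an error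
  governed by the powers of \<open>l' / l\<close>, which tend to 0.\<close>

lemma u0_increment: "u0 (a + h) - u0 a \<le> norm h / inradius"
proof (rule ccontr)
  assume n: "\<not> ?thesis"
  define L where "L = 1 / inradius"
  have L: "L > 0" using inradius_pos by (simp add: L_def)
  define w where "w x = u0 (x + h) - u0 x" for x
  have h: "norm h > 0" using n by auto
  have wa: "w a > L * norm h" using n by (simp add: w_def L_def)
  define r where "r = w a / norm h"
  \<comment> \<open>Two slopes strictly between \<open>L\<close> and the supposed slope
    \<open>r\<close>: the eigenvalue is eventually at most \<open>l' powr p j\<close>, and
    \<open>l' < l\<close> makes its contribution at level \<open>l\<close> vanish.\<close>
  define l where "l = (L + r) / 2"
  define l' where "l' = (L + l) / 2"
  have "L < r" using wa h by (simp add: r_def field_simps)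
  then have l: "L < l" "l < r" by (auto simp: l_def)
  then have l': "L < l'" "l' < l" by (auto simp: l'_def)
  define \<eta> where "\<eta> = w a - l * norm h"
  have \<eta>: "\<eta> > 0" using l h by (simp add: \<eta>_def r_def field_simps)
  have cw: "continuous_on UNIV w" unfolding w_def
    by (intro continuous_intros continuous_on_compose2[OF u0_continuous]) auto
  have "open {x. w x > w a - \<eta> / 4}" using cw by (intro open_Collect_less continuous_on_const)
  moreover have "a \<in> {x. w x > w a - \<eta> / 4}" using \<eta> by simp
  \<comment> \<open>The increment drops by at most \<open>\<eta> / 4\<close> on the box, and
    replacing \<open>u0\<close> by \<open>U j\<close> at two points costs another
    \<open>\<eta> / 4\<close>; half of the excess \<open>\<eta>\<close> remains.\<close>
  ultimately obtain c d where Q: "a \<in> box c d" "cbox c d \<subseteq> {x. w x > w a - \<eta> / 4}"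
    by (metis open_contains_cbox)
  define m where "m = measure lborel (cbox c d)"
  have "box c d \<noteq> {}" using Q by auto
  then have m: "m > 0" unfolding m_def using content_pos_lt_eq box_ne_empty(2) by metis
  have "filterlim (\<lambda>j. (l / l') powr p j) at_top sequentially"
    using l' L by (intro filterlim_const_powr_at_top p_at_top) (simp add: field_simps)
  then have ev1: "\<forall>\<^sub>F j in sequentially. (l / l') powr p j > norm h * l / (\<eta> / 2 * m)"
    by (simp add: filterlim_at_top_dense)
  have ev2: "\<forall>\<^sub>F j in sequentially. \<forall>x. \<bar>U j x - u0 x\<bar> < \<eta> / 8"
    using \<eta> by (intro U_close) auto
  have ev3: "\<forall>\<^sub>F j in sequentially. Lambda_p (p j) \<Omega> \<le> l' powr p j"
    using l' by (intro Lambda_p_le) (auto simp: L_def)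
  have "\<forall>\<^sub>F j::nat in sequentially. False"
    using ev1 ev2 ev3
  proof eventually_elim
    case (elim j)
    obtain g where g: "W0_grad (p j) \<Omega> (U j) g" "(LINT x|lborel. norm (g x) powr p j) = Lambda_p (p j) \<Omega>"
      using eigen[of j] unfolding first_eigenfunction_def by auto
    have iU: "set_integrable lborel (cbox c d) (\<lambda>x. U j (x + e))" for e
      unfolding set_integrable_def
      by (intro borel_integrable_compact continuous_on_compose2[OF U_continuous]) (auto intro!: continuous_intros)
    have lL: "l > 0" using l L by simp
    have "(l * norm h + \<eta> / 2) * m = (LINT x:cbox c d|lborel. l * norm h + \<eta> / 2)"
      unfolding m_def by (simp add: set_lebesgue_integral_def)
    also have "\<dots> \<le> (LINT x:cbox c d|lborel. U j (x + h) - U j x)"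
    proof (rule set_integral_mono)
      show "set_integrable lborel (cbox c d) (\<lambda>x. l * norm h + \<eta> / 2)"
        unfolding set_integrable_def by (intro borel_integrable_compact) auto
      show "set_integrable lborel (cbox c d) (\<lambda>x. U j (x + h) - U j x)"
        using iU[of h] iU[of 0] by auto
      fix x assume "x \<in> cbox c d"
      then have "w x > w a - \<eta> / 4" using Q by blast
      moreover have "\<bar>U j (x + h) - u0 (x + h)\<bar> < \<eta> / 8" "\<bar>U j x - u0 x\<bar> < \<eta> / 8" using elim by auto
      ultimately show "l * norm h + \<eta> / 2 \<le> U j (x + h) - U j x" unfolding w_def[of x] using \<eta>_def by linarith
    qed
    also have "\<dots> = (LINT x:cbox c d|lborel. U j (x + h)) - (LINT x:cbox c d|lborel. U j x)"
      using iU[of h] iU[of 0] by simp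
    also have "\<dots> \<le> norm h * (l * m + l powr (1 - p j) * Lambda_p (p j) \<Omega>)"
      using W0_grad_box_increment[OF g(1) _ lL, of c d h] p_gt_1[of j] unfolding m_def g(2) by simp
    also have "\<dots> \<le> norm h * (l * m + l powr (1 - p j) * l' powr p j)"
      using elim by (intro mult_left_mono add_left_mono) auto
    also have "l powr (1 - p j) * l' powr p j = l / (l / l') powr p j"
      using lL l' L by (simp add: powr_diff powr_divide)
    finally have "\<eta> / 2 * m \<le> norm h * l / (l / l') powr p j" by (simp add: algebra_simps)
    moreover have "(l / l') powr p j > 0" using lL l' L by simp
    ultimately have "(l / l') powr p j \<le> norm h * l / (\<eta> / 2 * m)"
      using \<eta> m by (simp add: field_simps)
    then show False using elim by simp
  qed
  then show False by simp
qed

lemma u0_lipschitz: "\<bar>u0 x - u0 y\<bar> \<le> dist x y / inradius"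
  using u0_increment[of x "y - x"] u0_increment[of y "x - y"]
  by (simp add: dist_norm norm_minus_commute[of y x])

lemma u0_le: "u0 x \<le> dist_bd \<Omega> x / inradius"
proof -
  obtain y where "y \<in> frontier \<Omega>" "dist x y = dist_bd \<Omega> x" using nearest_frontier .
  then show ?thesis using u0_lipschitz[of x y] u0_zero[of y] frontier_iff[of y] by auto
qed

text \<open>If the maximum of \<open>u0\<close> were below some \<open>q < 1\<close>, the p-th power
  integrals of \<open>U j\<close> would be at most \<open>q powr p j\<close> times the measure of
  the closure, hence tend to 0 instead of being 1. The bound \<open>u0_le\<close> then forces the
  maximum point onto the high ridge.\<close>

lemma u0_peak:
  obtains x where "x \<in> \<Omega>" "dist_bd \<Omega> x = inradius" "u0 x = 1"
proof -
  have "closure \<Omega> \<noteq> {}" using nonempty by simp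
  then obtain x where x: "x \<in> closure \<Omega>" "\<forall>y\<in>closure \<Omega>. u0 y \<le> u0 x"
    using continuous_attains_sup[OF compact_closure _ u0_continuous] by metis
  have "u0 x \<ge> 1"
  proof (rule ccontr)
    assume n: "\<not> u0 x \<ge> 1"
    define q where "q = (1 + u0 x) / 2"
    have q: "u0 x < q" "q < 1" "q > 0" using n u0_nonneg[of x] by (auto simp: q_def)
    have "filterlim (\<lambda>j. (1 / q) powr p j) at_top sequentially"
      using q by (intro filterlim_const_powr_at_top p_at_top) (simp add: field_simps)
    then have ev1: "\<forall>\<^sub>F j in sequentially. (1 / q) powr p j > measure lborel (closure \<Omega>)"
      by (simp add: filterlim_at_top_dense)
    have ev2: "\<forall>\<^sub>F j in sequentially. \<forall>y. \<bar>U j y - u0 y\<bar> < q - u0 x"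
      using q by (intro U_close) auto
    have "\<forall>\<^sub>F j::nat in sequentially. False"
      using ev1 ev2
    proof eventually_elim
      case (elim j)
      have "1 = (LINT x|lborel. \<bar>U j x\<bar> powr p j)" using U_norm by simp
      also have "\<dots> \<le> (LINT x|lborel. q powr p j * indicator (closure \<Omega>) x)"
      proof (rule integral_mono)
        show "integrable lborel (\<lambda>x. \<bar>U j x\<bar> powr p j)"
          using eigen[of j] unfolding first_eigenfunction_def W0_grad_def by auto
        show "integrable lborel (\<lambda>x. q powr p j * indicator (closure \<Omega>) x)"
          using compact_closure by (auto intro!: integrable_real_indicator emeasure_compact_finite)
        fix y
        show "\<bar>U j y\<bar> powr p j \<le> q powr p j * indicator (closure \<Omega>) y"
        proof (cases "y \<in> closure \<Omega>")
          case True
          then have "U j y \<le> q" using elim(2)[rule_format, of y] x by fastforce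
          then show ?thesis using True U_nonneg[of j y] p_gt_1[of j] by (auto intro!: powr_mono2)
        next
          case False
          then show ?thesis using U_zero[of y j] closure_subset[of \<Omega>] by auto
        qed
      qed
      also have "\<dots> = q powr p j * measure lborel (closure \<Omega>)" by simp
      also have "\<dots> < q powr p j * (1 / q) powr p j" using elim q by (intro mult_strict_left_mono) auto
      also have "\<dots> = 1" using q by (simp add: powr_mult[symmetric])
      finally show False by simp
    qed
    then show False by simp
  qed
  moreover have "u0 x * inradius \<le> dist_bd \<Omega> x" "dist_bd \<Omega> x \<le> inradius"
    using u0_le[of x] inradius_pos dist_bd_le_inradius[OF x(1)] by (simp_all add: field_simps)
  moreover have "1 * inradius \<le> u0 x * inradius" using \<open>u0 x \<ge> 1\<close> inradius_pos by (intro mult_right_mono) auto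
  ultimately have "dist_bd \<Omega> x = inradius" "u0 x * inradius = 1 * inradius" by linarith+
  moreover from this have "x \<in> \<Omega>"
    using x(1) inradius_pos frontier_iff[of x] dist_bd_frontier[of x] by auto
  ultimately show ?thesis using that inradius_pos by simp
qed

end

section \<open>Comparison with supersolutions\<close>

lemma test_C1_diff:
  assumes "open \<Omega>" "test_C1 \<Omega> f Df" "test_C1 \<Omega> g Dg"
  shows "test_C1 \<Omega> (\<lambda>x. f x - g x) (\<lambda>x. Df x - Dg x)"
proof -
  obtain S where S: "compact S" "S \<subseteq> \<Omega>" "\<And>x. x \<notin> S \<Longrightarrow> f x = 0" "\<And>x. x \<notin> S \<Longrightarrow> Df x = 0"
    using test_C1_support[OF assms(2)] by metis
  obtain T where T: "compact T" "T \<subseteq> \<Omega>" "\<And>x. x \<notin> T \<Longrightarrow> g x = 0" "\<And>x. x \<notin> T \<Longrightarrow> Dg x = 0"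
    using test_C1_support[OF assms(3)] by metis
  show ?thesis
  proof (rule test_C1I[OF assms(1) compact_Un[OF S(1) T(1)]])
    fix x
    have "(f has_derivative (\<lambda>h. Df x \<bullet> h)) (at x)" "(g has_derivative (\<lambda>h. Dg x \<bullet> h)) (at x)"
      using assms unfolding test_C1_def by auto
    then have "((\<lambda>x. f x - g x) has_derivative (\<lambda>h. Df x \<bullet> h - Dg x \<bullet> h)) (at x)"
      by (rule has_derivative_diff)
    then show "((\<lambda>x. f x - g x) has_derivative (\<lambda>h. (Df x - Dg x) \<bullet> h)) (at x)"
      by (simp add: inner_diff_left)
  next
    show "continuous_on \<Omega> (\<lambda>x. Df x - Dg x)"
      by (intro continuous_on_diff continuous_on_subset[OF test_C1_continuous(2)[OF assms(2)] subset_UNIV]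
          continuous_on_subset[OF test_C1_continuous(2)[OF assms(3)] subset_UNIV])
  qed (use S T in auto)
qed

text \<open>Since \<open>\<phi>\<close> is positive on \<open>\<Omega>\<close>, the difference
  \<open>f - \<phi>\<close> is positive only inside the support of \<open>f\<close>. The truncation
  is thus compactly supported although \<open>\<phi>\<close> need not vanish at the
  boundary.\<close>

lemma test_C1_truncation:
  fixes f \<phi> :: "'a::euclidean_space \<Rightarrow> real"
  assumes "open \<Omega>" and t: "test_C1 \<Omega> f Df" and \<sigma>: "\<sigma> > 0"
    and pos: "\<And>x. x \<in> \<Omega> \<Longrightarrow> \<phi> x > 0"
    and D: "\<And>x. x \<in> \<Omega> \<Longrightarrow> (\<phi> has_derivative (\<lambda>h. D\<phi> x \<bullet> h)) (at x)"
    and c: "continuous_on \<Omega> D\<phi>"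
  shows "test_C1 \<Omega> (\<lambda>x. if x \<in> \<Omega> then smooth_pos \<sigma> (f x - \<phi> x) else 0)
    (\<lambda>x. if x \<in> \<Omega> then smooth_pos' \<sigma> (f x - \<phi> x) *\<^sub>R (Df x - D\<phi> x) else 0)"
    (is "test_C1 \<Omega> ?\<psi> ?D\<psi>")
proof -
  obtain S where S: "compact S" "S \<subseteq> \<Omega>" "\<And>x. x \<notin> S \<Longrightarrow> f x = 0"
    using test_C1_support[OF t] by metis
  have c\<phi>: "continuous_on \<Omega> \<phi>"
    using D by (meson continuous_at_imp_continuous_on has_derivative_continuous)
  have neg: "f x - \<phi> x \<le> 0" if "x \<in> \<Omega>" "x \<notin> S" for x using S(3) pos that by fastforce
  show ?thesis
  proof (rule test_C1I[OF assms(1) S(1,2)])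
    show "?\<psi> x = 0" "?D\<psi> x = 0" if "x \<notin> S" for x
      using neg[OF _ that] \<sigma> by (auto simp: smooth_pos_nonpos smooth_pos'_nonpos)
    fix x assume x: "x \<in> \<Omega>"
    have "(f has_derivative (\<lambda>h. Df x \<bullet> h)) (at x)" using t unfolding test_C1_def by auto
    then have "((\<lambda>x. f x - \<phi> x) has_derivative (\<lambda>h. Df x \<bullet> h - D\<phi> x \<bullet> h)) (at x)"
      by (rule has_derivative_diff) (rule D[OF x])
    from has_derivative_compose[OF this DERIV_smooth_pos[OF \<sigma>, of "f x - \<phi> x", unfolded has_field_derivative_def]]
    have "((\<lambda>x. smooth_pos \<sigma> (f x - \<phi> x)) has_derivative (\<lambda>h. ?D\<psi> x \<bullet> h)) (at x)"
      using x by (simp add: inner_diff_left)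
    then show "(?\<psi> has_derivative (\<lambda>h. ?D\<psi> x \<bullet> h)) (at x)"
      by (rule has_derivative_transform_within_open[OF _ assms(1) x]) auto
  next
    have "continuous_on \<Omega> (\<lambda>x. smooth_pos' \<sigma> (f x - \<phi> x) *\<^sub>R (Df x - D\<phi> x))"
      by (intro continuous_on_scaleR continuous_on_diff c c\<phi>
          continuous_on_compose2[OF continuous_on_smooth_pos'[OF \<sigma>, of UNIV]]
          continuous_on_subset[OF test_C1_continuous(1)[OF t] subset_UNIV]
          continuous_on_subset[OF test_C1_continuous(2)[OF t] subset_UNIV] subset_UNIV)
    then show "continuous_on \<Omega> ?D\<psi>"
      using continuous_on_cong[of \<Omega> \<Omega> ?D\<psi> "\<lambda>x. smooth_pos' \<sigma> (f x - \<phi> x) *\<^sub>R (Df x - D\<phi> x)"] by simp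
  qed
qed

text \<open>The sum over \<open>Basis\<close> is the p-Laplacian of \<open>\<phi>\<close>. The
  competitor is the eigenfunction minus its smoothed excess \<open>\<psi>U\<close> over
  \<open>\<phi>\<close>. To first order, minimality says that the integral of \<open>\<psi>U\<close>
  times (p-Laplacian of \<open>\<phi>\<close> plus eigenvalue term) is nonnegative, while
  \<open>super\<close> makes the second factor at most \<open>- \<eta>\<close> wherever
  \<open>\<psi>U\<close> is positive. The bound \<open>C\<close> lets the divergence integrals pass
  to the limit.\<close>

lemma eigenfunction_le_supersolution:
  fixes \<phi> U :: "'a::euclidean_space \<Rightarrow> real" and D\<phi> :: "'a \<Rightarrow> 'a" and G :: "'a \<Rightarrow> 'a \<Rightarrow> 'a"
  assumes op: "open \<Omega>" and bd: "bounded \<Omega>" and p: "p > 1" and eig: "first_eigenfunction p \<Omega> U"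
    and pos: "\<And>x. x \<in> \<Omega> \<Longrightarrow> \<phi> x > 0"
    and D: "\<And>x. x \<in> \<Omega> \<Longrightarrow> (\<phi> has_derivative (\<lambda>h. D\<phi> x \<bullet> h)) (at x)"
    and c: "continuous_on \<Omega> D\<phi>" and nz: "\<And>x. x \<in> \<Omega> \<Longrightarrow> D\<phi> x \<noteq> 0"
    and F: "\<And>x i. x \<in> \<Omega> \<Longrightarrow> i \<in> Basis \<Longrightarrow>
      ((\<lambda>x. (norm (D\<phi> x) powr (p - 2) *\<^sub>R D\<phi> x) \<bullet> i) has_derivative (\<lambda>h. G i x \<bullet> h)) (at x)"
    and G: "\<And>i. i \<in> Basis \<Longrightarrow> continuous_on \<Omega> (G i)"
    and C: "\<And>x. x \<in> \<Omega> \<Longrightarrow> \<bar>\<Sum>i\<in>Basis. G i x \<bullet> i\<bar> \<le> C"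
    and \<eta>: "\<eta> > 0"
    and super: "\<And>x. x \<in> \<Omega> \<Longrightarrow> U x > \<phi> x \<Longrightarrow>
      (\<Sum>i\<in>Basis. G i x \<bullet> i) + Lambda_p p \<Omega> * U x powr (p - 1) \<le> - \<eta>"
    and x1: "x1 \<in> \<Omega>"
  shows "U x1 \<le> \<phi> x1"
proof (rule ccontr)
  assume "\<not> U x1 \<le> \<phi> x1"
  then have x1': "U x1 > \<phi> x1" by simp
  let ?H = "smooth_pos 1"
  let ?H' = "smooth_pos' 1"
  define F where "F x = norm (D\<phi> x) powr (p - 2) *\<^sub>R D\<phi> x" for x
  define dv where "dv x = (if x \<in> \<Omega> then \<Sum>i\<in>Basis. G i x \<bullet> i else 0)" for x
  define \<Lambda> where "\<Lambda> = Lambda_p p \<Omega>"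
  obtain g where w: "W0_grad p \<Omega> U g" and U1: "(LINT x|lborel. \<bar>U x\<bar> powr p) = 1"
    and g\<Lambda>: "(LINT x|lborel. norm (g x) powr p) = \<Lambda>"
    and Upos: "\<And>x. x \<in> \<Omega> \<Longrightarrow> U x > 0" and Uz: "\<And>x. x \<notin> \<Omega> \<Longrightarrow> U x = 0"
    using eig unfolding first_eigenfunction_def \<Lambda>_def by auto
  have \<Lambda>0: "\<Lambda> \<ge> 0" unfolding g\<Lambda>[symmetric] by (simp add: integral_nonneg_AE)
  have U0: "U x \<ge> 0" for x using Upos[of x] Uz[of x] by (cases "x \<in> \<Omega>") auto
  have Uc: "continuous_on S U" for S
    using first_eigenfunction_continuous[OF op eig] continuous_on_subset by blast
  obtain f Df where t: "\<And>k. test_C1 \<Omega> (f k) (Df k)"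
    and l1: "(\<lambda>k. LINT x|lborel. \<bar>f k x - U x\<bar> powr p) \<longlonglongrightarrow> 0"
    and l2: "(\<lambda>k. LINT x|lborel. norm (Df k x - g x) powr p) \<longlonglongrightarrow> 0"
    and Um[measurable]: "U \<in> borel_measurable borel" and gm: "g \<in> borel_measurable borel"
    and Ui: "integrable lborel (\<lambda>x. norm (U x) powr p)" and gi: "integrable lborel (\<lambda>x. norm (g x) powr p)"
    using w unfolding W0_grad_def by auto
  note [measurable] = test_C1_measurable[OF t]
  have p0: "p > 0" and p1: "p \<ge> 1" using p by auto
  have f0: "f k x = 0" if "x \<notin> \<Omega>" for k x
    using test_C1_support[OF t[of k]] that by (metis subsetD)
  have c\<phi>: "continuous_on \<Omega> \<phi>"
    using D by (meson continuous_at_imp_continuous_on has_derivative_continuous)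
  have C0: "C \<ge> 0" using C[OF x1] by linarith
  define \<psi> where "\<psi> k x = (if x \<in> \<Omega> then ?H (f k x - \<phi> x) else 0)" for k x
  define D\<psi> where "D\<psi> k x = (if x \<in> \<Omega> then ?H' (f k x - \<phi> x) *\<^sub>R (Df k x - D\<phi> x) else 0)" for k x
  \<comment> \<open>No gradient accompanies this limit of the \<open>\<psi> k\<close>: after
    integration by parts only the values of \<open>\<psi> k\<close> occur.\<close>
  define \<psi>U where "\<psi>U x = (if x \<in> \<Omega> then ?H (U x - \<phi> x) else 0)" for x
  have t\<psi>: "test_C1 \<Omega> (\<psi> k) (D\<psi> k)" for k
    unfolding \<psi>_def D\<psi>_def using pos D c by (intro test_C1_truncation[OF op t]) auto
  have tv: "test_C1 \<Omega> (\<lambda>x. f k x - \<psi> k x) (\<lambda>x. Df k x - D\<psi> k x)" for k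
    by (rule test_C1_diff[OF op t t\<psi>])
  note [measurable] = test_C1_measurable[OF t\<psi>]
  have fin: "emeasure lborel \<Omega> < \<infinity>" using bd by (rule emeasure_bounded_finite)
  have c\<psi>U: "continuous_on \<Omega> (\<lambda>x. ?H (U x - \<phi> x))"
    unfolding smooth_pos_def by (intro continuous_intros Uc c\<phi>) (auto simp: max_def)
  have "(\<lambda>x. indicator \<Omega> x *\<^sub>R ?H (U x - \<phi> x)) \<in> borel_measurable borel"
    using op c\<psi>U by (intro borel_measurable_continuous_on_indicator) auto
  also have "(\<lambda>x. indicator \<Omega> x *\<^sub>R ?H (U x - \<phi> x)) = \<psi>U" by (auto simp: \<psi>U_def split: split_indicator)
  finally have \<psi>Um[measurable]: "\<psi>U \<in> borel_measurable borel" .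
  have "continuous_on \<Omega> (\<lambda>x. \<Sum>i\<in>Basis. G i x \<bullet> i)"
    using G by (intro continuous_on_sum continuous_on_inner continuous_on_const) auto
  then have "(\<lambda>x. indicator \<Omega> x *\<^sub>R (\<Sum>i\<in>Basis. G i x \<bullet> i)) \<in> borel_measurable borel"
    using op by (intro borel_measurable_continuous_on_indicator) auto
  also have "(\<lambda>x. indicator \<Omega> x *\<^sub>R (\<Sum>i\<in>Basis. G i x \<bullet> i)) = dv" by (auto simp: dv_def split: split_indicator)
  finally have dvm[measurable]: "dv \<in> borel_measurable borel" .
  have \<psi>U0: "0 \<le> \<psi>U x" "\<psi>U x \<le> U x" for x
  proof -
    show "0 \<le> \<psi>U x" by (simp add: \<psi>U_def smooth_pos_nonneg)
    show "\<psi>U x \<le> U x"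
    proof (cases "x \<in> \<Omega>")
      case True
      have "0 \<le> U x" "?H (- \<phi> x) = 0" using U0 pos[OF True] by (auto simp: smooth_pos_nonpos)
      then show ?thesis using smooth_pos_incr(2)[of 1 "- \<phi> x" "U x - \<phi> x"] True by (simp add: \<psi>U_def)
    qed (use U0 in \<open>simp add: \<psi>U_def\<close>)
  qed
  have dvC: "\<bar>dv x\<bar> \<le> C" for x using C[of x] C0 by (auto simp: dv_def)
  have "set_integrable lborel \<Omega> U"
    using op fin Ui p1 by (intro set_LINT_norm_le_powr(1)[where l=1 and p=p]) auto
  moreover have "(\<lambda>x. indicator \<Omega> x *\<^sub>R U x) = U" using Uz by (auto split: split_indicator)
  ultimately have Uint: "integrable lborel U" unfolding set_integrable_def by simp
  have dint: "integrable lborel (\<lambda>x. norm (f k x - U x) powr p)" for k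
    using Ui test_C1_integrable(2)[OF t p0] p1 by (intro integrable_norm_powr_diff) auto
  have \<psi>\<psi>: "\<bar>\<psi> k x - \<psi>U x\<bar> \<le> \<bar>f k x - U x\<bar>" for k x
    using smooth_pos_lipschitz(1)[of 1 "f k x - \<phi> x" "U x - \<phi> x"] by (auto simp: \<psi>_def \<psi>U_def)
  have vv: "\<bar>(f k x - \<psi> k x) - (U x - \<psi>U x)\<bar> \<le> \<bar>f k x - U x\<bar>" for k x
    using smooth_pos_lipschitz(2)[of 1 "f k x" "\<phi> x" "U x"] by (auto simp: \<psi>_def \<psi>U_def)
  have vint: "integrable lborel (\<lambda>x. norm (U x - \<psi>U x) powr p)"
    by (rule Bochner_Integration.integrable_bound[OF Ui])
      (use \<psi>U0 U0 p0 in \<open>auto intro!: always_eventually powr_mono2 simp: abs_of_nonneg\<close>)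
  have lv: "(\<lambda>k. LINT x|lborel. \<bar>f k x - \<psi> k x\<bar> powr p) \<longlonglongrightarrow> (LINT x|lborel. \<bar>U x - \<psi>U x\<bar> powr p)"
  proof -
    have vi: "integrable lborel (\<lambda>x. norm (f k x - \<psi> k x) powr p)" for k
      using test_C1_integrable(2)[OF tv p0] .
    have vdi: "integrable lborel (\<lambda>x. norm ((f k x - \<psi> k x) - (U x - \<psi>U x)) powr p)" for k
      by (rule integrable_norm_powr_diff[OF _ _ vi vint p1]) auto
    have "(\<lambda>k. LINT x|lborel. norm ((f k x - \<psi> k x) - (U x - \<psi>U x)) powr p) \<longlonglongrightarrow> 0"
    proof (rule tendsto_sandwich[OF _ _ tendsto_const l1])
      show "\<forall>\<^sub>F k in sequentially. 0 \<le> (LINT x|lborel. norm ((f k x - \<psi> k x) - (U x - \<psi>U x)) powr p)"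
        by (simp add: integral_nonneg_AE)
      show "\<forall>\<^sub>F k in sequentially. (LINT x|lborel. norm ((f k x - \<psi> k x) - (U x - \<psi>U x)) powr p)
         \<le> (LINT x|lborel. \<bar>f k x - U x\<bar> powr p)"
        using vdi dint vv p0 by (intro always_eventually allI integral_mono) (auto intro!: powr_mono2)
    qed
    then have "(\<lambda>k. LINT x|lborel. norm (f k x - \<psi> k x) powr p) \<longlonglongrightarrow> (LINT x|lborel. norm (U x - \<psi>U x) powr p)"
      using vi vint p1 by (intro LINT_norm_powr_tendsto) auto
    then show ?thesis by simp
  qed
  have \<psi>Ui: "integrable lborel \<psi>U"
    by (rule Bochner_Integration.integrable_bound[OF Uint]) (use \<psi>U0 U0 in \<open>auto simp: abs_of_nonneg\<close>)
  have \<psi>Udv: "integrable lborel (\<lambda>x. \<psi>U x * dv x)"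
  proof (rule Bochner_Integration.integrable_bound)
    show "integrable lborel (\<lambda>x. C * \<psi>U x)" using \<psi>Ui by simp
    show "AE x in lborel. norm (\<psi>U x * dv x) \<le> norm (C * \<psi>U x)"
      using \<psi>U0 dvC C0 by (auto simp: abs_mult intro!: always_eventually mult_left_mono simp: mult.commute[of C])
  qed measurable
  have dv_eq: "(\<lambda>x. \<psi> k x * (\<Sum>i\<in>Basis. G i x \<bullet> i)) = (\<lambda>x. \<psi> k x * dv x)" for k
    by (auto simp: \<psi>_def dv_def)
  have ibp: "integrable lborel (\<lambda>x. F x \<bullet> D\<psi> k x)" "integrable lborel (\<lambda>x. \<psi> k x * dv x)"
    "(LINT x|lborel. F x \<bullet> D\<psi> k x) = - (LINT x|lborel. \<psi> k x * dv x)" for k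
    using integration_by_parts_test_C1[OF op t\<psi>[of k], of F G] F G unfolding F_def dv_eq by blast+
  have ldv: "(\<lambda>k. LINT x|lborel. \<psi> k x * dv x) \<longlonglongrightarrow> (LINT x|lborel. \<psi>U x * dv x)"
  proof -
    have z: "(\<lambda>k. LINT x:\<Omega>|lborel. norm (f k x - U x)) \<longlonglongrightarrow> 0"
      using op fin dint p1 l1 by (intro set_LINT_norm_tendsto_0) auto
    have "(\<lambda>k. C * (LINT x:\<Omega>|lborel. norm (f k x - U x))) \<longlonglongrightarrow> 0"
      using tendsto_mult_right_zero[OF z] .
    then have "(\<lambda>k. (LINT x|lborel. \<psi> k x * dv x) - (LINT x|lborel. \<psi>U x * dv x)) \<longlonglongrightarrow> 0"
    proof (rule Lim_null_comparison[rotated], intro always_eventually allI)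
      fix k
      have i1: "integrable lborel (\<lambda>x. \<bar>f k x - U x\<bar>)"
        using test_C1_integrable(1)[OF t p0] Uint by auto
      have e: "(LINT x:\<Omega>|lborel. norm (f k x - U x)) = (LINT x|lborel. \<bar>f k x - U x\<bar>)"
        unfolding set_lebesgue_integral_def using f0 Uz
        by (intro Bochner_Integration.integral_cong) (auto split: split_indicator)
      have "norm ((LINT x|lborel. \<psi> k x * dv x) - (LINT x|lborel. \<psi>U x * dv x))
        = norm (LINT x|lborel. (\<psi> k x - \<psi>U x) * dv x)"
        using ibp(2)[of k] \<psi>Udv by (simp add: left_diff_distrib)
      also have "\<dots> \<le> (LINT x|lborel. norm ((\<psi> k x - \<psi>U x) * dv x))" by (rule integral_norm_bound)
      also have "\<dots> \<le> (LINT x|lborel. C * \<bar>f k x - U x\<bar>)"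
      proof (rule integral_mono)
        show "integrable lborel (\<lambda>x. norm ((\<psi> k x - \<psi>U x) * dv x))"
          using ibp(2)[of k] \<psi>Udv by (auto simp: left_diff_distrib)
        show "integrable lborel (\<lambda>x. C * \<bar>f k x - U x\<bar>)" using i1 by simp
        show "norm ((\<psi> k x - \<psi>U x) * dv x) \<le> C * \<bar>f k x - U x\<bar>" for x
          using mult_mono[OF dvC[of x] \<psi>\<psi>[of k x] C0] by (simp add: abs_mult mult.commute)
      qed
      also have "\<dots> = C * (LINT x:\<Omega>|lborel. norm (f k x - U x))" unfolding e by simp
      finally show "norm ((LINT x|lborel. \<psi> k x * dv x) - (LINT x|lborel. \<psi>U x * dv x))
        \<le> C * (LINT x:\<Omega>|lborel. norm (f k x - U x))" .
    qed
    then show ?thesis by (simp add: LIM_zero_iff)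
  qed
  have lg: "(\<lambda>k. LINT x|lborel. norm (Df k x) powr p) \<longlonglongrightarrow> (LINT x|lborel. norm (g x) powr p)"
    using gm gi test_C1_integrable(3)[OF t p0] p1 l2 by (intro LINT_norm_powr_tendsto) auto
  \<comment> \<open>Convexity of \<open>|\<cdot>|^p\<close>, once for the convex combination of gradients and once as a tangent inequality at \<open>D\<phi>\<close>.\<close>
  have pt: "norm (Df k x - D\<psi> k x) powr p \<le> norm (Df k x) powr p - p * (F x \<bullet> D\<psi> k x)" for k x
  proof (cases "x \<in> \<Omega>")
    case True
    define s where "s = ?H' (f k x - \<phi> x)"
    have s: "0 \<le> s" "s \<le> 1" using smooth_pos'_bounds[of 1] by (auto simp: s_def)
    have "Df k x - D\<psi> k x = (1 - s) *\<^sub>R Df k x + s *\<^sub>R D\<phi> x"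
      using True by (simp add: D\<psi>_def s_def algebra_simps)
    then have "norm (Df k x - D\<psi> k x) powr p \<le> (1 - s) * norm (Df k x) powr p + s * norm (D\<phi> x) powr p"
      using norm_powr_convex_combination[OF s p1] by simp
    also have "\<dots> \<le> (1 - s) * norm (Df k x) powr p
        + s * (norm (Df k x) powr p - p * norm (D\<phi> x) powr (p - 2) * (D\<phi> x \<bullet> (Df k x - D\<phi> x)))"
      using norm_powr_above_tangent[OF nz[OF True] p1, of "Df k x"] s by (intro add_left_mono mult_left_mono) auto
    also have "\<dots> = norm (Df k x) powr p - p * (F x \<bullet> D\<psi> k x)"
      using True by (simp add: D\<psi>_def F_def s_def[symmetric] algebra_simps)
    finally show ?thesis .
  qed (simp add: D\<psi>_def)
  have main_k: "\<Lambda> * (LINT x|lborel. \<bar>f k x - \<psi> k x\<bar> powr p)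
      \<le> (LINT x|lborel. norm (Df k x) powr p) + p * (LINT x|lborel. \<psi> k x * dv x)" for k
  proof -
    have "\<Lambda> * (LINT x|lborel. \<bar>f k x - \<psi> k x\<bar> powr p) \<le> (LINT x|lborel. norm (Df k x - D\<psi> k x) powr p)"
      unfolding \<Lambda>_def by (rule Lambda_p_mult_le[OF op tv p0])
    also have "\<dots> \<le> (LINT x|lborel. norm (Df k x) powr p - p * (F x \<bullet> D\<psi> k x))"
      using test_C1_integrable(3)[OF t p0] test_C1_integrable(3)[OF tv p0] ibp(1) pt
      by (intro integral_mono) auto
    also have "\<dots> = (LINT x|lborel. norm (Df k x) powr p) - p * (LINT x|lborel. F x \<bullet> D\<psi> k x)"
      using test_C1_integrable(3)[OF t p0] ibp(1)[of k] by simp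
    finally show ?thesis using ibp(3)[of k] by simp
  qed
  have main: "\<Lambda> * (LINT x|lborel. \<bar>U x - \<psi>U x\<bar> powr p) \<le> \<Lambda> + p * (LINT x|lborel. \<psi>U x * dv x)"
  proof (rule LIMSEQ_le)
    show "(\<lambda>k. \<Lambda> * (LINT x|lborel. \<bar>f k x - \<psi> k x\<bar> powr p)) \<longlonglongrightarrow> \<Lambda> * (LINT x|lborel. \<bar>U x - \<psi>U x\<bar> powr p)"
      by (intro tendsto_intros lv)
    show "(\<lambda>k. (LINT x|lborel. norm (Df k x) powr p) + p * (LINT x|lborel. \<psi> k x * dv x))
      \<longlonglongrightarrow> \<Lambda> + p * (LINT x|lborel. \<psi>U x * dv x)"
      using lg unfolding g\<Lambda> by (intro tendsto_intros ldv)
  qed (use main_k in blast)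
  have "compact (closure \<Omega>)" using bd by simp
  then obtain B where B: "\<And>x. x \<in> closure \<Omega> \<Longrightarrow> norm (U x) \<le> B"
    using compact_imp_bounded[OF compact_continuous_image[OF Uc]] by (metis bounded_iff imageI)
  have B': "U x \<le> B" if "x \<in> \<Omega>" for x using B[of x] that closure_subset[of \<Omega>] by auto
  have Bpow: "U x powr (p - 1) * \<psi>U x \<le> B powr (p - 1) * \<psi>U x" for x
  proof (cases "x \<in> \<Omega>")
    case True
    then show ?thesis using B'[OF True] U0[of x] p1 \<psi>U0[of x] by (intro mult_right_mono powr_mono2) auto
  qed (simp add: \<psi>U_def)
  have Ui2: "integrable lborel (\<lambda>x. U x powr (p - 1) * \<psi>U x)"
  proof (rule Bochner_Integration.integrable_bound)
    show "integrable lborel (\<lambda>x. B powr (p - 1) * \<psi>U x)" using \<psi>Ui by simp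
    show "AE x in lborel. norm (U x powr (p - 1) * \<psi>U x) \<le> norm (B powr (p - 1) * \<psi>U x)"
      using \<psi>U0 Bpow by (auto intro!: always_eventually simp: abs_mult)
  qed measurable
  \<comment> \<open>Convexity now bounds the p-th power integral of the competitor from below, to
    first order in the removed part \<open>\<psi>U\<close>.\<close>
  have tang: "\<bar>U x\<bar> powr p - p * (U x powr (p - 1) * \<psi>U x) \<le> \<bar>U x - \<psi>U x\<bar> powr p" for x
  proof (cases "x \<in> \<Omega>")
    case True
    then show ?thesis
      using powr_above_tangent[of "U x - \<psi>U x" "U x" p] \<psi>U0[of x] Upos[OF True] p1 by simp
  qed (simp add: \<psi>U_def Uz)
  have "1 - p * (LINT x|lborel. U x powr (p - 1) * \<psi>U x)
      = (LINT x|lborel. \<bar>U x\<bar> powr p - p * (U x powr (p - 1) * \<psi>U x))"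
    using Ui Ui2 U1 by simp
  also have "\<dots> \<le> (LINT x|lborel. \<bar>U x - \<psi>U x\<bar> powr p)"
    using Ui Ui2 vint tang by (intro integral_mono) auto
  finally have "\<Lambda> * (1 - p * (LINT x|lborel. U x powr (p - 1) * \<psi>U x)) \<le> \<Lambda> + p * (LINT x|lborel. \<psi>U x * dv x)"
    using main \<Lambda>0 by (meson mult_left_mono order_trans)
  \<comment> \<open>The zero-order terms cancel, because \<open>U\<close> has unit p-norm and its
    gradient integral equals \<open>\<Lambda>\<close>.\<close>
  then have "0 \<le> p * ((LINT x|lborel. \<psi>U x * dv x) + \<Lambda> * (LINT x|lborel. U x powr (p - 1) * \<psi>U x))"
    by (simp add: algebra_simps)
  then have "0 \<le> (LINT x|lborel. \<psi>U x * dv x) + \<Lambda> * (LINT x|lborel. U x powr (p - 1) * \<psi>U x)"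
    using p0 by (simp add: zero_le_mult_iff)
  also have "\<dots> = (LINT x|lborel. \<psi>U x * dv x + \<Lambda> * (U x powr (p - 1) * \<psi>U x))"
    using \<psi>Udv Ui2 by simp
  also have "\<dots> \<le> (LINT x|lborel. - \<eta> * \<psi>U x)"
  proof (rule integral_mono)
    show "integrable lborel (\<lambda>x. \<psi>U x * dv x + \<Lambda> * (U x powr (p - 1) * \<psi>U x))" using \<psi>Udv Ui2 by simp
    show "integrable lborel (\<lambda>x. - \<eta> * \<psi>U x)" using \<psi>Ui by simp
    fix x
    show "\<psi>U x * dv x + \<Lambda> * (U x powr (p - 1) * \<psi>U x) \<le> - \<eta> * \<psi>U x"
    proof (cases "x \<in> \<Omega> \<and> U x > \<phi> x")
      case True
      then have "dv x + \<Lambda> * U x powr (p - 1) \<le> - \<eta>" using super[of x] by (simp add: dv_def \<Lambda>_def)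
      then have "\<psi>U x * (dv x + \<Lambda> * U x powr (p - 1)) \<le> \<psi>U x * - \<eta>" using \<psi>U0 by (intro mult_left_mono) auto
      then show ?thesis by (simp add: algebra_simps)
    next
      case False
      then have "\<psi>U x = 0" by (auto simp: \<psi>U_def smooth_pos_nonpos)
      then show ?thesis by simp
    qed
  qed
  finally have le0: "(LINT x|lborel. \<psi>U x) \<le> 0" using \<eta> by (simp add: mult_le_0_iff)
  \<comment> \<open>By continuity the excess at \<open>x1\<close> stays above half its value on a
    ball, contradicting the nonpositive integral.\<close>
  define d where "d = \<psi>U x1 / 2"
  have d: "d > 0" using x1 x1' by (simp add: d_def \<psi>U_def smooth_pos_pos)
  have "open {x \<in> \<Omega>. ?H (U x - \<phi> x) \<in> {d<..}}"
    using continuous_open_preimage[OF c\<psi>U op open_greaterThan[of d]] by (simp add: vimage_def Int_def)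
  moreover have "x1 \<in> {x \<in> \<Omega>. ?H (U x - \<phi> x) \<in> {d<..}}" using x1 d by (simp add: d_def \<psi>U_def)
  ultimately obtain r where r: "r > 0" "ball x1 r \<subseteq> {x \<in> \<Omega>. ?H (U x - \<phi> x) \<in> {d<..}}"
    by (meson open_contains_ball)
  have "0 < d * measure lborel (ball x1 r)" using d r by (simp add: content_ball_pos)
  also have "\<dots> = (LINT x|lborel. d * indicator (ball x1 r) x)" by simp
  also have "\<dots> \<le> (LINT x|lborel. \<psi>U x)"
  proof (rule integral_mono)
    show "integrable lborel (\<lambda>x. d * indicator (ball x1 r) x)"
      by (auto intro!: integrable_real_indicator emeasure_bounded_finite)
    show "d * indicator (ball x1 r) x \<le> \<psi>U x" for x
      using r(2) \<psi>U0[of x] by (auto simp: \<psi>U_def split: split_indicator)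
  qed (rule \<psi>Ui)
  finally show False using le0 by simp
qed

section \<open>Radial supersolutions\<close>

text \<open>An exponent of at least 2 flattens the kink at \<open>a\<close>. The exponents 3 and 2
  yield the first two derivatives of the cubic term in the barrier.\<close>

lemma DERIV_max_power:
  fixes a t :: real
  shows "((\<lambda>t. max 0 (t - a) ^ Suc (Suc n)) has_real_derivative real (Suc (Suc n)) * max 0 (t - a) ^ Suc n) (at t)"
proof -
  consider "t < a" | "t = a" | "t > a" by linarith
  then show ?thesis
  proof cases
    case 1
    have "((\<lambda>t. max 0 (t - a) ^ Suc (Suc n)) has_real_derivative 0) (at t)"
      by (rule has_field_derivative_transform_within_open[of "\<lambda>_. 0" _ _ "{..<a}"])
        (use 1 in \<open>auto simp: max_def\<close>)
    then show ?thesis using 1 by (simp add: max_def)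
  next
    case 2
    have "((\<lambda>h::real. (max 0 h ^ Suc (Suc n) - 0) / h) \<longlongrightarrow> 0) (at 0)"
    proof (rule Lim_null_comparison)
      show "\<forall>\<^sub>F h::real in at 0. norm ((max 0 h ^ Suc (Suc n) - 0) / h) \<le> \<bar>h\<bar> ^ Suc n"
        by (intro always_eventually allI) (auto simp: max_def mult_nonpos_nonneg)
      show "((\<lambda>h::real. \<bar>h\<bar> ^ Suc n) \<longlongrightarrow> 0) (at 0)"
        using tendsto_power[OF tendsto_rabs_zero[OF tendsto_ident_at[of "0::real" UNIV]], of "Suc n"] by simp
    qed
    then show ?thesis using 2 by (simp add: DERIV_def)
  next
    case 3
    have "((\<lambda>t. (t - a) ^ Suc (Suc n)) has_real_derivative real (Suc (Suc n)) * (t - a) ^ Suc n) (at t)"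
      by (auto intro!: derivative_eq_intros simp del: power_Suc)
    then have "((\<lambda>t. max 0 (t - a) ^ Suc (Suc n)) has_real_derivative real (Suc (Suc n)) * (t - a) ^ Suc n) (at t)"
      by (rule has_field_derivative_transform_within_open[of _ _ _ "{a<..}"])
        (use 3 in \<open>auto simp: max_def\<close>)
    then show ?thesis using 3 by (simp add: max_def)
  qed
qed

lemma has_derivative_dist:
  fixes x y :: "'a::real_inner"
  assumes "x \<noteq> y"
  shows "((\<lambda>x. dist x y) has_derivative (\<lambda>h. ((x - y) /\<^sub>R dist x y) \<bullet> h)) (at x)"
proof -
  have "((\<lambda>x. x - y) has_derivative (\<lambda>h. h)) (at x)" by (auto intro!: derivative_eq_intros)
  from has_derivative_compose[OF this has_derivative_norm[of "x - y"]] assms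
  show ?thesis by (simp add: dist_norm sgn_div_norm inner_commute)
qed

text \<open>For a radial function with slope \<open>h\<close> the field is
  \<open>q t *\<^sub>R (x - y0)\<close>, and its divergence splits into a radial part with
  \<open>h'\<close> and the curvature part with \<open>DIM('a) - 1\<close>. Keeping
  \<open>y0\<close> at distance \<open>\<tau>\<close> from \<open>\<Omega>\<close> avoids the
  singularity at the centre.\<close>

lemma eigenfunction_le_radial_supersolution:
  fixes \<Omega> :: "'a::euclidean_space set" and G h h' :: "real \<Rightarrow> real"
  assumes op: "open \<Omega>" and bd: "bounded \<Omega>" and p: "p > 1" and eig: "first_eigenfunction p \<Omega> U"
    and \<tau>: "\<tau> > 0" and far: "\<And>x. x \<in> \<Omega> \<Longrightarrow> \<tau> \<le> dist x y0"
    and DG: "\<And>t. t > 0 \<Longrightarrow> (G has_real_derivative h t) (at t)"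
    and Dh: "\<And>t. t > 0 \<Longrightarrow> (h has_real_derivative h' t) (at t)"
    and hpos: "\<And>t. t > 0 \<Longrightarrow> h t > 0" and ch': "continuous_on {0<..} h'"
    and pos: "\<And>x. x \<in> \<Omega> \<Longrightarrow> G (dist x y0) > 0"
    and \<eta>: "\<eta> > 0"
    and super: "\<And>x t. x \<in> \<Omega> \<Longrightarrow> t = dist x y0 \<Longrightarrow> U x > G t \<Longrightarrow>
      (p - 1) * h t powr (p - 2) * h' t + (real DIM('a) - 1) * h t powr (p - 1) / t
        + Lambda_p p \<Omega> * U x powr (p - 1) \<le> - \<eta>"
    and x1: "x1 \<in> \<Omega>"
  shows "U x1 \<le> G (dist x1 y0)"
proof -
  define q where "q t = h t powr (p - 1) / t" for t
  define q' where "q' t = ((p - 1) * h t powr (p - 2) * h' t * t - h t powr (p - 1)) / t\<^sup>2" for t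
  define D\<phi> where "D\<phi> x = (h (dist x y0) / dist x y0) *\<^sub>R (x - y0)" for x
  \<comment> \<open>This is the gradient of the component of \<open>q t *\<^sub>R (x - y0)\<close>
    along \<open>i\<close>, with \<open>t\<close> the distance to \<open>y0\<close>.\<close>
  define GG where "GG i x = q (dist x y0) *\<^sub>R i + (q' (dist x y0) / dist x y0 * ((x - y0) \<bullet> i)) *\<^sub>R (x - y0)" for i x
  have tpos: "dist x y0 > 0" "x \<noteq> y0" if "x \<in> \<Omega>" for x using far[OF that] \<tau> by auto
  have ch: "continuous_on {0<..} h"
    using Dh by (meson DERIV_continuous continuous_at_imp_continuous_on greaterThan_iff)
  have cq: "continuous_on {0<..} q" unfolding q_def
    using hpos by (intro continuous_intros ch) (auto simp: less_imp_neq[symmetric])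
  have cq': "continuous_on {0<..} q'" unfolding q'_def
    using hpos by (intro continuous_intros ch ch') (auto simp: less_imp_neq[symmetric])
  have cd: "continuous_on \<Omega> (\<lambda>x. g (dist x y0))" if "continuous_on {0<..} g" for g :: "real \<Rightarrow> real"
    by (rule continuous_on_compose2[OF that]) (use tpos in \<open>auto intro!: continuous_intros\<close>)
  have Dq: "(q has_real_derivative q' t) (at t)" if "t > 0" for t
  proof -
    have "((\<lambda>t. h t powr (p - 1)) has_real_derivative (p - 1) * h t powr (p - 1 - 1) * h' t) (at t)"
      using DERIV_chain2[OF has_real_derivative_powr[OF hpos[OF that]] Dh[OF that], of "p - 1"] .
    from DERIV_divide[OF this DERIV_ident] that show ?thesis
      unfolding q_def q'_def by (simp add: power2_eq_square)
  qed
  have nD: "norm (D\<phi> x) = h (dist x y0)" if "x \<noteq> y0" for x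
    using that hpos[of "dist x y0"] by (simp add: D\<phi>_def dist_norm)
  have Feq: "norm (D\<phi> x) powr (p - 2) *\<^sub>R D\<phi> x = q (dist x y0) *\<^sub>R (x - y0)" if "x \<noteq> y0" for x
  proof -
    have "h (dist x y0) powr (p - 2) * h (dist x y0) = h (dist x y0) powr (p - 1)"
      using powr_mult_base[of "h (dist x y0)" "p - 2"] hpos[of "dist x y0"] that by (simp add: mult.commute)
    then show ?thesis unfolding nD[OF that] by (simp add: D\<phi>_def q_def)
  qed
  have div: "(\<Sum>i\<in>Basis. GG i x \<bullet> i) =
      (p - 1) * h t powr (p - 2) * h' t + (real DIM('a) - 1) * h t powr (p - 1) / t"
    if "x \<in> \<Omega>" "t = dist x y0" for x t
  proof -
    have t: "t > 0" using tpos that by simp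
    have "(\<Sum>i\<in>Basis. GG i x \<bullet> i) = (\<Sum>i\<in>Basis. q t + q' t / t * (((x - y0) \<bullet> i) * ((x - y0) \<bullet> i)))"
      unfolding GG_def that(2)[symmetric] by (intro sum.cong) (auto simp: inner_add_left)
    also have "\<dots> = real DIM('a) * q t + q' t / t * ((x - y0) \<bullet> (x - y0))"
      unfolding sum.distrib sum_distrib_left[symmetric] euclidean_inner[of "x - y0" "x - y0"] by simp
    also have "(x - y0) \<bullet> (x - y0) = t\<^sup>2" using that by (simp add: dist_norm power2_norm_eq_inner)
    also have "q' t / t * t\<^sup>2 = (p - 1) * h t powr (p - 2) * h' t - h t powr (p - 1) / t"
      using t by (simp add: q'_def power2_eq_square diff_divide_distrib left_diff_distrib)
    finally show ?thesis by (simp add: q_def left_diff_distrib diff_divide_distrib)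
  qed
  \<comment> \<open>Distances to \<open>y0\<close> fill at most the compact interval from
    \<open>\<tau>\<close> to \<open>T\<close>, on which the divergence is bounded by
    continuity.\<close>
  obtain T where T: "\<And>x. x \<in> \<Omega> \<Longrightarrow> dist x y0 \<le> T"
    using bd bounded_any_center[of \<Omega> y0] by (metis dist_commute)
  define dd where "dd t = (p - 1) * h t powr (p - 2) * h' t + (real DIM('a) - 1) * h t powr (p - 1) / t" for t
  have "continuous_on {\<tau>..T} dd"
  proof (rule continuous_on_subset[of "{0<..}"])
    show "continuous_on {0<..} dd" unfolding dd_def
      using hpos by (intro continuous_intros ch ch') (auto simp: less_imp_neq[symmetric])
  qed (use \<tau> in auto)
  then have "bounded (dd ` {\<tau>..T})" by (intro compact_imp_bounded compact_continuous_image) auto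
  then obtain C where C: "\<And>t. t \<in> {\<tau>..T} \<Longrightarrow> \<bar>dd t\<bar> \<le> C"
    by (metis bounded_iff imageI real_norm_def)
  show ?thesis
  proof (rule eigenfunction_le_supersolution[OF op bd p eig, where \<phi>="\<lambda>x. G (dist x y0)" and D\<phi>=D\<phi> and G=GG and C=C and \<eta>=\<eta>])
    fix x assume x: "x \<in> \<Omega>"
    note t = tpos[OF x]
    show "0 < G (dist x y0)" using pos[OF x] .
    from has_derivative_compose[OF has_derivative_dist[OF t(2)] DG[OF t(1), unfolded has_field_derivative_def]]
    show "((\<lambda>x. G (dist x y0)) has_derivative (\<lambda>h. D\<phi> x \<bullet> h)) (at x)"
      by (rule has_derivative_eq_rhs) (simp add: D\<phi>_def fun_eq_iff divide_inverse)
    show "D\<phi> x \<noteq> 0" using nD[OF t(2)] hpos[OF t(1)] by auto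
    show "\<bar>\<Sum>i\<in>Basis. GG i x \<bullet> i\<bar> \<le> C" using C[of "dist x y0"] far[OF x] T[OF x] div[OF x refl] by (simp add: dd_def)
    show "(\<Sum>i\<in>Basis. GG i x \<bullet> i) + Lambda_p p \<Omega> * U x powr (p - 1) \<le> - \<eta>" if "U x > G (dist x y0)"
      using super[OF x refl that] unfolding div[OF x refl] .
    fix i :: 'a assume i: "i \<in> Basis"
    have "((\<lambda>x. q (dist x y0)) has_derivative (\<lambda>h. (((x - y0) /\<^sub>R dist x y0) \<bullet> h) * q' (dist x y0))) (at x)"
      using has_derivative_compose[OF has_derivative_dist[OF t(2)] Dq[OF t(1), unfolded has_field_derivative_def]]
      by (simp add: mult.commute)
    moreover have "((\<lambda>x. (x - y0) \<bullet> i) has_derivative (\<lambda>h. h \<bullet> i)) (at x)"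
      by (auto intro!: derivative_eq_intros)
    ultimately have "((\<lambda>x. q (dist x y0) * ((x - y0) \<bullet> i)) has_derivative
        (\<lambda>h. q (dist x y0) * (h \<bullet> i) + (((x - y0) /\<^sub>R dist x y0) \<bullet> h) * q' (dist x y0) * ((x - y0) \<bullet> i))) (at x)"
      by (rule has_derivative_mult)
    also have "(\<lambda>h. q (dist x y0) * (h \<bullet> i) + (((x - y0) /\<^sub>R dist x y0) \<bullet> h) * q' (dist x y0) * ((x - y0) \<bullet> i))
       = (\<lambda>h. GG i x \<bullet> h)"
      by (simp add: GG_def fun_eq_iff inner_add_left inner_add_right inner_commute divide_inverse mult_ac)
    finally show "((\<lambda>x. (norm (D\<phi> x) powr (p - 2) *\<^sub>R D\<phi> x) \<bullet> i) has_derivative (\<lambda>h. GG i x \<bullet> h)) (at x)"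
      by (rule has_derivative_transform_within_open[of _ _ _ _ "- {y0}"]) (use t Feq in auto)
  next
    show "continuous_on \<Omega> D\<phi>" unfolding D\<phi>_def
      using tpos by (intro continuous_intros cd[OF ch]) auto
    show "continuous_on \<Omega> (GG i)" if "i \<in> Basis" for i unfolding GG_def
      using tpos by (intro continuous_intros cd[OF cq] cd[OF cq']) auto
  qed (use \<eta> x1 in auto)
qed

section \<open>The barrier at a boundary point\<close>

context ground_state_sequence
begin

lemma u0_le_1: "u0 x \<le> 1"
proof (cases "x \<in> closure \<Omega>")
  case True
  have "u0 x \<le> dist_bd \<Omega> x / inradius" by (rule u0_le)
  also have "\<dots> \<le> 1" using dist_bd_le_inradius[OF True] inradius_pos by simp
  finally show ?thesis .
next
  case False
  then have "x \<notin> \<Omega>" using closure_subset by blast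
  then show ?thesis by (simp add: u0_zero)
qed

text \<open>If \<open>u0\<close> stays below \<open>r / inradius\<close> on the ball, there is room
  for barrier slopes large enough to dominate the eigenvalue term and yet smaller than the growth of
  \<open>u0\<close> along \<open>\<nu>\<close>. All constants below divide up this room.\<close>

lemma u0_reaches_slope:
  assumes y: "y \<in> frontier \<Omega>" and \<nu>: "norm \<nu> = 1"
    and normal: "\<And>z. z \<in> \<Omega> \<Longrightarrow> (z - y) \<bullet> \<nu> \<ge> 0"
    and slope: "\<And>b. 0 < b \<Longrightarrow> b < 1 / inradius \<Longrightarrow> \<exists>s0>0. \<forall>s. 0 < s \<and> s \<le> s0 \<longrightarrow> b * s \<le> u0 (y + s *\<^sub>R \<nu>)"
    and r: "0 < r" "r < inradius"
  shows "\<exists>z\<in>cball y r. r / inradius \<le> u0 z"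
proof (rule ccontr)
  assume contra: "\<not> ?thesis"
  define L where "L = 1 / inradius"
  have L: "L > 0" using inradius_pos by (simp add: L_def)
  obtain zM where zM: "zM \<in> cball y r" "\<forall>z\<in>cball y r. u0 z \<le> u0 zM"
    using continuous_attains_sup[OF compact_cball _ u0_continuous, of y r] r by (metis cball_eq_empty not_less_iff_gr_or_eq order_less_asym)
  define M where "M = u0 zM"
  have M: "0 \<le> M" "M < L * r" "\<And>z. dist z y \<le> r \<Longrightarrow> u0 z \<le> M"
  proof -
    show "0 \<le> M" unfolding M_def by (rule u0_nonneg)
    have "\<not> r / inradius \<le> u0 zM" using contra zM(1) by blast
    then show "M < L * r" by (simp add: M_def L_def)
    show "u0 z \<le> M" if "dist z y \<le> r" for z
      using zM(2) that by (simp add: M_def dist_commute)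
  qed
  have Lr: "L * r < 1" using r inradius_pos by (simp add: L_def)
  \<comment> \<open>Two lower bounds for the slope: above \<open>M / r\<close> the barrier passes
    the height \<open>M\<close> before radius \<open>r\<close>, and above \<open>L * M\<close> it
    beats the eigenvalue term. Both are below \<open>L\<close>, the second because
    \<open>M < 1\<close>.\<close>
  define m0 where "m0 = max (M / r) (L * M)"
  have "M / r < L" using M r by (simp add: field_simps)
  moreover have "L * M < L * 1" using M Lr L by (intro mult_strict_left_mono) auto
  ultimately have m0: "0 \<le> m0" "m0 < L" "M / r \<le> m0" "L * M \<le> m0"
    using M r by (auto simp: m0_def le_max_iff_disj)
  \<comment> \<open>The exponential part of the barrier starts with slope \<open>b\<close> and keeps
    at least \<open>\<theta>\<close> up to radius \<open>r\<close>, whereas \<open>u0\<close> grows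
    at rate \<open>b'\<close> near \<open>y\<close>.\<close>
  define \<theta> b b' where "\<theta> = m0 + (L - m0) / 4" and "b = m0 + (L - m0) / 2" and "b' = m0 + 3 * (L - m0) / 4"
  have ord: "0 < \<theta>" "m0 < \<theta>" "\<theta> < b" "b < b'" "b' < L" using m0 by (auto simp: \<theta>_def b_def b'_def field_simps)
  have M\<theta>: "M < \<theta> * r" "L * M < \<theta>"
  proof -
    have "M / r < \<theta>" using m0 ord by linarith
    then show "M < \<theta> * r" using r by (simp add: field_simps)
  qed (use m0 ord in linarith)
  \<comment> \<open>The surplus \<open>r - M / \<theta>\<close> is cut in three: one share shifts
    the centre outwards, one is the layer between \<open>r0\<close> and \<open>r\<close>, and one
    gives the margin \<open>\<theta> * \<tau>\<close> above \<open>M\<close> at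
    \<open>r0\<close>.\<close>
  define \<tau> where "\<tau> = (r - M / \<theta>) / 3"
  have \<tau>: "\<tau> > 0" using M\<theta> ord by (simp add: \<tau>_def field_simps)
  define r0 where "r0 = r - \<tau>"
  have r0: "r0 - \<tau> = M / \<theta> + \<tau>" by (simp add: r0_def \<tau>_def field_simps)
  have "M / \<theta> \<ge> 0" using M ord by simp
  then have r0\<tau>: "r0 - \<tau> > 0" "r0 < r" "\<tau> < r0" using r0 \<tau> by (auto simp: r0_def)
  have \<theta>r0: "\<theta> * (r0 - \<tau>) = M + \<theta> * \<tau>" unfolding r0 using ord by (simp add: distrib_left)
  \<comment> \<open>With this rate the slope \<open>b * exp (- \<kappa> * x)\<close> decays exactly
    to \<open>\<theta>\<close> at \<open>x = r\<close>. Its positivity is the concavity that beats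
    the curvature term for large exponents.\<close>
  define \<kappa> where "\<kappa> = ln (b / \<theta>) / r"
  have \<kappa>: "\<kappa> > 0" using ord r by (simp add: \<kappa>_def)
  have "exp (- \<kappa> * r) = \<theta> / b" using ord r by (simp add: \<kappa>_def exp_minus)
  then have b\<theta>: "b * exp (- \<kappa> * r) = \<theta>" using ord by simp
  obtain s0 where s0: "s0 > 0" "\<And>s. 0 < s \<Longrightarrow> s \<le> s0 \<Longrightarrow> b' * s \<le> u0 (y + s *\<^sub>R \<nu>)"
    using slope[of b'] ord by (auto simp: L_def)
  define s where "s = min s0 (r0 - \<tau>)"
  have s: "s > 0" "s \<le> s0" "\<tau> + s \<le> r0" using s0 r0\<tau> by (auto simp: s_def)
  \<comment> \<open>Half of the lead of slope \<open>b'\<close> over slope \<open>b\<close> at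
    distance \<open>s\<close>. Lifting the barrier by \<open>\<epsilon>\<close> makes it positive on
    \<Omega> and leaves a gap of \<open>\<epsilon>\<close> for the final contradiction.\<close>
  define \<epsilon> where "\<epsilon> = (b' - b) * s / 2"
  have \<epsilon>: "\<epsilon> > 0" using ord s by (simp add: \<epsilon>_def)
  have b's: "b' * s = b * s + 2 * \<epsilon>" unfolding \<epsilon>_def by (simp add: field_simps)
  \<comment> \<open>Beyond radius \<open>r\<close> the cubic term alone is then at least 2, well
    above \<open>u0 \<le> 1\<close>.\<close>
  define K where "K = 6 / \<tau> ^ 3"
  have K: "K > 0" "K / 3 * \<tau> ^ 3 = 2" using \<tau> by (simp_all add: K_def)
  define h where "h t = b * exp (- \<kappa> * (t - \<tau>)) + K * max 0 (t - r0) ^ 2" for t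
  define h' where "h' t = - \<kappa> * (b * exp (- \<kappa> * (t - \<tau>))) + K * (2 * max 0 (t - r0))" for t
  define G0 where "G0 x = (b / \<kappa>) * (1 - exp (- \<kappa> * x))" for x
  \<comment> \<open>The cubic term only lifts the barrier above \<open>u0\<close> beyond radius \<open>r0\<close>, where no control on \<open>u0\<close> is available.\<close>
  define G where "G t = \<epsilon> + G0 (t - \<tau>) + K / 3 * max 0 (t - r0) ^ 3" for t
  define y0 where "y0 = y - \<tau> *\<^sub>R \<nu>"
  have G0_mono: "G0 x \<le> G0 x'" if "x \<le> x'" for x x'
    unfolding G0_def using \<kappa> ord that by (intro mult_left_mono) auto
  have G0_le: "G0 x \<le> b * x" for x
  proof -
    have "1 - exp (- \<kappa> * x) \<le> \<kappa> * x" using exp_ge_add_one_self[of "- \<kappa> * x"] by simp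
    then have "(b / \<kappa>) * (1 - exp (- \<kappa> * x)) \<le> (b / \<kappa>) * (\<kappa> * x)" using \<kappa> ord by (intro mult_left_mono) auto
    then show ?thesis using \<kappa> by (simp add: G0_def)
  qed
  have exp_ge: "\<theta> \<le> b * exp (- \<kappa> * x)" if "x \<le> r" for x
    unfolding b\<theta>[symmetric] using that \<kappa> ord by (intro mult_left_mono) auto
  have G0_ge: "\<theta> * x \<le> G0 x" if "0 \<le> x" "x \<le> r" for x
  proof -
    have "\<theta> * x \<le> b * exp (- \<kappa> * x) * x" using exp_ge that by (intro mult_right_mono) auto
    also have "\<dots> = (b / \<kappa>) * (exp (- \<kappa> * x) * (\<kappa> * x))" using \<kappa> by simp
    also have "\<dots> \<le> (b / \<kappa>) * (exp (- \<kappa> * x) * (exp (\<kappa> * x) - 1))"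
    proof (intro mult_left_mono)
      show "\<kappa> * x \<le> exp (\<kappa> * x) - 1" using exp_ge_add_one_self[of "\<kappa> * x"] by linarith
    qed (use \<kappa> ord in auto)
    also have "\<dots> = G0 x" by (simp add: G0_def right_diff_distrib exp_minus)
    finally show ?thesis .
  qed
  have DG: "(G has_real_derivative h t) (at t)" for t
  proof -
    have "((\<lambda>t. G0 (t - \<tau>)) has_real_derivative b * exp (- \<kappa> * (t - \<tau>))) (at t)"
      unfolding G0_def using \<kappa> by (auto intro!: derivative_eq_intros)
    from DERIV_add[OF DERIV_add[OF DERIV_const this] DERIV_cmult[OF DERIV_max_power[of r0 1 t]], of \<epsilon> "K / 3"]
    show ?thesis unfolding G_def h_def by (simp add: numeral_eq_Suc)
  qed
  have Dh: "(h has_real_derivative h' t) (at t)" for t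
  proof -
    have "((\<lambda>t. b * exp (- \<kappa> * (t - \<tau>))) has_real_derivative - \<kappa> * (b * exp (- \<kappa> * (t - \<tau>)))) (at t)"
      by (auto intro!: derivative_eq_intros)
    from DERIV_add[OF this DERIV_cmult[OF DERIV_max_power[of r0 0 t]], of K]
    show ?thesis unfolding h_def h'_def by (simp add: numeral_eq_Suc)
  qed
  have hpos: "h t > 0" for t unfolding h_def using ord \<theta>_def K by (intro add_pos_nonneg) auto
  have ch': "continuous_on {0<..} h'" unfolding h'_def by (intro continuous_intros)
  \<comment> \<open>The centre is shifted against \<open>\<nu>\<close> and \<Omega> lies in the
    half-space at \<open>y\<close>, so the distance to \<open>y0\<close> dominates both
    \<open>\<tau>\<close> and the distance to \<open>y\<close>.\<close>
  have geo: "\<tau> \<le> dist z y0" "dist z y \<le> dist z y0" if "z \<in> \<Omega>" for z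
  proof -
    have "(dist z y0)\<^sup>2 = (dist z y)\<^sup>2 + 2 * \<tau> * ((z - y) \<bullet> \<nu>) + \<tau>\<^sup>2"
    proof -
      have "\<nu> \<bullet> \<nu> = 1" using \<nu> by (simp add: norm_eq_1)
      moreover have "z - y0 = (z - y) + \<tau> *\<^sub>R \<nu>" by (simp add: y0_def)
      ultimately show ?thesis unfolding dist_norm power2_norm_eq_inner
        by (simp add: inner_add_left inner_add_right inner_commute power2_eq_square algebra_simps)
    qed
    then have "\<tau>\<^sup>2 \<le> (dist z y0)\<^sup>2" "(dist z y)\<^sup>2 \<le> (dist z y0)\<^sup>2"
      using normal[OF that] \<tau> by auto
    then show "\<tau> \<le> dist z y0" "dist z y \<le> dist z y0"
      using power2_le_imp_le zero_le_dist by blast+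
  qed
  have pos: "G (dist z y0) > 0" if "z \<in> \<Omega>" for z
  proof -
    have "G0 0 \<le> G0 (dist z y0 - \<tau>)" using geo[OF that] by (intro G0_mono) auto
    moreover have "0 \<le> K / 3 * max 0 (dist z y0 - r0) ^ 3" using K by simp
    ultimately show ?thesis unfolding G_def using \<epsilon> by (simp add: G0_def)
  qed
  have G_r0: "\<epsilon> + M + \<theta> * \<tau> \<le> G t" if "r0 \<le> t" for t
  proof -
    have "M + \<theta> * \<tau> \<le> G0 (r0 - \<tau>)" using G0_ge[of "r0 - \<tau>"] r0\<tau> \<tau> \<theta>r0 by simp
    also have "\<dots> \<le> G0 (t - \<tau>)" using that by (intro G0_mono) auto
    finally have "M + \<theta> * \<tau> \<le> G0 (t - \<tau>)" .
    moreover have "0 \<le> K / 3 * max 0 (t - r0) ^ 3" using K(1) by simp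
    ultimately show ?thesis unfolding G_def by linarith
  qed
  have G_r: "2 \<le> G t" if "r \<le> t" for t
  proof -
    have "\<tau> ^ 3 \<le> max 0 (t - r0) ^ 3" using that \<tau> by (intro power_mono) (auto simp: r0_def)
    then have "2 \<le> K / 3 * max 0 (t - r0) ^ 3" using K(1) unfolding K(2)[symmetric] by (intro mult_left_mono) auto
    moreover have "0 \<le> G0 (t - \<tau>)" using G0_mono[of 0 "t - \<tau>"] that r0\<tau> by (simp add: G0_def)
    ultimately show ?thesis unfolding G_def using \<epsilon> by linarith
  qed
  \<comment> \<open>Tolerance for \<open>U j\<close> against \<open>u0\<close>: \<open>1/2\<close>
    serves beyond radius \<open>r\<close>, \<open>\<theta> * \<tau>\<close> between
    \<open>r0\<close> and \<open>r\<close>, \<open>\<epsilon>\<close> at \<open>z1\<close>, and the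
    last bound keeps \<open>L * (M + \<delta>)\<close> below \<open>\<theta>\<close>.\<close>
  define \<delta> where "\<delta> = min (min (1/2) \<epsilon>) (min (\<theta> * \<tau>) ((\<theta> - L * M) / (2 * L)))"
  have \<delta>: "\<delta> > 0" "\<delta> \<le> 1/2" "\<delta> \<le> \<epsilon>" "\<delta> \<le> \<theta> * \<tau>" "\<delta> \<le> (\<theta> - L * M) / (2 * L)"
    using \<epsilon> ord \<tau> M\<theta> L by (auto simp: \<delta>_def)
  have "L * \<delta> \<le> (\<theta> - L * M) / 2" using \<delta>(5) L by (simp add: field_simps)
  then have "L * (M + \<delta>) < \<theta>" using M\<theta> by (simp add: distrib_left)
  moreover have M\<delta>: "M + \<delta> > 0" using M \<delta> by simp
  ultimately have "L < \<theta> / (M + \<delta>)" by (simp add: field_simps)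
  then obtain l where l: "L < l" "l < \<theta> / (M + \<delta>)" using dense by blast
  \<comment> \<open>Where \<open>U j\<close> is at most \<open>M + \<delta>\<close>, the eigenvalue
    term is bounded by \<open>l * \<theta>' powr (p j - 1)\<close>, which is eventually at most half
    of \<open>\<theta> powr (p j - 1)\<close>.\<close>
  define \<theta>' where "\<theta>' = l * (M + \<delta>)"
  have l0: "l > 0" using l L by simp
  have \<theta>': "0 < \<theta>'" "\<theta>' < \<theta>" using l l0 M\<delta> by (simp_all add: \<theta>'_def pos_less_divide_eq)
  have p1: "filterlim (\<lambda>j. p j - 1) at_top sequentially"
    using filterlim_tendsto_add_at_top[OF tendsto_const[of "-1"] p_at_top] by (simp add: add.commute)
  have ev1: "\<forall>\<^sub>F j in sequentially. (1 + real DIM('a) / \<tau>) / \<kappa> \<le> p j - 1"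
    using p1 by (simp add: filterlim_at_top)
  have "filterlim (\<lambda>j. (\<theta> / \<theta>') powr (p j - 1)) at_top sequentially"
    using \<theta>' by (intro filterlim_const_powr_at_top p1) (simp add: field_simps)
  then have ev2: "\<forall>\<^sub>F j in sequentially. 2 * l \<le> (\<theta> / \<theta>') powr (p j - 1)" by (simp add: filterlim_at_top)
  have ev3: "\<forall>\<^sub>F j in sequentially. \<forall>x. \<bar>U j x - u0 x\<bar> < \<delta>" using \<delta> by (intro U_close)
  have ev4: "\<forall>\<^sub>F j in sequentially. Lambda_p (p j) \<Omega> \<le> l powr p j" using l by (intro Lambda_p_le) (simp add: L_def)
  define z1 where "z1 = y + s *\<^sub>R \<nu>"
  have uz1: "b' * s \<le> u0 z1" using s0 s by (simp add: z1_def)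
  moreover have "b' * s > 0" using ord s by simp
  ultimately have z1: "z1 \<in> \<Omega>" using u0_zero[of z1] by force
  have "z1 - y0 = (s + \<tau>) *\<^sub>R \<nu>" by (simp add: z1_def y0_def scaleR_add_left)
  then have dz1: "dist z1 y0 = s + \<tau>" using s \<tau> \<nu> by (simp add: dist_norm)
  have "\<forall>\<^sub>F j::nat in sequentially. False"
    using ev1 ev2 ev3 ev4
  proof eventually_elim
    case (elim j)
    let ?p = "p j"
    have pj: "?p > 1" by (rule p_gt_1)
    have "U j z1 \<le> G (dist z1 y0)"
    proof (rule eigenfunction_le_radial_supersolution[OF open_\<Omega> bounded_\<Omega> pj eigen \<tau> geo(1) DG Dh hpos ch' pos _ _ z1])
      show "0 < \<theta> powr (?p - 1) / 2" using ord by simp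
      fix z t assume z: "z \<in> \<Omega>" and t: "t = dist z y0" and UG: "U j z > G t"
      have Uz: "\<bar>U j z - u0 z\<bar> < \<delta>" using elim by blast
      \<comment> \<open>The barrier can lie below \<open>U j\<close> only at radii less than
        \<open>r0\<close>: first \<open>u0 \<le> 1\<close> excludes \<open>t \<ge> r\<close>, then
        the bound \<open>M\<close>, valid for smaller radii, excludes
        \<open>t \<ge> r0\<close>.\<close>
      have "\<not> r \<le> t" using G_r[of t] UG Uz u0_le_1[of z] \<delta> by linarith
      then have "u0 z \<le> M" using M(3)[of z] geo(2)[OF z] t by linarith
      then have UM: "U j z \<le> M + \<delta>" using Uz by linarith
      have "\<not> r0 \<le> t" using G_r0[of t] UG UM \<delta> \<epsilon> by linarith
      then have tr: "\<tau> \<le> t" "t < r0" "t > 0" using geo(1)[OF z] t \<tau> by auto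
      have ht: "h t = b * exp (- \<kappa> * (t - \<tau>))" "h' t = - \<kappa> * h t" using tr by (auto simp: h_def h'_def)
      have h\<theta>: "\<theta> \<le> h t" unfolding ht using tr r0\<tau> \<tau> by (intro exp_ge) auto
      have hh: "h t powr (?p - 2) * h t = h t powr (?p - 1)"
        using powr_mult_base[of "h t" "?p - 2"] hpos[of t] by (simp add: mult.commute)
      have "(?p - 1) * h t powr (?p - 2) * h' t + (real DIM('a) - 1) * h t powr (?p - 1) / t
         = (- (\<kappa> * (?p - 1)) + (real DIM('a) - 1) / t) * h t powr (?p - 1)"
        unfolding ht(2) hh[symmetric] by (simp add: algebra_simps)
      also have "\<dots> \<le> (- 1) * h t powr (?p - 1)"
      proof (rule mult_right_mono)
        have "(real DIM('a) - 1) / t \<le> real DIM('a) / \<tau>"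
          using tr \<tau> by (intro frac_le) auto
        moreover have "1 + real DIM('a) / \<tau> \<le> \<kappa> * (?p - 1)" using elim(1) \<kappa> by (simp add: field_simps)
        ultimately show "- (\<kappa> * (?p - 1)) + (real DIM('a) - 1) / t \<le> - 1" by linarith
      qed auto
      also have "\<dots> \<le> - (\<theta> powr (?p - 1))" using h\<theta> ord pj by (auto intro!: powr_mono2)
      finally have A: "(?p - 1) * h t powr (?p - 2) * h' t + (real DIM('a) - 1) * h t powr (?p - 1) / t
         \<le> - (\<theta> powr (?p - 1))" .
      have "Lambda_p ?p \<Omega> * U j z powr (?p - 1) \<le> l powr ?p * (M + \<delta>) powr (?p - 1)"
        using elim UM U_nonneg[of j z] pj by (intro mult_mono powr_mono2) auto
      also have "\<dots> = l * \<theta>' powr (?p - 1)"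
      proof -
        have "l powr ?p = l * l powr (?p - 1)" using powr_mult_base[of l "?p - 1"] l0 by simp
        then show ?thesis unfolding \<theta>'_def using l0 M\<delta> by (simp add: powr_mult)
      qed
      also have "\<dots> \<le> \<theta> powr (?p - 1) / 2"
      proof -
        have "2 * l \<le> \<theta> powr (?p - 1) / \<theta>' powr (?p - 1)" using elim(2) \<theta>' ord by (simp add: powr_divide)
        then show ?thesis using \<theta>' by (simp add: field_simps)
      qed
      finally show "(?p - 1) * h t powr (?p - 2) * h' t + (real DIM('a) - 1) * h t powr (?p - 1) / t
        + Lambda_p ?p \<Omega> * U j z powr (?p - 1) \<le> - (\<theta> powr (?p - 1) / 2)" using A by linarith
    qed
    also have "G (dist z1 y0) \<le> \<epsilon> + b * s"
    proof -
      have "max 0 (s + \<tau> - r0) = 0" using s by simp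
      then show ?thesis unfolding dz1 G_def using G0_le[of s] by simp
    qed
    finally have "U j z1 \<le> \<epsilon> + b * s" .
    moreover have "\<bar>U j z1 - u0 z1\<bar> < \<delta>" using elim by blast
    ultimately show False using uz1 b's \<delta> by linarith
  qed
  then show False by simp
qed

end

section \<open>Geometry of the overdetermined problem\<close>

lemma has_derivative_squeeze:
  fixes f f1 f2 :: "'a::real_normed_vector \<Rightarrow> real"
  assumes "(f1 has_derivative D) (at x)" "(f2 has_derivative D) (at x)"
    and "f1 x = f x" "f2 x = f x" "\<And>y. f1 y \<le> f y" "\<And>y. f y \<le> f2 y"
  shows "(f has_derivative D) (at x)"
proof -
  have l: "bounded_linear D" using assms(1) by (rule has_derivative_bounded_linear)
  let ?q = "\<lambda>f h. norm (f (x + h) - f x - D h) / norm h"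
  have "((\<lambda>h. ?q f1 h + ?q f2 h) \<longlongrightarrow> 0 + 0) (at 0)"
    using assms(1,2) unfolding has_derivative_at by (intro tendsto_add) auto
  then have z: "((\<lambda>h. ?q f1 h + ?q f2 h) \<longlongrightarrow> 0) (at 0)" by simp
  have "(?q f \<longlongrightarrow> 0) (at 0)"
  proof (rule Lim_null_comparison[OF _ z], intro always_eventually allI)
    fix h
    have "norm (f (x + h) - f x - D h) \<le> norm (f1 (x + h) - f1 x - D h) + norm (f2 (x + h) - f2 x - D h)"
      using assms(3,4) assms(5,6)[of "x + h"] by auto
    then have "?q f h \<le> (norm (f1 (x + h) - f1 x - D h) + norm (f2 (x + h) - f2 x - D h)) / norm h"
      by (intro divide_right_mono) auto
    then show "norm (?q f h) \<le> ?q f1 h + ?q f2 h" by (simp add: add_divide_distrib)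
  qed
  then show ?thesis unfolding has_derivative_at using l by blast
qed

lemma has_derivative_ray_limit:
  fixes f :: "'a::real_normed_vector \<Rightarrow> real"
  assumes "(f has_derivative D) (at x)"
  shows "((\<lambda>t. (f (x + t *\<^sub>R w) - f x) / t) \<longlongrightarrow> D w) (at_right 0)"
proof -
  interpret bounded_linear D using assms by (rule has_derivative_bounded_linear)
  have "(f has_derivative D) (at (x + 0 *\<^sub>R w))" using assms by simp
  moreover have "((\<lambda>t. x + t *\<^sub>R w) has_derivative (\<lambda>t. t *\<^sub>R w)) (at 0)"
    by (auto intro!: derivative_eq_intros)
  ultimately have "((\<lambda>t. f (x + t *\<^sub>R w)) has_derivative (\<lambda>t. D (t *\<^sub>R w))) (at 0)"
    using has_derivative_compose by fastforce
  then have "((\<lambda>t. f (x + t *\<^sub>R w)) has_field_derivative D w) (at 0)"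
    unfolding has_field_derivative_def by (simp add: scaleR mult_commute_abs)
  then have "((\<lambda>t. (f (x + t *\<^sub>R w) - f x) / t) \<longlongrightarrow> D w) (at 0)"
    unfolding has_field_derivative_iff by simp
  then show ?thesis by (rule tendsto_within_subset) auto
qed

section \<open>Boundary gradient and the value of the constant\<close>

locale overdetermined_ground_state = ground_state_sequence +
  fixes Du :: "'a \<Rightarrow> 'a" and c \<delta> :: real
  assumes convex_\<Omega>: "convex \<Omega>" and \<delta>_pos: "\<delta> > 0" and c_pos: "c > 0"
    and Du_continuous: "continuous_on {x\<in>closure \<Omega>. dist_bd \<Omega> x < \<delta>} Du"
    and Du_derivative: "\<And>x. x \<in> \<Omega> \<Longrightarrow> dist_bd \<Omega> x < \<delta> \<Longrightarrow> (u has_derivative (\<lambda>h. Du x \<bullet> h)) (at x)"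
    and Du_frontier: "\<And>x. x \<in> frontier \<Omega> \<Longrightarrow> norm (Du x) = c"
begin

lemma dist_bd_le: "y \<in> frontier \<Omega> \<Longrightarrow> dist_bd \<Omega> x \<le> dist x y"
  unfolding dist_bd_def by (rule infdist_le)

lemma dist_bd_lipschitz: "dist_bd \<Omega> x - dist x y \<le> dist_bd \<Omega> y"
  unfolding dist_bd_def using infdist_triangle[of x "frontier \<Omega>" y] by simp

lemma u0_derivative:
  assumes "x \<in> \<Omega>" "dist_bd \<Omega> x < \<delta>"
  shows "(u0 has_derivative (\<lambda>h. Du x \<bullet> h)) (at x)"
  by (rule has_derivative_transform_within_open[OF Du_derivative[OF assms] open_\<Omega> assms(1)])
    (use closure_subset in \<open>auto simp: u0_def\<close>)

lemma u0_mvt: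
  assumes "t > 0" "\<And>\<tau>. 0 < \<tau> \<Longrightarrow> \<tau> < t \<Longrightarrow> x + \<tau> *\<^sub>R w \<in> \<Omega> \<and> dist_bd \<Omega> (x + \<tau> *\<^sub>R w) < \<delta>"
  obtains \<xi> where "0 < \<xi>" "\<xi> < t" "u0 (x + t *\<^sub>R w) - u0 x = t * (Du (x + \<xi> *\<^sub>R w) \<bullet> w)"
proof -
  have "continuous_on {0..t} (\<lambda>\<tau>. u0 (x + \<tau> *\<^sub>R w))"
    by (rule continuous_on_compose2[OF u0_continuous[of UNIV]]) (auto intro!: continuous_intros)
  moreover have "((\<lambda>\<tau>. u0 (x + \<tau> *\<^sub>R w)) has_derivative (\<lambda>h. Du (x + \<tau> *\<^sub>R w) \<bullet> (h *\<^sub>R w))) (at \<tau>)"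
    if "0 < \<tau>" "\<tau> < t" for \<tau>
  proof -
    have "((\<lambda>\<tau>. x + \<tau> *\<^sub>R w) has_derivative (\<lambda>h. h *\<^sub>R w)) (at \<tau>)"
      by (auto intro!: derivative_eq_intros)
    moreover have "(u0 has_derivative (\<lambda>h. Du (x + \<tau> *\<^sub>R w) \<bullet> h)) (at (x + \<tau> *\<^sub>R w))"
      using assms(2)[OF that] by (intro u0_derivative) auto
    ultimately show ?thesis by (rule has_derivative_compose)
  qed
  ultimately obtain \<xi> where "0 < \<xi>" "\<xi> < t"
    "u0 (x + t *\<^sub>R w) - u0 (x + 0 *\<^sub>R w) = Du (x + \<xi> *\<^sub>R w) \<bullet> ((t - 0) *\<^sub>R w)"
    using mvt[OF assms(1), of "\<lambda>\<tau>. u0 (x + \<tau> *\<^sub>R w)" "\<lambda>\<tau> h. Du (x + \<tau> *\<^sub>R w) \<bullet> (h *\<^sub>R w)"]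
    by (metis greaterThanLessThan_iff)
  then show ?thesis using that by simp
qed

lemma ray_in_collar:
  assumes y: "y \<in> frontier \<Omega>" and ray: "\<And>s. 0 < s \<Longrightarrow> s \<le> 1 \<Longrightarrow> y + s *\<^sub>R w \<in> \<Omega>"
  shows "\<exists>s1>0. \<forall>s. 0 < s \<and> s < s1 \<longrightarrow> y + s *\<^sub>R w \<in> \<Omega> \<and> dist_bd \<Omega> (y + s *\<^sub>R w) < \<delta>"
proof (intro exI[of _ "min 1 (\<delta> / (norm w + 1))"] conjI allI impI)
  have n: "norm w + 1 > 0" by (simp add: add_nonneg_pos)
  then show "0 < min 1 (\<delta> / (norm w + 1))" using \<delta>_pos by simp
  fix s assume s: "0 < s \<and> s < min 1 (\<delta> / (norm w + 1))"
  then show "y + s *\<^sub>R w \<in> \<Omega>" using ray by simp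
  have "dist_bd \<Omega> (y + s *\<^sub>R w) \<le> s * norm w" using dist_bd_le[OF y, of "y + s *\<^sub>R w"] s by (simp add: dist_norm)
  also have "\<dots> \<le> s * (norm w + 1)" using s by (intro mult_left_mono) auto
  also have "\<dots> < \<delta>" using s n by (simp add: pos_less_divide_eq)
  finally show "dist_bd \<Omega> (y + s *\<^sub>R w) < \<delta>" .
qed

text \<open>On the frontier \<open>Du\<close> is tied to \<open>u\<close> only as the continuous
  extension of the gradient from inside, so boundary information is obtained as a limit along rays
  into \<Omega>.\<close>

lemma Du_ray_limit:
  assumes y: "y \<in> frontier \<Omega>" and ray: "\<And>s. 0 < s \<Longrightarrow> s \<le> 1 \<Longrightarrow> y + s *\<^sub>R w \<in> \<Omega>"
  shows "((\<lambda>s. Du (y + s *\<^sub>R w)) \<longlongrightarrow> Du y) (at_right 0)"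
proof -
  let ?N = "{x\<in>closure \<Omega>. dist_bd \<Omega> x < \<delta>}"
  obtain s1 where s1: "s1 > 0" "\<And>s. 0 < s \<Longrightarrow> s < s1 \<Longrightarrow> y + s *\<^sub>R w \<in> \<Omega> \<and> dist_bd \<Omega> (y + s *\<^sub>R w) < \<delta>"
    using ray_in_collar[OF assms] by auto
  have "y \<in> ?N" using y frontier_iff dist_bd_frontier \<delta>_pos by auto
  then have "(Du \<longlongrightarrow> Du y) (at y within ?N)" using Du_continuous by (simp add: continuous_on_def)
  moreover have "((\<lambda>s. y + s *\<^sub>R w) \<longlongrightarrow> y) (at_right 0)" by (auto intro!: tendsto_eq_intros)
  moreover have "\<forall>\<^sub>F s in at_right 0. y + s *\<^sub>R w \<in> ?N"
    unfolding eventually_at_right_field using s1 closure_subset by (intro exI[of _ s1]) auto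
  ultimately show ?thesis using \<open>y \<in> ?N\<close> by (intro continuous_on_tendsto_compose[OF Du_continuous])
qed

lemma ray_to_interior:
  assumes "y \<in> frontier \<Omega>" "z \<in> \<Omega>" "0 < s" "s \<le> 1"
  shows "y + s *\<^sub>R (z - y) \<in> \<Omega>"
proof -
  have "y - s *\<^sub>R (y - z) \<in> interior \<Omega>"
    using assms open_\<Omega> convex_\<Omega> frontier_iff by (intro mem_interior_closure_convex_shrink) (auto simp: interior_open)
  then show ?thesis using open_\<Omega> by (simp add: interior_open algebra_simps)
qed

text \<open>The difference quotients in the direction \<open>Du x\<close> tend to the square of its
  norm, while the Lipschitz bound limits them to \<open>norm (Du x) / inradius\<close>.\<close>

lemma norm_Du_le:
  assumes "x \<in> \<Omega>" "dist_bd \<Omega> x < \<delta>"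
  shows "norm (Du x) \<le> 1 / inradius"
proof -
  have "((\<lambda>t. (u0 (x + t *\<^sub>R Du x) - u0 x) / t) \<longlongrightarrow> Du x \<bullet> Du x) (at_right 0)"
    by (rule has_derivative_ray_limit[OF u0_derivative[OF assms]])
  moreover have "\<forall>\<^sub>F t in at_right 0. (u0 (x + t *\<^sub>R Du x) - u0 x) / t \<le> norm (Du x) / inradius"
    using eventually_at_right_less[of "0::real"]
  proof eventually_elim
    case (elim t)
    have "u0 (x + t *\<^sub>R Du x) - u0 x \<le> t * (norm (Du x) / inradius)"
      using u0_increment[of x "t *\<^sub>R Du x"] elim by simp
    then show ?case using elim by (simp add: pos_divide_le_eq mult.commute)
  qed
  ultimately have "Du x \<bullet> Du x \<le> norm (Du x) / inradius" by (intro tendsto_upperbound) auto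
  then have "norm (Du x) * norm (Du x) \<le> norm (Du x) * (1 / inradius)"
    by (simp add: power2_norm_eq_inner[symmetric] power2_eq_square)
  then show ?thesis using inradius_pos mult_left_le_imp_le[of "norm (Du x)" "norm (Du x)" "1 / inradius"]
    by (cases "Du x = 0") (simp, force)
qed

text \<open>At any boundary point the interior gradient bound passes to the limit and gives the
  upper estimate. The lower one is read off at a boundary point nearest to a peak of
  \<open>u0\<close>.\<close>

lemma c_eq: "c = 1 / inradius"
proof (rule antisym)
  obtain y where y: "y \<in> frontier \<Omega>" using frontier_nonempty by blast
  obtain z where z: "z \<in> \<Omega>" using nonempty by blast
  note ray = ray_to_interior[OF y z]
  obtain s1 where s1: "s1 > 0" "\<And>s. 0 < s \<Longrightarrow> s < s1 \<Longrightarrow> y + s *\<^sub>R (z - y) \<in> \<Omega> \<and> dist_bd \<Omega> (y + s *\<^sub>R (z - y)) < \<delta>"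
    using ray_in_collar[OF y ray] by auto
  have "norm (Du y) \<le> 1 / inradius"
  proof (rule tendsto_upperbound[OF tendsto_norm[OF Du_ray_limit[OF y ray]]])
    show "\<forall>\<^sub>F s in at_right 0. norm (Du (y + s *\<^sub>R (z - y))) \<le> 1 / inradius"
      unfolding eventually_at_right_field using s1 norm_Du_le by (intro exI[of _ s1]) auto
  qed auto
  then show "c \<le> 1 / inradius" using Du_frontier[OF y] by simp
next
  obtain x0 where x0: "x0 \<in> \<Omega>" "dist_bd \<Omega> x0 = inradius" "u0 x0 = 1" using u0_peak .
  obtain y where y: "y \<in> frontier \<Omega>" "dist x0 y = inradius" using nearest_frontier[of x0] x0 by metis
  define w where "w = x0 - y"
  have w: "norm w = inradius" using y by (simp add: w_def dist_norm)
  have ray: "y + s *\<^sub>R w \<in> \<Omega>" if "0 < s" "s \<le> 1" for s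
    unfolding w_def using ray_to_interior[OF y(1) x0(1) that] .
  have uy: "u0 y = 0" using y frontier_iff by (simp add: u0_zero)
  \<comment> \<open>The Lipschitz bounds from both endpoints of the segment force \<open>u0\<close> to be affine on it.\<close>
  have lin: "u0 (y + s *\<^sub>R w) = s" if "0 \<le> s" "s \<le> 1" for s
  proof (rule antisym)
    show "u0 (y + s *\<^sub>R w) \<le> s" using u0_increment[of y "s *\<^sub>R w"] uy w that inradius_pos by simp
    have "x0 = (y + s *\<^sub>R w) + (1 - s) *\<^sub>R w" by (simp add: w_def algebra_simps)
    then show "s \<le> u0 (y + s *\<^sub>R w)"
      using u0_increment[of "y + s *\<^sub>R w" "(1 - s) *\<^sub>R w"] x0(3) w that inradius_pos by simp
  qed
  obtain s1 where s1: "s1 > 0" "\<And>s. 0 < s \<Longrightarrow> s < s1 \<Longrightarrow> y + s *\<^sub>R w \<in> \<Omega> \<and> dist_bd \<Omega> (y + s *\<^sub>R w) < \<delta>"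
    using ray_in_collar[OF y(1) ray] by auto
  have "1 / inradius \<le> norm (Du y)"
  proof (rule tendsto_lowerbound[OF tendsto_norm[OF Du_ray_limit[OF y(1) ray]]])
    have "1 / inradius \<le> norm (Du (y + s *\<^sub>R w))" if s: "0 < s" "s < min 1 s1" for s
    proof -
      have "((\<lambda>t. (u0 (y + s *\<^sub>R w + t *\<^sub>R w) - u0 (y + s *\<^sub>R w)) / t) \<longlongrightarrow> Du (y + s *\<^sub>R w) \<bullet> w) (at_right 0)"
        using s s1(2)[of s] by (intro has_derivative_ray_limit u0_derivative) auto
      moreover have "\<forall>\<^sub>F t in at_right 0. (u0 (y + s *\<^sub>R w + t *\<^sub>R w) - u0 (y + s *\<^sub>R w)) / t = 1"
        unfolding eventually_at_right_field
      proof (intro exI[of _ "1 - s"] conjI allI impI)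
        fix t :: real assume t: "0 < t" "t < 1 - s"
        have "y + s *\<^sub>R w + t *\<^sub>R w = y + (s + t) *\<^sub>R w" by (simp add: algebra_simps)
        then show "(u0 (y + s *\<^sub>R w + t *\<^sub>R w) - u0 (y + s *\<^sub>R w)) / t = 1"
          using lin[of "s + t"] lin[of s] s t by (simp only:) simp
      qed (use s in auto)
      ultimately have "((\<lambda>t::real. 1) \<longlongrightarrow> Du (y + s *\<^sub>R w) \<bullet> w) (at_right 0)"
        by (rule Lim_transform_eventually)
      then have "Du (y + s *\<^sub>R w) \<bullet> w = 1"
        using tendsto_unique[OF trivial_limit_at_right_real _ tendsto_const] by metis
      then have "1 \<le> norm (Du (y + s *\<^sub>R w)) * inradius"
        using norm_cauchy_schwarz[of "Du (y + s *\<^sub>R w)" w] w by simp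
      then show ?thesis using inradius_pos by (simp add: pos_divide_le_eq)
    qed
    then show "\<forall>\<^sub>F s in at_right 0. 1 / inradius \<le> norm (Du (y + s *\<^sub>R w))"
      unfolding eventually_at_right_field using s1(1) by (intro exI[of _ "min 1 s1"]) auto
  qed auto
  then show "1 / inradius \<le> c" using Du_frontier[OF y(1)] by simp
qed

section \<open>The inner normal and the inscribed balls\<close>

definition \<nu> :: "'a \<Rightarrow> 'a" where "\<nu> y = Du y /\<^sub>R c"

lemma norm_\<nu>: "y \<in> frontier \<Omega> \<Longrightarrow> norm (\<nu> y) = 1"
  using Du_frontier c_pos by (simp add: \<nu>_def)

text \<open>If the gradient at \<open>y\<close> pointed away from \<open>z\<close>, then
  \<open>u0\<close>, which is 0 at \<open>y\<close>, would become negative along the segment towards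
  \<open>z\<close>.\<close>

lemma \<nu>_normal:
  assumes y: "y \<in> frontier \<Omega>" and z: "z \<in> \<Omega>"
  shows "(z - y) \<bullet> \<nu> y \<ge> 0"
proof (rule ccontr)
  define w where "w = z - y"
  assume "\<not> (z - y) \<bullet> \<nu> y \<ge> 0"
  then have neg: "Du y \<bullet> w < 0"
    using c_pos by (simp add: w_def \<nu>_def inner_commute mult_less_0_iff not_le)
  have ray: "y + s *\<^sub>R w \<in> \<Omega>" if "0 < s" "s \<le> 1" for s
    unfolding w_def using ray_to_interior[OF y z that] .
  obtain s1 where s1: "s1 > 0" "\<And>s. 0 < s \<Longrightarrow> s < s1 \<Longrightarrow> y + s *\<^sub>R w \<in> \<Omega> \<and> dist_bd \<Omega> (y + s *\<^sub>R w) < \<delta>"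
    using ray_in_collar[OF y ray] by auto
  have "((\<lambda>s. Du (y + s *\<^sub>R w) \<bullet> w) \<longlongrightarrow> Du y \<bullet> w) (at_right 0)"
    by (intro tendsto_inner Du_ray_limit[OF y ray] tendsto_const)
  then have "\<forall>\<^sub>F s in at_right 0. Du (y + s *\<^sub>R w) \<bullet> w < 0" using neg by (rule order_tendstoD)
  then obtain s2 where s2: "s2 > 0" "\<And>s. 0 < s \<Longrightarrow> s < s2 \<Longrightarrow> Du (y + s *\<^sub>R w) \<bullet> w < 0"
    unfolding eventually_at_right_field by auto
  define t where "t = min s1 s2"
  obtain \<xi> where \<xi>: "0 < \<xi>" "\<xi> < t" "u0 (y + t *\<^sub>R w) - u0 y = t * (Du (y + \<xi> *\<^sub>R w) \<bullet> w)"
    using u0_mvt[of t y w] s1 s2 by (auto simp: t_def)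
  have "t * (Du (y + \<xi> *\<^sub>R w) \<bullet> w) < 0" using \<xi> s2 by (intro mult_pos_neg) (auto simp: t_def)
  then show False using \<xi>(3) u0_nonneg[of "y + t *\<^sub>R w"] y frontier_iff by (simp add: u0_zero)
qed

text \<open>It is not known beforehand that \<open>y + s *\<^sub>R \<nu> y\<close> lies in \<Omega>.
  Growth is therefore proved on rays from interior points near \<open>y\<close>, and the starting
  point is then sent to \<open>y\<close>.\<close>

lemma u0_normal_growth:
  assumes y: "y \<in> frontier \<Omega>" and b: "0 < b" "b < c"
  shows "\<exists>s0>0. \<forall>s. 0 < s \<and> s \<le> s0 \<longrightarrow> b * s \<le> u0 (y + s *\<^sub>R \<nu> y)"
proof -
  let ?N = "{x\<in>closure \<Omega>. dist_bd \<Omega> x < \<delta>}"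
  let ?\<nu> = "\<nu> y"
  have yN: "y \<in> ?N" using y frontier_iff dist_bd_frontier \<delta>_pos by auto
  have "Du y \<bullet> Du y = c * c" using Du_frontier[OF y] by (simp add: power2_norm_eq_inner[symmetric] power2_eq_square)
  then have "Du y \<bullet> ?\<nu> = c" using c_pos by (simp add: \<nu>_def)
  moreover have "((\<lambda>x. Du x \<bullet> ?\<nu>) \<longlongrightarrow> Du y \<bullet> ?\<nu>) (at y within ?N)"
    using Du_continuous yN by (intro tendsto_intros) (auto simp: continuous_on_def)
  ultimately have "\<forall>\<^sub>F x in at y within ?N. b < Du x \<bullet> ?\<nu>" using b by (intro order_tendstoD(1)) auto
  then obtain \<rho> where \<rho>: "\<rho> > 0" "\<And>x. x \<in> ?N \<Longrightarrow> x \<noteq> y \<Longrightarrow> dist x y < \<rho> \<Longrightarrow> b < Du x \<bullet> ?\<nu>"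
    unfolding eventually_at by auto
  \<comment> \<open>A start within \<open>d\<close> of \<open>y\<close> and a ray of length at most
    \<open>d\<close> stay where the gradient estimate holds.\<close>
  define d where "d = min \<rho> \<delta> / 2"
  have d: "d > 0" using \<rho> \<delta>_pos by (simp add: d_def)
  have near: "b < Du x \<bullet> ?\<nu>" "dist_bd \<Omega> x < \<delta>" if "x \<in> \<Omega>" "dist x y < 2 * d" for x
  proof -
    have "dist x y < \<rho>" "dist x y < \<delta>" using that by (auto simp: d_def)
    then show *: "dist_bd \<Omega> x < \<delta>" using dist_bd_le[OF y, of x] by simp
    have "x \<noteq> y" using that(1) y frontier_iff by auto
    then show "b < Du x \<bullet> ?\<nu>" using \<rho>(2)[of x] * \<open>dist x y < \<rho>\<close> that(1) closure_subset by blast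
  qed
  have step: "u0 x + b * t \<le> u0 (x + t *\<^sub>R ?\<nu>)"
    if "0 < t" "t \<le> d" "dist x y < d" and path: "\<And>\<tau>. 0 < \<tau> \<Longrightarrow> \<tau> < t \<Longrightarrow> x + \<tau> *\<^sub>R ?\<nu> \<in> \<Omega>" for x t
  proof -
    have nr: "dist (x + \<tau> *\<^sub>R ?\<nu>) y < 2 * d" if \<tau>: "0 < \<tau>" "\<tau> < t" for \<tau>
    proof -
      have "dist (x + \<tau> *\<^sub>R ?\<nu>) y \<le> dist (x + \<tau> *\<^sub>R ?\<nu>) x + dist x y" by (rule dist_triangle)
      also have "dist (x + \<tau> *\<^sub>R ?\<nu>) x = \<tau>" using \<tau> norm_\<nu>[OF y] by (simp add: dist_norm)
      finally show ?thesis using \<tau> \<open>t \<le> d\<close> \<open>dist x y < d\<close> by linarith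
    qed
    obtain \<xi> where \<xi>: "0 < \<xi>" "\<xi> < t" "u0 (x + t *\<^sub>R ?\<nu>) - u0 x = t * (Du (x + \<xi> *\<^sub>R ?\<nu>) \<bullet> ?\<nu>)"
      using u0_mvt[OF \<open>0 < t\<close>, of x ?\<nu>] path near(2) nr by metis
    have "b < Du (x + \<xi> *\<^sub>R ?\<nu>) \<bullet> ?\<nu>" using near(1)[OF path[OF \<xi>(1,2)] nr[OF \<xi>(1,2)]] .
    then have "t * b \<le> t * (Du (x + \<xi> *\<^sub>R ?\<nu>) \<bullet> ?\<nu>)" using \<open>0 < t\<close> by (intro mult_left_mono) auto
    then show ?thesis using \<xi>(3) by (simp add: mult.commute)
  qed
  \<comment> \<open>A ray in direction \<open>\<nu>\<close> cannot leave \<open>\<Omega>\<close> near \<open>y\<close>, because \<open>u0\<close> vanishes at an exit point.\<close>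
  have stay: "x + t *\<^sub>R ?\<nu> \<in> \<Omega>" if x: "x \<in> \<Omega>" "dist x y < d" and t: "0 < t" "t \<le> d" for x t
  proof (rule ccontr)
    assume out: "x + t *\<^sub>R ?\<nu> \<notin> \<Omega>"
    define T where "T = {0..t} \<inter> (\<lambda>\<tau>. x + \<tau> *\<^sub>R ?\<nu>) -` (- \<Omega>)"
    have "closed T" unfolding T_def using open_\<Omega>
      by (intro continuous_closed_preimage) (auto intro!: continuous_intros)
    then have "compact T" unfolding T_def by (meson compact_Icc compact_Int_closed closed_Int inf_le1 bounded_subset compact_eq_bounded_closed compact_imp_bounded)
    moreover have "t \<in> T" using out t by (simp add: T_def)
    ultimately obtain t1 where t1: "t1 \<in> T" "\<And>\<tau>. \<tau> \<in> T \<Longrightarrow> t1 \<le> \<tau>"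
      using compact_attains_inf[of T] by blast
    have t1': "0 < t1" "t1 \<le> t" "x + t1 *\<^sub>R ?\<nu> \<notin> \<Omega>"
      using t1(1) x by (auto simp: T_def order_less_le)
    have "x + \<tau> *\<^sub>R ?\<nu> \<in> \<Omega>" if "0 < \<tau>" "\<tau> < t1" for \<tau>
      using t1(2)[of \<tau>] that t1' by (force simp: T_def)
    then have "u0 x + b * t1 \<le> u0 (x + t1 *\<^sub>R ?\<nu>)" using step[of t1 x] t1' t x by auto
    moreover have "b * t1 > 0" using b t1' by simp
    ultimately show False using u0_zero[OF t1'(3)] u0_nonneg[of x] by simp
  qed
  have inside: "u0 x + b * t \<le> u0 (x + t *\<^sub>R ?\<nu>)" if "x \<in> \<Omega>" "dist x y < d" "0 < t" "t \<le> d" for x t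
    using step[of t x] stay[of x] that by simp
  show ?thesis
  proof (intro exI[of _ d] conjI allI impI)
    fix s assume s: "0 < s \<and> s \<le> d"
    obtain X where X: "\<And>n::nat. X n \<in> \<Omega>" "X \<longlonglongrightarrow> y"
      using y frontier_iff closure_sequential by metis
    have cu: "isCont u0 x" for x using u0_continuous[of UNIV] by (simp add: continuous_on_eq_continuous_at)
    have "(\<lambda>n. u0 (X n + s *\<^sub>R ?\<nu>)) \<longlonglongrightarrow> u0 (y + s *\<^sub>R ?\<nu>)"
      by (intro isCont_tendsto_compose[OF cu] tendsto_intros X)
    moreover have "\<forall>\<^sub>F n in sequentially. b * s \<le> u0 (X n + s *\<^sub>R ?\<nu>)"
      using tendstoD[OF X(2) d]
    proof eventually_elim
      case (elim n)
      then show ?case using inside[OF X(1) elim, of s] s u0_nonneg[of "X n"] by linarith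
    qed
    ultimately show "b * s \<le> u0 (y + s *\<^sub>R ?\<nu>)" by (rule tendsto_lowerbound) auto
  qed (use d in auto)
qed

text \<open>The inscribed ball around \<open>z\<close> lies in the supporting half-space at
  \<open>y\<close>, so \<open>z - y\<close> has component at least \<open>dist_bd \<Omega> z\<close>
  along \<open>\<nu> y\<close>. Its norm is no larger than that, which leaves no tangential
  part.\<close>

lemma nearest_normal:
  assumes y: "y \<in> frontier \<Omega>" and z: "z \<in> \<Omega>" and "dist z y \<le> dist_bd \<Omega> z"
  shows "z = y + dist_bd \<Omega> z *\<^sub>R \<nu> y"
proof -
  define \<rho> where "\<rho> = dist_bd \<Omega> z"
  let ?\<nu> = "\<nu> y"
  have \<rho>: "\<rho> > 0" using dist_bd_pos[OF z] by (simp add: \<rho>_def)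
  have \<nu>1: "?\<nu> \<bullet> ?\<nu> = 1" using norm_\<nu>[OF y] by (simp add: norm_eq_1)
  have "t \<le> (z - y) \<bullet> ?\<nu>" if t: "0 < t" "t < \<rho>" for t
  proof -
    have "z - t *\<^sub>R ?\<nu> \<in> ball z (dist_bd \<Omega> z)"
      using t norm_\<nu>[OF y] by (simp add: dist_norm \<rho>_def)
    then have "z - t *\<^sub>R ?\<nu> \<in> \<Omega>" using ball_dist_bd_subset[OF z] by blast
    from \<nu>_normal[OF y this] show ?thesis using \<nu>1 by (simp add: inner_diff_left algebra_simps)
  qed
  then have ge: "\<rho> \<le> (z - y) \<bullet> ?\<nu>" using \<rho> by (rule dense_le_bounded[rotated]) auto
  have "(norm (z - y - \<rho> *\<^sub>R ?\<nu>))\<^sup>2 = (norm (z - y))\<^sup>2 - 2 * \<rho> * ((z - y) \<bullet> ?\<nu>) + \<rho>\<^sup>2"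
    using \<nu>1 unfolding power2_norm_eq_inner
    by (simp add: inner_diff_left inner_diff_right inner_commute power2_eq_square algebra_simps)
  also have "\<dots> \<le> \<rho>\<^sup>2 - 2 * \<rho> * \<rho> + \<rho>\<^sup>2"
  proof -
    have "(norm (z - y))\<^sup>2 \<le> \<rho>\<^sup>2" using assms(3) by (intro power_mono) (auto simp: dist_norm \<rho>_def)
    moreover have "2 * \<rho> * \<rho> \<le> 2 * \<rho> * ((z - y) \<bullet> ?\<nu>)" using ge \<rho> by (intro mult_left_mono) auto
    ultimately show ?thesis by linarith
  qed
  also have "\<dots> = 0" by (simp add: power2_eq_square)
  finally have "norm (z - y - \<rho> *\<^sub>R ?\<nu>) = 0" by simp
  then show ?thesis by (simp add: \<rho>_def algebra_simps)
qed

text \<open>The passage \<open>r \<rightarrow> inradius\<close> is made on values: the maximum of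
  \<open>u0\<close> over the closed ball of radius \<open>inradius\<close> is at least
  \<open>r / inradius\<close> for every smaller \<open>r\<close>, hence 1. The maximum point has
  \<open>y\<close> as a nearest boundary point, so \<open>nearest_normal\<close> determines its
  position.\<close>

lemma inner_ball_at_frontier:
  assumes y: "y \<in> frontier \<Omega>"
  defines "z \<equiv> y + inradius *\<^sub>R \<nu> y"
  shows "z \<in> \<Omega>" "dist_bd \<Omega> z = inradius" "u0 z = 1"
proof -
  let ?R = inradius
  have slope: "\<exists>s0>0. \<forall>s. 0 < s \<and> s \<le> s0 \<longrightarrow> b * s \<le> u0 (y + s *\<^sub>R \<nu> y)" if "0 < b" "b < 1 / inradius" for b
    using u0_normal_growth[OF y] that c_eq by simp
  have reach: "\<exists>w\<in>cball y r. r / ?R \<le> u0 w" if "0 < r" "r < ?R" for r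
    using u0_reaches_slope[OF y norm_\<nu>[OF y] _ _ that] \<nu>_normal[OF y] slope by blast
  have "cball y ?R \<noteq> {}" using inradius_pos by simp
  then obtain v where v: "v \<in> cball y ?R" "\<And>w. w \<in> cball y ?R \<Longrightarrow> u0 w \<le> u0 v"
    using continuous_attains_sup[OF compact_cball _ u0_continuous] by metis
  have "r \<le> u0 v * ?R" if "0 < r" "r < ?R" for r
  proof -
    from reach[OF that] obtain w where w: "w \<in> cball y r" "r / ?R \<le> u0 w" by blast
    have "w \<in> cball y ?R" using w that by simp
    then have "r / ?R \<le> u0 v" using v(2)[of w] w by linarith
    then show ?thesis using inradius_pos by (simp add: pos_divide_le_eq)
  qed
  then have "?R \<le> u0 v * ?R" using inradius_pos by (rule dense_le_bounded[rotated]) auto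
  then have "1 \<le> u0 v" using inradius_pos by simp
  then have u1: "u0 v = 1" using u0_le_1[of v] by linarith
  then have v\<Omega>: "v \<in> \<Omega>" using u0_zero[of v] by force
  have "?R \<le> dist_bd \<Omega> v" using u0_le[of v] u1 inradius_pos by (simp add: pos_le_divide_eq)
  then have dv: "dist_bd \<Omega> v = ?R" using dist_bd_le_inradius[of v] v\<Omega> closure_subset[of \<Omega>]
    by (meson antisym subsetD)
  have "v = z" unfolding z_def using nearest_normal[OF y v\<Omega>] v(1) dv by (simp add: dist_commute)
  then show "z \<in> \<Omega>" "dist_bd \<Omega> z = ?R" "u0 z = 1" using u1 v\<Omega> dv by auto
qed

lemma u0_eq_dist:
  assumes "x \<in> \<Omega>"
  shows "u0 x = c * dist_bd \<Omega> x"
proof (rule antisym)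
  show "u0 x \<le> c * dist_bd \<Omega> x" using u0_le[of x] by (simp add: c_eq)
  obtain y where y: "y \<in> frontier \<Omega>" "dist x y = dist_bd \<Omega> x" using nearest_frontier .
  let ?d = "dist_bd \<Omega> x"
  have x: "x = y + ?d *\<^sub>R \<nu> y" using nearest_normal[OF y(1) assms] y by simp
  have dR: "?d \<le> inradius" using assms closure_subset dist_bd_le_inradius by blast
  define h where "h = (inradius - ?d) *\<^sub>R \<nu> y"
  have "y + inradius *\<^sub>R \<nu> y = x + h" by (subst x) (simp add: h_def algebra_simps)
  then have "u0 (x + h) = 1" using inner_ball_at_frontier(3)[OF y(1)] by simp
  moreover have "norm h = inradius - ?d" using dR norm_\<nu>[OF y(1)] by (simp add: h_def)
  ultimately have "1 - u0 x \<le> (inradius - ?d) / inradius" using u0_increment[of x h] by simp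
  then show "c * ?d \<le> u0 x" using inradius_pos by (simp add: c_eq diff_divide_distrib)
qed

section \<open>Cut locus and high ridge\<close>

lemma dist_bd_differentiable:
  assumes "x \<in> \<Omega>" "dist_bd \<Omega> x < inradius"
  shows "dist_bd \<Omega> differentiable (at x)"
proof -
  obtain y where y: "y \<in> frontier \<Omega>" "dist x y = dist_bd \<Omega> x" using nearest_frontier .
  let ?d = "dist_bd \<Omega> x" and ?\<nu> = "\<nu> y"
  define z where "z = y + inradius *\<^sub>R ?\<nu>"
  have x: "x = y + ?d *\<^sub>R ?\<nu>" using nearest_normal[OF y(1) assms(1)] y by simp
  have d0: "?d > 0" by (rule dist_bd_pos[OF assms(1)])
  have xz: "x - z = - ((inradius - ?d) *\<^sub>R ?\<nu>)" by (subst x) (simp add: z_def algebra_simps)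
  have dz: "dist x z = inradius - ?d" unfolding dist_norm xz using assms norm_\<nu>[OF y(1)] by simp
  have xy: "x - y = ?d *\<^sub>R ?\<nu>" using x by (metis add_diff_cancel_left')
  have "(dist_bd \<Omega> has_derivative (\<lambda>h. ?\<nu> \<bullet> h)) (at x)"
  proof (rule has_derivative_squeeze[where ?f1.0="\<lambda>w. inradius - dist w z" and ?f2.0="\<lambda>w. dist w y"])
    have "x \<noteq> z" using dz assms by auto
    from has_derivative_diff[OF has_derivative_const has_derivative_dist[OF this], of inradius]
    show "((\<lambda>w. inradius - dist w z) has_derivative (\<lambda>h. ?\<nu> \<bullet> h)) (at x)"
      unfolding dz xz using assms by simp
    have "x \<noteq> y" using y d0 by auto
    from has_derivative_dist[OF this] show "((\<lambda>w. dist w y) has_derivative (\<lambda>h. ?\<nu> \<bullet> h)) (at x)"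
      unfolding y(2) xy using d0 by simp
    show "inradius - dist x z = ?d" "dist x y = ?d" using dz y by auto
    fix w
    show "inradius - dist w z \<le> dist_bd \<Omega> w"
      using dist_bd_lipschitz[of z w] inner_ball_at_frontier(2)[OF y(1)] by (simp add: z_def dist_commute)
    show "dist_bd \<Omega> w \<le> dist w y" by (rule dist_bd_le[OF y(1)])
  qed
  then show ?thesis unfolding differentiable_def by blast
qed

text \<open>At a maximum the derivative would vanish, but towards a nearest boundary point the
  distance decreases linearly.\<close>

lemma dist_bd_not_differentiable:
  assumes "x \<in> \<Omega>" "dist_bd \<Omega> x = inradius"
  shows "\<not> dist_bd \<Omega> differentiable (at x)"
proof
  assume "dist_bd \<Omega> differentiable (at x)"
  then obtain D where D: "(dist_bd \<Omega> has_derivative D) (at x)" unfolding differentiable_def by blast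
  have "dist_bd \<Omega> w \<le> dist_bd \<Omega> x" if "w \<in> \<Omega>" for w
    using dist_bd_le_inradius[of w] that closure_subset assms by auto
  then have D0: "D = (\<lambda>h. 0)"
    by (intro differential_zero_maxmin[OF assms(1) open_\<Omega> D] disjI1) auto
  obtain y where y: "y \<in> frontier \<Omega>" "dist x y = inradius" using nearest_frontier[of x] assms by metis
  have "\<forall>\<^sub>F t in at_right 0. (dist_bd \<Omega> (x + t *\<^sub>R (y - x)) - dist_bd \<Omega> x) / t = - inradius"
    unfolding eventually_at_right_field
  proof (intro exI[of _ 1] conjI allI impI)
    fix t :: real assume t: "0 < t" "t < 1"
    let ?w = "x + t *\<^sub>R (y - x)"
    have n: "norm (y - x) = inradius" using y by (simp add: dist_norm norm_minus_commute)
    have "?w - y = (1 - t) *\<^sub>R (x - y)" by (simp add: algebra_simps)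
    then have "dist ?w y = (1 - t) * inradius" using n t by (simp add: dist_norm norm_minus_commute)
    then have "dist_bd \<Omega> ?w \<le> (1 - t) * inradius" using dist_bd_le[OF y(1), of ?w] by simp
    moreover have "dist x ?w = t * inradius" using n t by (simp add: dist_norm)
    then have "inradius - t * inradius \<le> dist_bd \<Omega> ?w" using dist_bd_lipschitz[of x ?w] assms by simp
    ultimately have "dist_bd \<Omega> ?w = (1 - t) * inradius" by (simp add: left_diff_distrib)
    then show "(dist_bd \<Omega> ?w - dist_bd \<Omega> x) / t = - inradius" using t assms by (simp add: left_diff_distrib)
  qed auto
  from Lim_transform_eventually[OF has_derivative_ray_limit[OF D, of "y - x"] this]
  have "((\<lambda>t::real. - inradius) \<longlongrightarrow> 0) (at_right 0)" by (simp add: D0)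
  then have "- inradius = 0"
    using tendsto_unique[OF trivial_limit_at_right_real _ tendsto_const] by metis
  then show False using inradius_pos by simp
qed

text \<open>The set of non-differentiability already equals the high ridge before the closure is
  taken, and the high ridge is closed.\<close>

lemma stadium: "stadium_like \<Omega>"
proof -
  have "{x\<in>\<Omega>. \<not> (dist_bd \<Omega> differentiable (at x))} = high_ridge \<Omega>"
  proof (intro equalityI subsetI)
    fix x assume "x \<in> {x\<in>\<Omega>. \<not> (dist_bd \<Omega> differentiable (at x))}"
    then have x: "x \<in> \<Omega>" "\<not> dist_bd \<Omega> differentiable (at x)" by auto
    then have xc: "x \<in> closure \<Omega>" using closure_subset by blast
    then have "dist_bd \<Omega> x = inradius"
      using dist_bd_differentiable[OF x(1)] x(2) dist_bd_le_inradius[OF xc] by linarith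
    then show "x \<in> high_ridge \<Omega>" using xc by (simp add: high_ridge_def inradius_def)
  next
    fix x assume "x \<in> high_ridge \<Omega>"
    then have x: "x \<in> closure \<Omega>" "dist_bd \<Omega> x = inradius" by (auto simp: high_ridge_def inradius_def)
    then have "x \<in> \<Omega>" using frontier_iff[of x] dist_bd_frontier[of x] inradius_pos by auto
    then show "x \<in> {x\<in>\<Omega>. \<not> (dist_bd \<Omega> differentiable (at x))}"
      using dist_bd_not_differentiable x by blast
  qed
  moreover have "closed (high_ridge \<Omega>)"
  proof -
    have "closed (closure \<Omega> \<inter> dist_bd \<Omega> -` {inradius})"
      by (intro continuous_closed_preimage continuous_on_dist_bd) auto
    moreover have "closure \<Omega> \<inter> dist_bd \<Omega> -` {inradius} = high_ridge \<Omega>"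
      by (auto simp: high_ridge_def inradius_def)
    ultimately show ?thesis by simp
  qed
  ultimately show ?thesis unfolding stadium_like_def cut_locus_def by simp
qed

lemma u_eq_dist:
  assumes "x \<in> closure \<Omega>"
  shows "u x = c * dist_bd \<Omega> x"
proof (cases "x \<in> \<Omega>")
  case True
  then show ?thesis using u0_eq_dist[OF True] assms by (simp add: u0_def)
next
  case False
  then have "x \<in> frontier \<Omega>" using assms frontier_iff by blast
  then show ?thesis using u0_zero[OF False] dist_bd_frontier[of x] assms by (simp add: u0_def)
qed

end

theorem theorem1p1:
  fixes \<Omega> :: "'a::euclidean_space set" and u :: "'a \<Rightarrow> real" and c :: real
  assumes "open \<Omega>" and "bounded \<Omega>" and "convex \<Omega>"
    and "variational_inf_ground_state \<Omega> u"
    and "\<exists>\<delta>>0. \<exists>Du. continuous_on {x\<in>closure \<Omega>. dist_bd \<Omega> x < \<delta>} Du \<and>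
           (\<forall>x\<in>{x\<in>\<Omega>. dist_bd \<Omega> x < \<delta>}. (u has_derivative (\<lambda>h. Du x \<bullet> h)) (at x)) \<and>
           (\<forall>x\<in>frontier \<Omega>. norm (Du x) = c)"
    and "c > 0"
  shows "c = Lambda_inf \<Omega> \<and> (\<forall>x\<in>closure \<Omega>. u x = c * dist_bd \<Omega> x) \<and> stadium_like \<Omega>"
proof -
  obtain p U where pU: "\<And>j. p j > 1" "\<And>j. first_eigenfunction (p j) \<Omega> (U j)"
    "filterlim p at_top sequentially" "uniform_limit (closure \<Omega>) U u sequentially"
    using assms(4) unfolding variational_inf_ground_state_def by metis
  obtain \<delta> Du where D: "\<delta> > 0" "continuous_on {x\<in>closure \<Omega>. dist_bd \<Omega> x < \<delta>} Du"
    "\<forall>x\<in>{x\<in>\<Omega>. dist_bd \<Omega> x < \<delta>}. (u has_derivative (\<lambda>h. Du x \<bullet> h)) (at x)"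
    "\<forall>x\<in>frontier \<Omega>. norm (Du x) = c"
    using assms(5) by blast
  interpret overdetermined_ground_state \<Omega> p U u Du c \<delta>
    by unfold_locales (use assms pU D in auto)
  show ?thesis
    using c_eq u_eq_dist stadium unfolding inradius_def Lambda_inf_def by blast
qed

end
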